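(* The following three families are in bijection: (1) enriched Eulerian trees; (2) Eulerian trees endowed with a forward matching; (3) rooted Eulerian maps (of arbitrary, unfixed genus). The bijections can be chosen such that, for every $k\ge 1$, the number of nodes of degree $2k$ in families (1) and (2) is preserved and corresponds to the number of vertices of degree $2k$ in family (3). In particular the total half-degree $E$ of the nodes in (1), (2) and of the vertices in (3) is preserved ($E$ is also the number of edges of the map in (3)). The three families are enumerated by the series $r_1(t)$, where $t$ is conjugate to $E$ and each node (resp. vertex) of degree $2k$ is weighted by $g_k$.
   Context: Maps. A map is a cellular embedding of a connected graph (loops and multiple edges allowed) in a closed oriented surface of arbitrary genus, up to orientation-preserving homeomorphism. It is rooted if a corner is marked. It is Eulerian if all vertex degrees are even. A rooted Eulerian map has at least one edge, except that, by convention, the family of rooted Eulerian maps also contains one trivial object with no vertex and $E=0$ (contributing $1$ to the counting series). Blossoming trees. Trees are plane trees; vertices of degree 1 are leaves, the others are nodes. A rooted tree is a plane tree with a marked leaf (the root leaf); it is nodeless if it has a single edge (joining two leaves), otherwise the node adjacent to the root leaf is the root node. A blossoming tree is a rooted tree whose leaves are of two kinds, opening and closing, with as many opening as closing leaves, the root leaf being opening. Leaves are ordered according to a clockwise walk around the tree (outer face on the left) starting with the root leaf. The leaf-path is the path starting at height $1$ obtained by reading the non-root leaves in this order, with an up-step for each opening leaf and a down-step for each closing leaf (it ends at height $0$). A closing leaf has height $h$ if its down-step goes from $h$ to $h-1$. The tree is balanced if all closing leaves have height $\ge 1$. An Eulerian tree is a blossoming tree in which every node has even degree and every node of degree $2k$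 has exactly $k-1$ adjacent opening leaves (not counting the root leaf for the root node). The nodeless tree (one opening root leaf, one closing leaf) is an Eulerian tree. An enriched Eulerian tree is a balanced Eulerian tree in which each closing leaf of height $h$ carries an integer in $\{0,\dots,h-1\}$. A forward matching of a blossoming tree is a perfect matching of the opening leaves (including the root leaf) with the closing leaves such that in each pair the opening leaf appears before the closing leaf in the clockwise walk around the tree (outer face on the left) starting with the root leaf. Series. For $i,k\ge1$ let $\mathcal P_k^{(i)}$ be the set of paths of length $2k-1$ with steps $\pm1$, staying in $\mathbb Z_{\ge 0}$, from height $i$ to height $i-1$. The formal power series $r_i(t)$, $i\ge 1$, in $t$ with coefficients polynomial in the indeterminates $g_1,g_2,\dots$ are uniquely determined by $$r_i(t)=i+\sum_{k\ge1}t^kg_k\sum_{\wp\in\mathcal P_k^{(i)}}\ \prod_{\text{descending steps } h\to h-1 \text{ of }\wp} r_h(t),\qquad i\ge1.$$ *)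

theory Defs
  imports
    "Graph_Theory.Bidirected_Digraph"
    "Graph_Theory.Digraph_Component"
    "HOL-Combinatorics.Orbits"
    "HOL-Computational_Algebra.Formal_Power_Series"
    "HOL-Library.FuncSet"
    "HOL-Library.Multiset"
    "HOL-Library.Poly_Mapping"
begin

section \<open>Blossoming trees\<close>

datatype leaf_kind = Opening | Closing

text \<open>
  A tree rooted at an opening leaf is given by the subtree hanging from that leaf; the
  root leaf itself is implicit. The children of a node are listed in the order in which the
  clockwise walk starting at the root leaf meets them. Since a rooted plane tree has no nontrivial
  automorphism, trees up to homeomorphism are exactly the values of this type with no childless
  node. The nodeless tree is \<open>Leaf Closing\<close>.
\<close>

datatype plane_tree = Leaf leaf_kind | Node "plane_tree list"

text \<open>A node is represented by its list of children.\<close>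

fun nodes :: "plane_tree \<Rightarrow> plane_tree list list" where
  "nodes (Leaf b) = []"
| "nodes (Node ts) = ts # concat (map nodes ts)"

fun hanging_leaves :: "plane_tree \<Rightarrow> leaf_kind list" where
  "hanging_leaves (Leaf b) = [b]"
| "hanging_leaves (Node ts) = concat (map hanging_leaves ts)"

text \<open>All leaves in walk order; the root leaf has position 0.\<close>

definition leaf_seq :: "plane_tree \<Rightarrow> leaf_kind list" where
  "leaf_seq T = Opening # hanging_leaves T"

text \<open>The summand 1 is the edge (or half of the root edge) leading towards the root leaf.\<close>

definition node_degree :: "plane_tree list \<Rightarrow> nat" where
  "node_degree ts = length ts + 1"

definition node_degrees :: "plane_tree \<Rightarrow> nat multiset" where
  "node_degrees T = mset (map node_degree (nodes T))"

definition opening_leaves :: "plane_tree \<Rightarrow> nat set" where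
  "opening_leaves T = {i. i < length (leaf_seq T) \<and> leaf_seq T ! i = Opening}"

definition closing_leaves :: "plane_tree \<Rightarrow> nat set" where
  "closing_leaves T = {i. i < length (leaf_seq T) \<and> leaf_seq T ! i = Closing}"

definition blossoming_tree :: "plane_tree \<Rightarrow> bool" where
  "blossoming_tree T \<longleftrightarrow>
     (\<forall>ts \<in> set (nodes T). node_degree ts \<ge> 2) \<and>
     card (opening_leaves T) = card (closing_leaves T)"

definition eulerian_tree :: "plane_tree \<Rightarrow> bool" where
  "eulerian_tree T \<longleftrightarrow> blossoming_tree T \<and>
     (\<forall>ts \<in> set (nodes T). \<exists>k\<ge>1. node_degree ts = 2 * k \<and>
        length (filter (\<lambda>t. t = Leaf Opening) ts) = k - 1)"

fun leaf_step :: "leaf_kind \<Rightarrow> int" where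
  "leaf_step Opening = 1"
| "leaf_step Closing = -1"

text \<open>
  Height of the leaf-path just before the step of the leaf at position \<open>i \<ge> 1\<close>; for a closing
  leaf this is its height.
\<close>

definition leaf_height :: "plane_tree \<Rightarrow> nat \<Rightarrow> int" where
  "leaf_height T i = 1 + (\<Sum>j = 1..<i. leaf_step (leaf_seq T ! j))"

definition balanced :: "plane_tree \<Rightarrow> bool" where
  "balanced T \<longleftrightarrow> (\<forall>i \<in> closing_leaves T. leaf_height T i \<ge> 1)"

definition enriched_eulerian_trees :: "(plane_tree \<times> (nat \<Rightarrow> int)) set" where
  "enriched_eulerian_trees =
     {(T, c). eulerian_tree T \<and> balanced T \<and>
              c \<in> (\<Pi>\<^sub>E i \<in> closing_leaves T. {0..<leaf_height T i})}"

definition forward_matching :: "plane_tree \<Rightarrow> (nat \<times> nat) set \<Rightarrow> bool" where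
  "forward_matching T M \<longleftrightarrow>
     M \<subseteq> {(i, j). i \<in> opening_leaves T \<and> j \<in> closing_leaves T \<and> i < j} \<and>
     (\<forall>i \<in> opening_leaves T. \<exists>!j. (i, j) \<in> M) \<and>
     (\<forall>j \<in> closing_leaves T. \<exists>!i. (i, j) \<in> M)"

definition matched_eulerian_trees :: "(plane_tree \<times> (nat \<times> nat) set) set" where
  "matched_eulerian_trees = {(T, M). eulerian_tree T \<and> forward_matching T M}"


section \<open>Rooted maps\<close>

text \<open>
  A cellular embedding of a connected graph in a closed oriented surface, up to
  orientation-preserving homeomorphism, is encoded by its rotation system. The graph is a
  finite bidirected multigraph: each edge gives two opposite arcs (its half-edges), exchanged by
  \<open>map_rev\<close>, and an arc is attached to its tail. On the arcs leaving a vertex,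
  \<open>map_rot\<close> is the counterclockwise cyclic order in the surface. The root \<open>map_root\<close> stands for
  the corner between the arcs \<open>map_root\<close> and \<open>map_rot map_root\<close>.
\<close>

record ('v, 'a) map_rep =
  map_graph :: "('v, 'a) pre_digraph"
  map_rev :: "'a \<Rightarrow> 'a"
  map_rot :: "'a \<Rightarrow> 'a"
  map_root :: 'a

definition is_rooted_map :: "('v, 'a) map_rep \<Rightarrow> bool" where
  "is_rooted_map M \<longleftrightarrow>
     fin_digraph (map_graph M) \<and>
     Digraph_Component.connected (map_graph M) \<and>
     bidirected_digraph (map_graph M) (map_rev M) \<and>
     map_rot M permutes arcs (map_graph M) \<and>
     (\<forall>v \<in> verts (map_graph M). out_arcs (map_graph M) v \<noteq> {} \<longrightarrow>
        cyclic_on (map_rot M) (out_arcs (map_graph M) v)) \<and>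
     map_root M \<in> arcs (map_graph M)"

text \<open>
  Commuting with the rotations, rather than with their inverses, is what makes an
  isomorphism orientation-preserving.
\<close>

definition map_iso_by ::
  "('v \<Rightarrow> 'w) \<Rightarrow> ('a \<Rightarrow> 'b) \<Rightarrow> ('v, 'a) map_rep \<Rightarrow> ('w, 'b) map_rep \<Rightarrow> bool" where
  "map_iso_by f h M N \<longleftrightarrow>
     bij_betw f (verts (map_graph M)) (verts (map_graph N)) \<and>
     bij_betw h (arcs (map_graph M)) (arcs (map_graph N)) \<and>
     (\<forall>a \<in> arcs (map_graph M).
        tail (map_graph N) (h a) = f (tail (map_graph M) a) \<and>
        head (map_graph N) (h a) = f (head (map_graph M) a) \<and>
        map_rev N (h a) = h (map_rev M a) \<and>
        map_rot N (h a) = h (map_rot M a)) \<and>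
     map_root N = h (map_root M)"

definition map_iso :: "('v, 'a) map_rep \<Rightarrow> ('w, 'b) map_rep \<Rightarrow> bool" where
  "map_iso M N \<longleftrightarrow> (\<exists>f h. map_iso_by f h M N)"

definition rep_vertex_degrees :: "('v, 'a) map_rep \<Rightarrow> nat multiset" where
  "rep_vertex_degrees M = image_mset (out_degree (map_graph M)) (mset_set (verts (map_graph M)))"

definition rep_num_edges :: "('v, 'a) map_rep \<Rightarrow> nat" where
  "rep_num_edges M = card ((\<lambda>a. {a, map_rev M a}) ` arcs (map_graph M))"

definition map_equiv :: "('v, 'a) map_rep \<Rightarrow> ('v, 'a) map_rep \<Rightarrow> bool" where
  "map_equiv M N \<longleftrightarrow> is_rooted_map M \<and> is_rooted_map N \<and> map_iso M N"

lemma map_iso_by_id: "map_iso_by id id M M"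
  by (simp add: map_iso_by_def)

lemma is_rooted_map_closed:
  assumes "is_rooted_map M" "a \<in> arcs (map_graph M)"
  shows "map_rev M a \<in> arcs (map_graph M)" "map_rot M a \<in> arcs (map_graph M)"
    "tail (map_graph M) a \<in> verts (map_graph M)" "head (map_graph M) a \<in> verts (map_graph M)"
  using assms
  by (auto simp: is_rooted_map_def bidirected_digraph.arev_in_arcs permutes_in_image
      fin_digraph_def wf_digraph.tail_in_verts wf_digraph.head_in_verts)

lemma map_iso_by_inv:
  assumes M: "is_rooted_map M" and i: "map_iso_by f h M N"
  shows "map_iso_by (inv_into (verts (map_graph M)) f) (inv_into (arcs (map_graph M)) h) N M"
proof -
  let ?f = "inv_into (verts (map_graph M)) f" and ?h = "inv_into (arcs (map_graph M)) h"
  have bf: "bij_betw f (verts (map_graph M)) (verts (map_graph N))"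
    and bh: "bij_betw h (arcs (map_graph M)) (arcs (map_graph N))"
    using i by (auto simp: map_iso_by_def)
  have f: "?f (f v) = v" if "v \<in> verts (map_graph M)" for v
    using bf that by (simp add: bij_betw_inv_into_left)
  have h: "?h (h a) = a" if "a \<in> arcs (map_graph M)" for a
    using bh that by (simp add: bij_betw_inv_into_left)
  have "\<forall>b \<in> h ` arcs (map_graph M).
        tail (map_graph M) (?h b) = ?f (tail (map_graph N) b) \<and>
        head (map_graph M) (?h b) = ?f (head (map_graph N) b) \<and>
        map_rev M (?h b) = ?h (map_rev N b) \<and>
        map_rot M (?h b) = ?h (map_rot N b)"
    using i by (auto simp: map_iso_by_def f h is_rooted_map_closed[OF M])
  moreover have "h ` arcs (map_graph M) = arcs (map_graph N)"
    using bh by (simp add: bij_betw_def)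
  moreover have "map_root M = ?h (map_root N)"
    using i M h by (simp add: map_iso_by_def is_rooted_map_def)
  ultimately show ?thesis
    using bf bh unfolding map_iso_by_def by (simp add: bij_betw_inv_into)
qed

lemma map_iso_by_comp:
  assumes "is_rooted_map M" "map_iso_by f h M N" "map_iso_by f' h' N P"
  shows "map_iso_by (f' \<circ> f) (h' \<circ> h) M P"
  using assms unfolding map_iso_by_def
  by (auto intro: bij_betw_trans simp: bij_betw_apply)

lemma map_iso_by_out_arcs:
  assumes M: "is_rooted_map M" and i: "map_iso_by f h M N" and v: "v \<in> verts (map_graph M)"
  shows "out_arcs (map_graph N) (f v) = h ` out_arcs (map_graph M) v"
proof -
  have bh: "arcs (map_graph N) = h ` arcs (map_graph M)"
    and inj: "inj_on f (verts (map_graph M))"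
    using i by (auto simp: map_iso_by_def bij_betw_def)
  have "tail (map_graph N) (h a) = f v \<longleftrightarrow> tail (map_graph M) a = v" if "a \<in> arcs (map_graph M)" for a
    using i that inj_on_eq_iff[OF inj is_rooted_map_closed(3)[OF M that] v]
    by (simp add: map_iso_by_def)
  then show ?thesis
    by (auto simp: out_arcs_def bh)
qed

lemma rep_vertex_degrees_cong:
  assumes "map_equiv M N"
  shows "rep_vertex_degrees M = rep_vertex_degrees N"
proof -
  from assms obtain f h where M: "is_rooted_map M" and i: "map_iso_by f h M N"
    by (auto simp: map_equiv_def map_iso_def)
  have f: "inj_on f (verts (map_graph M))" "f ` verts (map_graph M) = verts (map_graph N)"
    and h: "inj_on h (arcs (map_graph M))"
    using i by (auto simp: map_iso_by_def bij_betw_def)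
  have fin: "finite (verts (map_graph M))"
    using M by (simp add: is_rooted_map_def fin_digraph.finite_verts)
  have deg: "out_degree (map_graph N) (f v) = out_degree (map_graph M) v"
    if "v \<in> verts (map_graph M)" for v
    using map_iso_by_out_arcs[OF M i that] inj_on_subset[OF h]
    by (simp add: out_degree_def card_image out_arcs_def)
  have "mset_set (verts (map_graph N)) = image_mset f (mset_set (verts (map_graph M)))"
    using f by (simp add: image_mset_mset_set)
  then show ?thesis
    unfolding rep_vertex_degrees_def using deg fin
    by (auto simp: multiset.map_comp comp_def intro!: image_mset_cong)
qed

lemma rep_num_edges_cong:
  assumes "map_equiv M N"
  shows "rep_num_edges M = rep_num_edges N"
proof -
  from assms obtain f h where M: "is_rooted_map M" and i: "map_iso_by f h M N"
    by (auto simp: map_equiv_def map_iso_def)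
  have h: "inj_on h (arcs (map_graph M))" "arcs (map_graph N) = h ` arcs (map_graph M)"
    using i by (auto simp: map_iso_by_def bij_betw_def)
  have "(\<lambda>a. {a, map_rev N a}) ` arcs (map_graph N)
      = image h ` (\<lambda>a. {a, map_rev M a}) ` arcs (map_graph M)"
    using i by (auto simp: h(2) map_iso_by_def image_image intro!: image_eqI)
  moreover have "inj_on (image h) ((\<lambda>a. {a, map_rev M a}) ` arcs (map_graph M))"
    by (rule inj_on_subset[OF inj_on_image_Pow[OF h(1)]])
      (auto simp: is_rooted_map_closed[OF M])
  ultimately show ?thesis
    by (simp add: rep_num_edges_def card_image)
qed

text \<open>
  Labels are natural numbers; this loses nothing, as the maps are finite and are
  considered up to isomorphism.
\<close>

quotient_type rooted_map = "(nat, nat) map_rep" / partial: map_equiv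
proof (rule part_equivpI)
  define G :: "(nat, nat) pre_digraph" where
    "G = \<lparr>verts = {0}, arcs = {0, 1}, tail = (\<lambda>_. 0), head = (\<lambda>_. 0)\<rparr>"
  define s :: "nat \<Rightarrow> nat" where "s = Transposition.transpose 0 1"
  have s: "s permutes {0, 1}" unfolding s_def by (rule permutes_swap_id) auto
  have "fin_digraph G" by unfold_locales (auto simp: G_def)
  moreover have "bidirected_digraph G s"
    by unfold_locales (auto simp: G_def s_def Transposition.transpose_def)
  moreover have "Digraph_Component.connected G"
    by (auto simp: Digraph_Component.connected_def strongly_connected_def mk_symmetric_def G_def
        reachable_def intro!: rtrancl_on_refl)
  moreover have "cyclic_on s {0, 1}"
  proof -
    have "s 0 \<in> orbit s 0" "s (s 0) \<in> orbit s 0"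
      by (auto intro: orbit.intros)
    then have "{0, 1} \<subseteq> orbit s 0"
      by (auto simp: s_def)
    moreover have "orbit s 0 \<subseteq> {0, 1}"
      using permutes_orbit_subset[OF s] by auto
    ultimately show ?thesis by (auto simp: cyclic_on_def)
  qed
  moreover have sets: "verts G = {0}" "arcs G = {0, 1}" "out_arcs G 0 = {0, 1}"
    by (auto simp: G_def out_arcs_def)
  ultimately have "is_rooted_map \<lparr>map_graph = G, map_rev = s, map_rot = s, map_root = 0\<rparr>"
    using s sets by (simp add: is_rooted_map_def)
  then show "\<exists>M :: (nat, nat) map_rep. map_equiv M M"
    unfolding map_equiv_def map_iso_def by (metis map_iso_by_id)
  show "symp (map_equiv :: (nat, nat) map_rep \<Rightarrow> _)"
    by (rule sympI) (auto simp: map_equiv_def map_iso_def dest: map_iso_by_inv)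
  show "transp (map_equiv :: (nat, nat) map_rep \<Rightarrow> _)"
    by (rule transpI) (auto simp: map_equiv_def map_iso_def dest: map_iso_by_comp)
qed

lift_definition vertex_degrees :: "rooted_map \<Rightarrow> nat multiset" is rep_vertex_degrees
  by (rule rep_vertex_degrees_cong)

lift_definition num_edges :: "rooted_map \<Rightarrow> nat" is rep_num_edges
  by (rule rep_num_edges_cong)

text \<open>
  \<open>None\<close> is the conventional trivial object with no vertex and no edge. Every other
  object has at least one edge, since it carries a root arc.
\<close>

definition rooted_eulerian_maps :: "rooted_map option set" where
  "rooted_eulerian_maps = insert None (Some ` {m. \<forall>d \<in># vertex_degrees m. even d})"

definition emap_degrees :: "rooted_map option \<Rightarrow> nat multiset" where
  "emap_degrees x = (case x of None \<Rightarrow> {#} | Some m \<Rightarrow> vertex_degrees m)"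

definition emap_edges :: "rooted_map option \<Rightarrow> nat" where
  "emap_edges x = (case x of None \<Rightarrow> 0 | Some m \<Rightarrow> num_edges m)"


section \<open>Generating series\<close>

text \<open>
  Polynomials with integer coefficients in the indeterminates \<open>g\<^sub>1, g\<^sub>2, \<dots>\<close>: monomials are finitely
  supported exponent functions.
\<close>

type_synonym gpoly = "(nat \<Rightarrow>\<^sub>0 nat) \<Rightarrow>\<^sub>0 int"

definition gvar :: "nat \<Rightarrow> gpoly" where
  "gvar k = Poly_Mapping.single (Poly_Mapping.single k 1) 1"

text \<open>
  A path is the list of the \<open>2k\<close> heights it visits; it stays in the nonnegative
  integers by typing.
\<close>

definition height_paths :: "nat \<Rightarrow> nat \<Rightarrow> nat list set" where
  "height_paths i k = {p. length p = 2 * k \<and> p ! 0 = i \<and> p ! (2 * k - 1) + 1 = i \<and>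
     (\<forall>n < 2 * k - 1. p ! (n + 1) = p ! n + 1 \<or> p ! n = p ! (n + 1) + 1)}"

definition descents :: "nat list \<Rightarrow> nat set" where
  "descents p = {n. n + 1 < length p \<and> p ! n = p ! (n + 1) + 1}"

definition r_term :: "(nat \<Rightarrow> gpoly fps) \<Rightarrow> nat \<Rightarrow> nat \<Rightarrow> gpoly fps" where
  "r_term r i k = fps_X ^ k * fps_const (gvar k) *
     (\<Sum>p \<in> height_paths i k. \<Prod>n \<in> descents p. r (p ! n))"

text \<open>
  The summation index is shifted so that \<open>k + 1\<close> ranges over the positive integers; the
  infinite sum is taken in the usual topology of formal power series.
\<close>

definition r_system :: "(nat \<Rightarrow> gpoly fps) \<Rightarrow> bool" where
  "r_system r \<longleftrightarrow> (\<forall>i\<ge>1. (\<lambda>k. r_term r i (k + 1)) sums (r i - of_nat i))"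

text \<open>The system has a solution, and \<open>r i\<close> is uniquely determined by it for \<open>i \<ge> 1\<close>.\<close>

definition agree :: "nat \<Rightarrow> 'a::comm_ring_1 fps \<Rightarrow> 'a fps \<Rightarrow> bool" where
  "agree n a b \<longleftrightarrow> (\<forall>m<n. fps_nth a m = fps_nth b m)"

lemma agree_refl [simp]: "agree n a a"
  by (simp add: agree_def)

lemma agree_mult: "agree n a a' \<Longrightarrow> agree n b b' \<Longrightarrow> agree n (a * b) (a' * b')"
  unfolding agree_def fps_mult_nth by (intro allI impI sum.cong arg_cong2[where f = times]) simp_all

lemma agree_prod: "(\<And>x. x \<in> A \<Longrightarrow> agree n (f x) (g x)) \<Longrightarrow> agree n (prod f A) (prod g A)"
  by (induction A rule: infinite_finite_induct) (simp_all add: agree_mult)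

lemma agree_sum: "(\<And>x. x \<in> A \<Longrightarrow> agree n (f x) (g x)) \<Longrightarrow> agree n (sum f A) (sum g A)"
  unfolding agree_def fps_sum_nth by (intro allI impI sum.cong) simp_all

lemma r_term_agree:
  assumes "\<And>h. h \<ge> 1 \<Longrightarrow> agree n (r h) (r' h)" "m < n + k"
  shows "fps_nth (r_term r i k) m = fps_nth (r_term r' i k) m"
proof -
  let ?S = "\<lambda>r. fps_const (gvar k) * (\<Sum>p \<in> height_paths i k. \<Prod>n \<in> descents p. r (p ! n))"
  have "agree n (?S r) (?S r')"
  proof (rule agree_mult[OF agree_refl agree_sum[OF agree_prod]])
    fix p d assume "d \<in> descents p"
    then have "p ! d \<ge> 1" by (simp add: descents_def)
    then show "agree n (r (p ! d)) (r' (p ! d))" by (rule assms(1))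
  qed
  then have "fps_nth (?S r) (m - k) = fps_nth (?S r') (m - k)" if "\<not> m < k"
    unfolding agree_def using assms(2) that by (auto simp del: fps_mult_left_const_nth)
  then show ?thesis
    unfolding r_term_def mult.assoc fps_X_power_mult_nth by presburger
qed

lemma r_term_nth_0: "n < k \<Longrightarrow> fps_nth (r_term r i k) n = 0"
  unfolding r_term_def mult.assoc fps_X_power_mult_nth by (rule if_P)

lemma r_term_sums_iff:
  "(\<lambda>k. r_term r i (k + 1)) sums s \<longleftrightarrow> (\<forall>n. fps_nth s n = (\<Sum>k<n. fps_nth (r_term r i (k + 1)) n))"
proof -
  have *: "(\<Sum>k<N. fps_nth (r_term r i (k + 1)) n) = (\<Sum>k<n. fps_nth (r_term r i (k + 1)) n)"
    if "n \<le> N" for N n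
    using that by (intro sum.mono_neutral_right) (auto simp: r_term_nth_0)
  have "(\<forall>\<^sub>F N in sequentially. fps_nth (\<Sum>k<N. r_term r i (k + 1)) n = fps_nth s n)
     \<longleftrightarrow> fps_nth s n = (\<Sum>k<n. fps_nth (r_term r i (k + 1)) n)" for n
  proof
    assume "\<forall>\<^sub>F N in sequentially. fps_nth (\<Sum>k<N. r_term r i (k + 1)) n = fps_nth s n"
    then obtain N where N: "\<And>M. M \<ge> N \<Longrightarrow> fps_nth (\<Sum>k<M. r_term r i (k + 1)) n = fps_nth s n"
      unfolding eventually_sequentially by blast
    from N[of "max N n"] *[of n "max N n"] show "fps_nth s n = (\<Sum>k<n. fps_nth (r_term r i (k + 1)) n)"
      by (simp add: fps_sum_nth)
  next
    assume s: "fps_nth s n = (\<Sum>k<n. fps_nth (r_term r i (k + 1)) n)"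
    have "fps_nth (\<Sum>k<N. r_term r i (k + 1)) n = fps_nth s n" if "n \<le> N" for N
      unfolding fps_sum_nth s by (rule *[OF that])
    then show "\<forall>\<^sub>F N in sequentially. fps_nth (\<Sum>k<N. r_term r i (k + 1)) n = fps_nth s n"
      unfolding eventually_sequentially by blast
  qed
  then show ?thesis
    by (simp add: sums_def tendsto_fps_iff)
qed

lemma r_system_iff:
  "r_system r \<longleftrightarrow> (\<forall>i\<ge>1. \<forall>n. fps_nth (r i) n =
     fps_nth (of_nat i) n + (\<Sum>k<n. fps_nth (r_term r i (k + 1)) n))"
proof -
  have "a - b = c \<longleftrightarrow> a = b + c" for a b c :: gpoly
    by (metis add_diff_cancel_left' add_diff_cancel_left diff_add_cancel add.commute)
  then show ?thesis
    unfolding r_system_def r_term_sums_iff fps_sub_nth by (simp only:)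
qed

lemma r_system_unique:
  assumes "r_system r" "r_system r'" "i \<ge> 1"
  shows "r i = r' i"
proof -
  have "\<forall>h\<ge>1. agree n (r h) (r' h)" for n
  proof (induction n)
    case (Suc n)
    have eq: "fps_nth (r_term r h (k + 1)) n = fps_nth (r_term r' h (k + 1)) n" for h k
      by (rule r_term_agree[of n]) (use Suc in auto)
    have "fps_nth (r h) n = fps_nth (r' h) n" if "h \<ge> 1" for h
    proof -
      have "fps_nth (r h) n = fps_nth (of_nat h) n + (\<Sum>k<n. fps_nth (r_term r h (k + 1)) n)"
        using assms(1) that unfolding r_system_iff by blast
      also have "\<dots> = fps_nth (of_nat h) n + (\<Sum>k<n. fps_nth (r_term r' h (k + 1)) n)"
        by (simp only: eq)
      also have "\<dots> = fps_nth (r' h) n"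
        using assms(2) that unfolding r_system_iff by metis
      finally show ?thesis .
    qed
    with Suc show ?case
      unfolding agree_def less_Suc_eq by blast
  qed (simp add: agree_def)
  then show ?thesis
    using assms(3) by (auto simp: agree_def fps_eq_iff)
qed

lemma r_system_exists: "\<exists>r. r_system r"
proof -
  define F :: "(nat \<Rightarrow> gpoly fps) \<Rightarrow> nat \<Rightarrow> gpoly fps" where
    "F r i = Abs_fps (\<lambda>n. fps_nth (of_nat i) n + (\<Sum>k<n. fps_nth (r_term r i (k + 1)) n))" for r i
  have F: "agree (Suc n) (F r i) (F r' i)" if "\<forall>h. agree n (r h) (r' h)" for n r r' i
    unfolding agree_def F_def using that
    by (auto intro!: sum.cong r_term_agree[of n] simp: agree_def)
  define R where "R n = (F ^^ n) (\<lambda>_. 0)" for n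
  have step: "\<forall>i. agree n (R n i) (R (Suc n) i)" for n
  proof (induction n)
    case (Suc n)
    then show ?case using F[OF Suc] by (simp add: R_def)
  qed (simp add: agree_def)
  have le: "fps_nth (R n i) m = fps_nth (R (Suc m) i) m" if "m < n" for n i m
    using that
  proof (induction n)
    case (Suc n)
    then show ?case using step[of n] by (cases "m = n") (auto simp: agree_def)
  qed simp
  define L where "L i = Abs_fps (\<lambda>n. fps_nth (R (Suc n) i) n)" for i
  have "\<forall>i. agree n (L i) (R n i)" for n
    unfolding agree_def L_def using le by (metis fps_nth_Abs_fps)
  then have "agree (Suc n) (F L i) (F (R n) i)" for n i
    by (rule F)
  then have "fps_nth (F L i) n = fps_nth (L i) n" for n i
    unfolding agree_def by (simp add: L_def R_def)
  then have "r_system L"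
    by (simp add: r_system_iff F_def)
  then show ?thesis by blast
qed

definition half_degree :: "nat multiset \<Rightarrow> nat" where
  "half_degree D = (\<Sum>d \<in># D. d div 2)"

definition weight :: "nat multiset \<Rightarrow> gpoly" where
  "weight D = (\<Prod>d \<in># D. gvar (d div 2))"

text \<open>
  \<open>enumerated_by A D s\<close>: the sum over \<open>x \<in> A\<close> of \<open>t ^ half_degree (D x) * weight (D x)\<close> is
  well-defined as a formal power series in \<open>t\<close> and equals \<open>s\<close>.
\<close>

definition enumerated_by :: "'x set \<Rightarrow> ('x \<Rightarrow> nat multiset) \<Rightarrow> gpoly fps \<Rightarrow> bool" where
  "enumerated_by A D s \<longleftrightarrow>
     (\<forall>n. finite {x \<in> A. half_degree (D x) = n} \<and>
          fps_nth s n = (\<Sum>x | x \<in> A \<and> half_degree (D x) = n. weight (D x)))"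

end

theory Submission
  imports Defs "HOL-Combinatorics.Cycles"
begin

text \<open>
  The weight of a degree multiset is a single monomial, so the required bijections exist as soon as all
  three families are enumerated by \<open>r 1\<close>.

  For trees, both the labellings and the forward matchings of a given Eulerian tree are counted by the
  product of the heights of its closing leaves. Decomposing at the root node, a subtree turns height
  \<open>h\<close> into \<open>h - 1\<close> and an opening leaf turns \<open>h\<close> into \<open>h + 1\<close>; hence the series of Eulerian trees
  read from height \<open>i\<close>, with this product as weight, solve the defining system of the \<open>r i\<close>.

  For maps, removing a root loop or contracting a root edge shows that the series of rooted maps with a root
  vertex of degree \<open>n\<close> satisfy the loop equation
  \<open>m (n + 1) = n * m (n - 1) + (\<Sum>k\<ge>1. t^k * g k * m (n + 2 * k - 1))\<close>, which has a unique solution with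
  \<open>m 0 = 1\<close>. It is also satisfied by the weighted path counts from 0 to 0 of length \<open>n\<close>, the moments of the
  orthogonal polynomials with \<open>x * p i = p (i + 1) + r i * p (i - 1)\<close> for the potential
  \<open>V = x^2 / 2 - (\<Sum>k\<ge>1. t^k * g k * x^(2 * k) / (2 * k))\<close>: the system for \<open>r\<close> is the string equation, and
  it makes the strictly lower triangular part of \<open>V'(X)\<close> act as \<open>d/dx\<close>.
\<close>

section \<open>Weighted paths and the loop equation\<close>

text \<open>Why the loop equation is linear: as the genus is free, deleting a loop at the root
  vertex need not cut the map in two. The half-edges on both sides of the loop stay in one cyclic
  order, so the only datum is the position of its second end. This gives the factor
  \<open>n\<close>, where planar maps would give a product of two series. In \<open>m n\<close> the
  root vertex carries no weight and its degree may be odd. The weight is restored at the end: maps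
  with at least one edge have the series \<open>\<Sum>k\<ge>1. t^k * g k * m (2 * k)\<close>. A path
  of length \<open>2 * k\<close> from 0 to 0 starts with a step up, so this is the sum over paths
  from 1 to 0 in the equation for \<open>r 1\<close>; the remaining term 1 there is the trivial map.
  Maps are isomorphism classes and cannot be taken apart inside the quotient. The codes serve as a
  complete invariant with a recursive structure. The system leaves \<open>r 0\<close> open. The tree
  series vanish at index 0, which suppresses steps below height 0 in spite of truncated
  subtraction.\<close>

fun wpaths :: "(nat \<Rightarrow> 'a::comm_ring_1) \<Rightarrow> nat \<Rightarrow> nat \<Rightarrow> nat \<Rightarrow> 'a" where
  "wpaths r 0 i j = (if i = j then 1 else 0)"
| "wpaths r (Suc n) i j = wpaths r n (Suc i) j + r i * wpaths r n (i - 1) j"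

text \<open>\<open>wpaths r n\<close> is the \<open>n\<close>-th power of the one-step matrix; the
  recursion multiplies on the left, this identity on the right. At \<open>i = 0\<close> the index
  \<open>i - 1\<close> is 0 again, so without \<open>r 0 = 0\<close> a step down from 0 would be a
  stationary step of weight \<open>r 0\<close>.\<close>

lemma wpaths_last_step:
  assumes "r 0 = 0"
  shows "wpaths r (Suc n) i j =
    (if j = 0 then 0 else wpaths r n i (j - 1)) + r (Suc j) * wpaths r n i (Suc j)"
proof (induction n arbitrary: i)
  case 0
  show ?case
    using assms by (cases i; cases j) auto
next
  case (Suc n)
  have "wpaths r (Suc (Suc n)) i j = wpaths r (Suc n) (Suc i) j + r i * wpaths r (Suc n) (i - 1) j"
    by simp
  also have "\<dots> = (if j = 0 then 0 else wpaths r (Suc n) i (j - 1)) + r (Suc j) * wpaths r (Suc n) i (Suc j)"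
    unfolding Suc by (simp add: algebra_simps)
  finally show ?case .
qed

lemma wpaths_parity: "r 0 = 0 \<Longrightarrow> odd (n + i + j) \<Longrightarrow> wpaths r n i j = 0"
proof (induction n arbitrary: i)
  case (Suc n)
  have "wpaths r n (Suc i) j = 0" "i > 0 \<Longrightarrow> wpaths r n (i - 1) j = 0"
    using Suc.prems(2) by (intro Suc.IH Suc.prems(1); simp)+
  then show ?case
    using Suc.prems(1) by (cases "i = 0") auto
qed auto

lemma wpaths_eq_0: "i + n < j \<Longrightarrow> wpaths r n i j = 0"
  by (induction n arbitrary: i) auto

text \<open>Matrix product: row \<open>i\<close> of the \<open>m\<close>-th power is supported on
  columns up to \<open>i + m\<close>, so the infinite sum may be cut at any such
  \<open>N\<close>.\<close>

lemma wpaths_add: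
  "i + m \<le> N \<Longrightarrow> wpaths r (m + n) i j = (\<Sum>l\<le>N. wpaths r m i l * wpaths r n l j)"
proof (induction m arbitrary: i)
  case 0
  have "(\<Sum>l\<le>N. wpaths r 0 i l * wpaths r n l j) = (\<Sum>l\<le>N. if i = l then wpaths r n l j else 0)"
    by (intro sum.cong) auto
  then show ?case
    using 0 by simp
next
  case (Suc m)
  then show ?case
    by (simp add: distrib_right sum.distrib sum_distrib_left mult.assoc)
qed

text \<open>The factor of \<open>a k\<close> is the weight of a vertex of degree
  \<open>2 * (k + 1)\<close>. It has order \<open>k + 1\<close> in \<open>t\<close>, so the cut at
  \<open>k < n\<close> is exact and no limit has to be taken.\<close>

definition vertex_sum :: "(nat \<Rightarrow> gpoly fps) \<Rightarrow> gpoly fps" where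
  "vertex_sum a = Abs_fps (\<lambda>n. \<Sum>k<n. fps_nth (fps_X ^ (k + 1) * fps_const (gvar (k + 1)) * a k) n)"

lemma vertex_term_nth:
  "fps_nth (fps_X ^ (k + 1) * fps_const (gvar (k + 1)) * a) n =
    (if n < k + 1 then 0 else gvar (k + 1) * fps_nth a (n - (k + 1)))"
  by (simp only: mult.assoc fps_X_power_mult_nth fps_mult_left_const_nth)

lemma vertex_sum_nth:
  "fps_nth (vertex_sum a) n = (\<Sum>k<n. gvar (k + 1) * fps_nth (a k) (n - (k + 1)))"
  unfolding vertex_sum_def fps_nth_Abs_fps by (intro sum.cong) (simp_all only: vertex_term_nth lessThan_iff, auto)

lemma vertex_sum_nth_le:
  assumes "n \<le> N"
  shows "fps_nth (vertex_sum a) n =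
    (\<Sum>k<N. fps_nth (fps_X ^ (k + 1) * fps_const (gvar (k + 1)) * a k) n)"
  unfolding vertex_sum_def fps_nth_Abs_fps
proof (rule sum.mono_neutral_left)
  show "\<forall>k\<in>{..<N} - {..<n}. fps_nth (fps_X ^ (k + 1) * fps_const (gvar (k + 1)) * a k) n = 0"
    unfolding vertex_term_nth by simp
qed (use assms in auto)

lemma vertex_sum_0 [simp]: "vertex_sum (\<lambda>k. 0) = 0"
  by (simp add: fps_eq_iff vertex_sum_nth)

lemma vertex_sum_add: "vertex_sum (\<lambda>k. a k + b k) = vertex_sum a + vertex_sum b"
  by (simp add: fps_eq_iff vertex_sum_nth sum.distrib algebra_simps)

lemma vertex_sum_mult: "vertex_sum (\<lambda>k. c * a k) = c * vertex_sum a"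
proof (rule fps_ext)
  fix n
  let ?t = "\<lambda>k. fps_X ^ (k + 1) * fps_const (gvar (k + 1)) * a k"
  \<comment> \<open>All coefficients up to \<open>n\<close> can share the cutoff \<open>n\<close>;
    with one finite sum for all of them, \<open>c\<close> distributes.\<close>
  have "fps_nth (vertex_sum a) (n - i) = fps_nth (\<Sum>k<n. ?t k) (n - i)" for i
    unfolding fps_sum_nth by (rule vertex_sum_nth_le) simp
  then have "fps_nth (c * vertex_sum a) n = (\<Sum>i=0..n. fps_nth c i * fps_nth (\<Sum>k<n. ?t k) (n - i))"
    by (simp only: fps_mult_nth[of c])
  also have "\<dots> = fps_nth (c * (\<Sum>k<n. ?t k)) n"
    by (simp only: fps_mult_nth)
  also have "\<dots> = (\<Sum>k<n. fps_nth (fps_X ^ (k + 1) * fps_const (gvar (k + 1)) * (c * a k)) n)"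
    unfolding sum_distrib_left fps_sum_nth by (intro sum.cong refl arg_cong2[where f = fps_nth]) (simp only: mult_ac)
  finally show "fps_nth (vertex_sum (\<lambda>k. c * a k)) n = fps_nth (c * vertex_sum a) n"
    by (simp add: vertex_sum_def)
qed

lemma vertex_sum_sum: "vertex_sum (\<lambda>k. \<Sum>x\<in>A. f x k) = (\<Sum>x\<in>A. vertex_sum (f x))"
  by (induction A rule: infinite_finite_induct) (simp_all add: vertex_sum_add)

text \<open>Decomposition at the first step. Finiteness is proved along with the sum because
  splitting it into the two families needs finite sets.\<close>

lemma sum_height_paths:
  assumes "r 0 = 0"
  defines "S n i j \<equiv> {p. length p = Suc n \<and> p ! 0 = i \<and> p ! n = j \<and>
     (\<forall>m<n. p ! (m + 1) = p ! m + 1 \<or> p ! m = p ! (m + 1) + 1)}"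
  shows "finite (S n i j) \<and> (\<Sum>p\<in>S n i j. \<Prod>m\<in>descents p. r (p ! m)) = wpaths r n i j"
proof (induction n arbitrary: i)
  case 0
  have "S 0 i j = (if i = j then {[i]} else {})"
    unfolding S_def by (auto simp: length_Suc_conv)
  then show ?case
    by (simp add: descents_def)
next
  case (Suc n)
  have ne: "p \<noteq> []" if "p \<in> S n i' j" for p i'
    using that by (auto simp: S_def)
  have S: "S (Suc n) i j = (#) i ` S n (Suc i) j \<union> (if i = 0 then {} else (#) i ` S n (i - 1) j)"
  proof (intro set_eqI iffI)
    fix p assume p: "p \<in> S (Suc n) i j"
    then obtain q where q: "p = i # q" "length q = Suc n"
      by (auto simp: S_def length_Suc_conv)
    from p have st: "\<And>m. m < Suc n \<Longrightarrow> p ! (m + 1) = p ! m + 1 \<or> p ! m = p ! (m + 1) + 1" "p ! Suc n = j"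
      by (auto simp: S_def)
    have "q ! (m + 1) = q ! m + 1 \<or> q ! m = q ! (m + 1) + 1" if "m < n" for m
      using st(1)[of "Suc m"] that q by simp
    moreover have "q ! 0 = Suc i \<or> i \<noteq> 0 \<and> q ! 0 = i - 1"
      using st(1)[of 0] q by auto
    ultimately show "p \<in> (#) i ` S n (Suc i) j \<union> (if i = 0 then {} else (#) i ` S n (i - 1) j)"
      using q st(2) by (auto simp: S_def)
  next
    fix p assume "p \<in> (#) i ` S n (Suc i) j \<union> (if i = 0 then {} else (#) i ` S n (i - 1) j)"
    then obtain q where p: "p = i # q" and q: "q \<in> S n (Suc i) j \<or> i \<noteq> 0 \<and> q \<in> S n (i - 1) j"
      by (auto split: if_splits)
    have "p ! (m + 1) = p ! m + 1 \<or> p ! m = p ! (m + 1) + 1" if "m < Suc n" for m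
      using q that unfolding p by (cases m) (auto simp: S_def)
    then show "p \<in> S (Suc n) i j"
      using q unfolding p by (auto simp: S_def)
  qed
  have desc: "descents (i # q) = (if i = q ! 0 + 1 then {0} else {}) \<union> Suc ` descents q" if "q \<noteq> []" for q
  proof (intro set_eqI)
    fix m
    show "m \<in> descents (i # q) \<longleftrightarrow> m \<in> (if i = q ! 0 + 1 then {0} else {}) \<union> Suc ` descents q"
      using that by (cases m) (auto simp: descents_def image_iff)
  qed
  have fd: "finite (descents q)" for q
    by (rule finite_subset[of _ "{..<length q}"]) (auto simp: descents_def)
  have prod: "(\<Prod>m\<in>descents (i # q). r ((i # q) ! m)) =
      (if i = q ! 0 + 1 then r i else 1) * (\<Prod>m\<in>descents q. r (q ! m))" if "q \<noteq> []" for q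
    using that by (simp add: desc prod.reindex fd)
  have disj: "(#) i ` S n (Suc i) j \<inter> (#) i ` S n (i - 1) j = {}"
    by (auto simp: S_def)
  have up: "(\<Sum>p\<in>(#) i ` S n (Suc i) j. \<Prod>m\<in>descents p. r (p ! m)) = wpaths r n (Suc i) j"
  proof -
    have "(\<Sum>p\<in>(#) i ` S n (Suc i) j. \<Prod>m\<in>descents p. r (p ! m)) =
        (\<Sum>p\<in>S n (Suc i) j. \<Prod>m\<in>descents (i # p). r ((i # p) ! m))"
      by (simp add: sum.reindex[OF inj_on_Cons1])
    also have "\<dots> = (\<Sum>p\<in>S n (Suc i) j. \<Prod>m\<in>descents p. r (p ! m))"
    proof (rule sum.cong)
      fix p assume p: "p \<in> S n (Suc i) j"
      then have "i \<noteq> p ! 0 + 1" by (simp add: S_def)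
      then show "(\<Prod>m\<in>descents (i # p). r ((i # p) ! m)) = (\<Prod>m\<in>descents p. r (p ! m))"
        unfolding prod[OF ne[OF p]] by simp
    qed simp
    finally show ?thesis using Suc by simp
  qed
  have down: "(\<Sum>p\<in>(#) i ` S n (i - 1) j. \<Prod>m\<in>descents p. r (p ! m)) = r i * wpaths r n (i - 1) j"
    if "i \<noteq> 0"
  proof -
    have "(\<Sum>p\<in>(#) i ` S n (i - 1) j. \<Prod>m\<in>descents p. r (p ! m)) =
        (\<Sum>p\<in>S n (i - 1) j. r i * (\<Prod>m\<in>descents p. r (p ! m)))"
      unfolding sum.reindex[OF inj_on_Cons1] comp_def
    proof (rule sum.cong)
      fix p assume p: "p \<in> S n (i - 1) j"
      then have "i = p ! 0 + 1" using that by (simp add: S_def)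
      then show "(\<Prod>m\<in>descents (i # p). r ((i # p) ! m)) = r i * (\<Prod>m\<in>descents p. r (p ! m))"
        unfolding prod[OF ne[OF p]] by simp
    qed simp
    then show ?thesis
      using Suc[of "i - 1"] by (simp add: sum_distrib_left[symmetric])
  qed
  show ?case
    using Suc[of "Suc i"] Suc[of "i - 1"] up down disj assms(1) unfolding S
    by (auto simp: sum.union_disjoint)
qed

text \<open>Restates the system without limits and height lists; with the shifted index, the path
  length \<open>2k - 1\<close> reads \<open>2 * k + 1\<close>.\<close>

lemma r_system_iff_vertex_sum:
  assumes "r 0 = 0"
  shows "r_system r \<longleftrightarrow> (\<forall>i\<ge>1. r i = of_nat i + vertex_sum (\<lambda>k. wpaths r (2 * k + 1) i (i - 1)))"
proof -
  have paths: "(\<Sum>p\<in>height_paths i (k + 1). \<Prod>n\<in>descents p. r (p ! n)) = wpaths r (2 * k + 1) i (i - 1)"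
    if "i \<ge> 1" for i k
  proof -
    have "height_paths i (k + 1) = {p. length p = Suc (2 * k + 1) \<and> p ! 0 = i \<and> p ! (2 * k + 1) = i - 1 \<and>
       (\<forall>m<2 * k + 1. p ! (m + 1) = p ! m + 1 \<or> p ! m = p ! (m + 1) + 1)}"
      using that by (auto simp: height_paths_def)
    then show ?thesis
      using sum_height_paths[where r = r, OF assms, of "2 * k + 1" i "i - 1"] by simp
  qed
  show ?thesis
    unfolding r_system_iff fps_eq_iff fps_add_nth vertex_sum_def fps_nth_Abs_fps r_term_def
    by (simp only: paths cong: imp_cong)
qed

text \<open>In the basis of the orthogonal polynomials, row 0 of the \<open>n\<close>-th power of
  the path matrix holds the coordinates of \<open>x^n\<close>, and column 0 extracts the moment. The
  equation says that \<open>n * x^(n - 1)\<close> and \<open>x^n * V'\<close> have the same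
  moment.\<close>

lemma loop_equation:
  assumes r0: "r 0 = 0" and sys: "r_system r"
  shows "wpaths r (Suc n) 0 0 =
    of_nat n * wpaths r (n - 1) 0 0 + vertex_sum (\<lambda>k. wpaths r (n + 2 * k + 1) 0 0)"
proof -
  \<comment> \<open>\<open>X\<close> is the one-step path matrix, \<open>W = V'(X)\<close> and \<open>D\<close> is the strictly lower triangular part of \<open>W\<close>.\<close>
  define W where "W i j = wpaths r 1 i j - vertex_sum (\<lambda>k. wpaths r (2 * k + 1) i j)" for i j
  define D where "D i j = (if j < i then W i j else 0)" for i j
  have W_diag: "W i i = 0" for i
  proof -
    have "wpaths r (2 * k + 1) i i = 0" for k
      by (rule wpaths_parity) (auto simp: r0)
    then show ?thesis
      unfolding W_def using wpaths_parity[where r = r, OF r0, of 1 i i] by simp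
  qed
  \<comment> \<open>The string equation at \<open>i + 1\<close>. The value is the factor that
    \<open>d/dx\<close> puts in front of the leading term of \<open>p (i + 1)\<close>.\<close>
  have W_sub: "W (Suc i) i = of_nat (Suc i)" for i
  proof -
    have "r (Suc i) = of_nat (Suc i) + vertex_sum (\<lambda>k. wpaths r (2 * k + 1) (Suc i) i)"
      using sys[unfolded r_system_iff_vertex_sum[where r = r, OF r0], rule_format, of "Suc i"] by simp
    then have "r (Suc i) - vertex_sum (\<lambda>k. wpaths r (2 * k + 1) (Suc i) i) = of_nat (Suc i)"
      by (metis add_diff_cancel_right')
    moreover have "wpaths r 1 (Suc i) i = r (Suc i)"
      by simp
    ultimately show ?thesis
      by (simp only: W_def)
  qed
  \<comment> \<open>\<open>W\<close> is a series in powers of \<open>X\<close> and so commutes with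
    \<open>X\<close>; for each power this is first step against last step.\<close>
  have W_comm: "W (Suc i) j + r i * W (i - 1) j =
      (if j = 0 then 0 else W i (j - 1)) + r (Suc j) * W i (Suc j)" for i j
  proof -
    have "wpaths r k (Suc i) j + r i * wpaths r k (i - 1) j =
       (if j = 0 then 0 else wpaths r k i (j - 1)) + r (Suc j) * wpaths r k i (Suc j)" for k
      using wpaths_last_step[where r = r, OF r0, of k i j] by simp
    note eq = this
    have "vertex_sum (\<lambda>k. wpaths r (2 * k + 1) (Suc i) j + r i * wpaths r (2 * k + 1) (i - 1) j) =
       vertex_sum (\<lambda>k. (if j = 0 then 0 else wpaths r (2 * k + 1) i (j - 1)) + r (Suc j) * wpaths r (2 * k + 1) i (Suc j))"
      by (simp only: eq)
    then show ?thesis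
      using eq[of 1] unfolding vertex_sum_add vertex_sum_mult W_def
      by (auto simp: algebra_simps split: if_splits)
  qed
  \<comment> \<open>\<open>[D, X] = 1\<close>: off the diagonal this is \<open>[W, X] = 0\<close>, since \<open>[D, X]\<close> only has lowering and
    diagonal entries and \<open>[W - D, X]\<close> only has raising and diagonal ones; on the diagonal it is \<open>r_system\<close>.\<close>
  have D_comm: "D (Suc i) j + r i * D (i - 1) j =
      (if i = j then 1 else 0) + (if j = 0 then 0 else D i (j - 1)) + r (Suc j) * D i (Suc j)" for i j
  proof -
    consider "Suc j < i" | "i = Suc j" | "i = j" | "i < j"
      by linarith
    then show ?thesis
    proof cases
      case 1
      then show ?thesis
        using W_comm[of i j] by (auto simp: D_def)
    next
      case 2
      then show ?thesis
        using W_comm[of i j] by (auto simp: D_def W_diag)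
    next
      \<comment> \<open>The entries of \<open>W\<close> just below the diagonal are
        \<open>i + 1\<close> and \<open>i\<close> in neighbouring rows; their difference is the 1 of
        the commutator.\<close>
      case 3
      then show ?thesis
        using W_sub[of i] W_sub[of "i - 1"] by (cases i) (auto simp: D_def r0)
    qed (auto simp: D_def)
  qed
  \<comment> \<open>The Leibniz rule: \<open>X^(m + 1) * D = X^m * (1 + D * X)\<close>, read in row
    0, where \<open>D\<close> itself vanishes. As \<open>m \<le> N\<close>, the truncation keeps
    every nonzero entry of row 0 of \<open>X^m\<close>.\<close>
  have D_power: "(\<Sum>i\<le>N. wpaths r m 0 i * D i j) = of_nat m * wpaths r (m - 1) 0 j"
    if "m \<le> N" for m N j
    using that
  proof (induction m arbitrary: j N)
    case 0
    have "wpaths r 0 0 i * D i j = 0" for i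
      by (simp add: D_def)
    then show ?case by (simp only: sum.neutral_const) simp
  next
    case (Suc m)
    have "(\<Sum>i\<le>N. wpaths r (Suc m) 0 i * D i j)
        = (\<Sum>i\<le>N. (if i = 0 then 0 else wpaths r m 0 (i - 1)) * D i j) + (\<Sum>i\<le>N. wpaths r m 0 (Suc i) * (r (Suc i) * D i j))"
      unfolding wpaths_last_step[where r = r, OF r0] distrib_right sum.distrib by (simp only: mult_ac)
    also have "(\<Sum>i\<le>N. (if i = 0 then 0 else wpaths r m 0 (i - 1)) * D i j) = (\<Sum>i\<le>N. wpaths r m 0 i * D (Suc i) j)"
    proof -
      obtain N' where N': "N = Suc N'"
        using Suc.prems by (cases N) auto
      have "wpaths r m 0 N = 0"
        using Suc.prems by (intro wpaths_eq_0) simp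
      then show ?thesis
        unfolding N' by (subst sum.atMost_Suc_shift) simp
    qed
    also have "(\<Sum>i\<le>N. wpaths r m 0 (Suc i) * (r (Suc i) * D i j)) = (\<Sum>i\<le>N. wpaths r m 0 i * (r i * D (i - 1) j))"
    proof -
      have "wpaths r m 0 (Suc N) = 0"
        using Suc.prems by (intro wpaths_eq_0) simp
      then have "(\<Sum>i\<le>N. wpaths r m 0 (Suc i) * (r (Suc i) * D i j)) + wpaths r m 0 0 * (r 0 * D (0 - 1) j) =
          (\<Sum>i\<le>Suc N. wpaths r m 0 i * (r i * D (i - 1) j))"
        by (subst sum.atMost_Suc_shift) (simp add: add.commute)
      then show ?thesis
        using \<open>wpaths r m 0 (Suc N) = 0\<close> by (simp add: r0)
    qed
    also have "(\<Sum>i\<le>N. wpaths r m 0 i * D (Suc i) j) + \<dots> =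
        (\<Sum>i\<le>N. wpaths r m 0 i * (D (Suc i) j + r i * D (i - 1) j))"
      by (simp add: sum.distrib distrib_left)
    also have "\<dots> = (\<Sum>i\<le>N. (if i = j then wpaths r m 0 i else 0) +
        ((if j = 0 then 0 else wpaths r m 0 i * D i (j - 1)) + r (Suc j) * (wpaths r m 0 i * D i (Suc j))))"
      unfolding D_comm by (intro sum.cong) (auto simp: algebra_simps)
    also have "\<dots> = wpaths r m 0 j + ((if j = 0 then 0 else (\<Sum>i\<le>N. wpaths r m 0 i * D i (j - 1))) +
        r (Suc j) * (\<Sum>i\<le>N. wpaths r m 0 i * D i (Suc j)))"
      using Suc.prems wpaths_eq_0[of 0 m j r] by (auto simp: sum.distrib sum_distrib_left)
    also have "\<dots> = wpaths r m 0 j + of_nat m * ((if j = 0 then 0 else wpaths r (m - 1) 0 (j - 1)) +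
        r (Suc j) * wpaths r (m - 1) 0 (Suc j))"
      unfolding Suc.IH[OF Suc_leD[OF Suc.prems]] by (simp add: algebra_simps)
    also have "\<dots> = of_nat (Suc m) * wpaths r m 0 j"
      using wpaths_last_step[where r = r, OF r0, of "m - 1" 0 j] by (cases m) (simp_all add: algebra_simps)
    finally show ?case by simp
  qed
  have "of_nat n * wpaths r (n - 1) 0 0 = (\<Sum>i\<le>n. wpaths r n 0 i * D i 0)"
    by (simp add: D_power)
  \<comment> \<open>In column 0 the matrices \<open>D\<close> and \<open>W\<close> could differ only
    on the diagonal, where both are 0.\<close>
  also have "\<dots> = (\<Sum>i\<le>n. wpaths r n 0 i * W i 0)"
    using W_diag[of 0] by (intro sum.cong) (auto simp: D_def)
  also have "\<dots> = (\<Sum>i\<le>n. wpaths r n 0 i * wpaths r 1 i 0) -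
      vertex_sum (\<lambda>k. \<Sum>i\<le>n. wpaths r n 0 i * wpaths r (2 * k + 1) i 0)"
    unfolding W_def vertex_sum_sum vertex_sum_mult by (simp only: right_diff_distrib sum_subtractf)
  also have "\<dots> = wpaths r (n + 1) 0 0 - vertex_sum (\<lambda>k. wpaths r (n + (2 * k + 1)) 0 0)"
    by (simp only: wpaths_add[of 0 n n r, symmetric] add_0 order_refl)
  finally show ?thesis
    by (simp add: algebra_simps)
qed

text \<open>The vertex terms raise the index but lower the order in \<open>t\<close>; the other term
  keeps the order but lowers the index. Hence an outer induction on the order and an inner one on
  the index.\<close>

lemma loop_equation_unique:
  assumes a: "a 0 = 1" "\<And>n. a (Suc n) = of_nat n * a (n - 1) + vertex_sum (\<lambda>k. a (n + 2 * k + 1))"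
    and b: "b 0 = 1" "\<And>n. b (Suc n) = of_nat n * b (n - 1) + vertex_sum (\<lambda>k. b (n + 2 * k + 1))"
  shows "a n = b n"
proof -
  have "fps_nth (a n) m = fps_nth (b n) m" for m n
  proof (induction m arbitrary: n rule: less_induct)
    case (less m)
    show ?case
    proof (induction n rule: less_induct)
      case inner: (less n)
      show ?case
      proof (cases n)
        case 0
        then show ?thesis using a b by simp
      next
        case (Suc n')
        have "fps_nth (vertex_sum (\<lambda>k. a (n' + 2 * k + 1))) m = fps_nth (vertex_sum (\<lambda>k. b (n' + 2 * k + 1))) m"
          unfolding vertex_sum_nth using less by (intro sum.cong) auto
        moreover have "fps_nth (of_nat n' * a (n' - 1)) m = fps_nth (of_nat n' * b (n' - 1)) m"
          using inner[of "n' - 1"] Suc by (simp add: fps_of_nat[symmetric] del: fps_of_nat)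
        ultimately show ?thesis
          unfolding Suc a(2) b(2) fps_add_nth by simp
      qed
    qed
  qed
  then show ?thesis by (rule fps_ext)
qed

section \<open>Weighted counting by degrees\<close>

lemma half_degree_simps [simp]:
  "half_degree {#} = 0" "half_degree (add_mset d D) = d div 2 + half_degree D"
  "half_degree (D + D') = half_degree D + half_degree D'"
  by (simp_all add: half_degree_def)

lemma weight_simps [simp]:
  "weight {#} = 1" "weight (add_mset d D) = gvar (d div 2) * weight D"
  "weight (D + D') = weight D * weight D'"
  by (simp_all add: weight_def)

definition graded_finite :: "'x set \<Rightarrow> ('x \<Rightarrow> nat multiset) \<Rightarrow> bool" where
  "graded_finite A D \<longleftrightarrow> (\<forall>n. finite {x \<in> A. half_degree (D x) = n})"

text \<open>The multiplicity \<open>c\<close> counts decorations of an object without listing them.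
  A sum over an infinite grade would silently be 0, so \<open>graded_finite\<close> accompanies this
  series.\<close>

definition wgf :: "'x set \<Rightarrow> ('x \<Rightarrow> nat multiset) \<Rightarrow> ('x \<Rightarrow> nat) \<Rightarrow> gpoly fps" where
  "wgf A D c = Abs_fps (\<lambda>n. \<Sum>x | x \<in> A \<and> half_degree (D x) = n. of_nat (c x) * weight (D x))"

lemma enumerated_by_iff_wgf: "enumerated_by A D s \<longleftrightarrow> graded_finite A D \<and> s = wgf A D (\<lambda>_. 1)"
  by (auto simp: enumerated_by_def graded_finite_def wgf_def fps_eq_iff)

lemma graded_finite_subset:
  assumes "graded_finite B D" "A \<subseteq> B"
  shows "graded_finite A D"
  unfolding graded_finite_def
proof
  fix n
  have "{x \<in> A. half_degree (D x) = n} \<subseteq> {x \<in> B. half_degree (D x) = n}"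
    using assms(2) by blast
  moreover have "finite {x \<in> B. half_degree (D x) = n}"
    using assms(1) unfolding graded_finite_def by (rule spec)
  ultimately show "finite {x \<in> A. half_degree (D x) = n}"
    by (rule finite_subset)
qed

lemma graded_finite_image:
  assumes "graded_finite A D" "\<And>x. x \<in> A \<Longrightarrow> D' (f x) = D x"
  shows "graded_finite (f ` A) D'"
  unfolding graded_finite_def
proof
  fix n
  have "{y \<in> f ` A. half_degree (D' y) = n} \<subseteq> f ` {x \<in> A. half_degree (D x) = n}"
    using assms(2) by auto
  then show "finite {y \<in> f ` A. half_degree (D' y) = n}"
    by (rule finite_subset) (use assms(1) in \<open>simp add: graded_finite_def\<close>)
qed

lemma wgf_reindex:
  assumes "bij_betw f A B" "\<And>x. x \<in> A \<Longrightarrow> D' (f x) = D x" "\<And>x. x \<in> A \<Longrightarrow> c' (f x) = c x"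
  shows "wgf B D' c' = wgf A D c"
proof -
  have inj: "inj_on f {x \<in> A. half_degree (D x) = n}" for n
    using assms(1) by (auto simp: bij_betw_def inj_on_def)
  have "{y \<in> B. half_degree (D' y) = n} = f ` {x \<in> A. half_degree (D x) = n}" for n
    using assms(1,2) by (auto simp: bij_betw_def)
  then show ?thesis
    using assms(2,3) by (auto simp: wgf_def fps_eq_iff sum.reindex[OF inj] intro!: sum.cong)
qed

lemma wgf_cong:
  assumes "A = B" "\<And>x. x \<in> B \<Longrightarrow> D x = D' x" "\<And>x. x \<in> B \<Longrightarrow> c x = c' x"
  shows "wgf A D c = wgf B D' c'"
  using wgf_reindex[of id B A D D' c c'] assms by (auto simp: bij_betw_def)

lemma wgf_empty [simp]: "wgf {} D c = 0"
  by (simp add: wgf_def fps_eq_iff)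

lemma wgf_Un:
  assumes "graded_finite A D" "graded_finite B D" "A \<inter> B = {}"
  shows "wgf (A \<union> B) D c = wgf A D c + wgf B D c"
proof (rule fps_ext)
  fix n
  have "{x \<in> A \<union> B. half_degree (D x) = n} =
      {x \<in> A. half_degree (D x) = n} \<union> {x \<in> B. half_degree (D x) = n}"
    by auto
  then show "fps_nth (wgf (A \<union> B) D c) n = fps_nth (wgf A D c + wgf B D c) n"
    unfolding wgf_def fps_nth_Abs_fps fps_add_nth
    by (subst sum.union_disjoint[symmetric]) (use assms in \<open>auto simp: graded_finite_def\<close>)
qed

lemma graded_finite_insert [simp]: "graded_finite (insert x A) D \<longleftrightarrow> graded_finite A D"
proof -
  have "finite {y \<in> insert x A. half_degree (D y) = n} \<longleftrightarrow> finite {y \<in> A. half_degree (D y) = n}" for n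
  proof -
    have "{y \<in> insert x A. half_degree (D y) = n} =
        (if half_degree (D x) = n then insert x {y \<in> A. half_degree (D y) = n} else {y \<in> A. half_degree (D y) = n})"
      by auto
    then show ?thesis by simp
  qed
  then show ?thesis by (simp add: graded_finite_def)
qed

lemma graded_finite_empty [simp]: "graded_finite {} D"
  by (simp add: graded_finite_def)

lemma wgf_singleton: "D x = {#} \<Longrightarrow> wgf {x} D c = of_nat (c x)"
proof (rule fps_ext)
  fix n assume "D x = {#}"
  then have "{y \<in> {x}. half_degree (D y) = n} = (if n = 0 then {x} else {})"
    by auto
  with \<open>D x = {#}\<close> show "fps_nth (wgf {x} D c) n = fps_nth (of_nat (c x)) n"
    by (simp add: wgf_def fps_of_nat[symmetric] del: fps_of_nat)
qed

lemma graded_finite_Times: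
  assumes "graded_finite A D" "graded_finite B D'"
  shows "graded_finite (A \<times> B) (\<lambda>(x, y). D x + D' y)"
  unfolding graded_finite_def
proof
  fix n
  have "{z \<in> A \<times> B. half_degree (case z of (x, y) \<Rightarrow> D x + D' y) = n} \<subseteq>
      (\<Union>i\<le>n. {x \<in> A. half_degree (D x) = i} \<times> {y \<in> B. half_degree (D' y) = n - i})"
    by auto
  then show "finite {z \<in> A \<times> B. half_degree (case z of (x, y) \<Rightarrow> D x + D' y) = n}"
    by (rule finite_subset) (use assms in \<open>auto simp: graded_finite_def\<close>)
qed

lemma wgf_Times:
  assumes "graded_finite A D" "graded_finite B D'"
  shows "wgf (A \<times> B) (\<lambda>(x, y). D x + D' y) (\<lambda>(x, y). c x * c' y) = wgf A D c * wgf B D' c'"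
proof (rule fps_ext)
  fix n
  let ?A = "\<lambda>i. {x \<in> A. half_degree (D x) = i}" and ?B = "\<lambda>i. {y \<in> B. half_degree (D' y) = i}"
  let ?f = "\<lambda>z. of_nat (case z of (x, y) \<Rightarrow> c x * c' y) * weight (case z of (x, y) \<Rightarrow> D x + D' y) :: gpoly"
  have "{z \<in> A \<times> B. half_degree (case z of (x, y) \<Rightarrow> D x + D' y) = n} = (\<Union>i\<in>{0..n}. ?A i \<times> ?B (n - i))"
    by auto
  then have "fps_nth (wgf (A \<times> B) (\<lambda>(x, y). D x + D' y) (\<lambda>(x, y). c x * c' y)) n =
      (\<Sum>z\<in>(\<Union>i\<in>{0..n}. ?A i \<times> ?B (n - i)). ?f z)"
    by (simp add: wgf_def)
  also have "\<dots> = (\<Sum>i=0..n. \<Sum>z\<in>?A i \<times> ?B (n - i). ?f z)"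
    by (rule sum.UNION_disjoint) (use assms in \<open>auto simp: graded_finite_def\<close>)
  also have "\<dots> = (\<Sum>i=0..n. fps_nth (wgf A D c) i * fps_nth (wgf B D' c') (n - i))"
    unfolding wgf_def fps_nth_Abs_fps sum_product sum.cartesian_product
    by (intro sum.cong) (auto simp: mult_ac)
  finally show "fps_nth (wgf (A \<times> B) (\<lambda>(x, y). D x + D' y) (\<lambda>(x, y). c x * c' y)) n =
      fps_nth (wgf A D c * wgf B D' c') n"
    by (simp add: fps_mult_nth)
qed

text \<open>Trades the multiplicity for actual decorated objects.\<close>

lemma enumerated_by_Sigma:
  assumes "graded_finite A D" "\<And>x. x \<in> A \<Longrightarrow> finite (B x)"
  shows "enumerated_by (Sigma A B) (\<lambda>z. D (fst z)) (wgf A D (\<lambda>x. card (B x)))"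
  unfolding enumerated_by_def
proof (intro allI conjI)
  fix n
  let ?A = "{x \<in> A. half_degree (D x) = n}"
  have eq: "{z \<in> Sigma A B. half_degree (D (fst z)) = n} = Sigma ?A B"
    by auto
  have fin: "finite ?A"
    using assms(1) by (simp add: graded_finite_def)
  show "finite {z \<in> Sigma A B. half_degree (D (fst z)) = n}"
    unfolding eq using fin assms(2) by (intro finite_SigmaI) auto
  show "fps_nth (wgf A D (\<lambda>x. card (B x))) n =
      (\<Sum>z | z \<in> Sigma A B \<and> half_degree (D (fst z)) = n. weight (D (fst z)))"
    unfolding eq using sum.Sigma[OF fin, of B "\<lambda>x y. weight (D x)"] assms(2)
    by (simp add: wgf_def split_def)
qed

lemma vertices_fibre:
  "{z \<in> Sigma UNIV A. half_degree (case z of (k, x) \<Rightarrow> add_mset (2 * (k + 1)) (D x)) = n} =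
    Sigma {..<n} (\<lambda>k. {x \<in> A k. half_degree (D x) = n - (k + 1)})"
  by auto

text \<open>Although \<open>k\<close> is unbounded, the new vertex alone adds \<open>k + 1\<close>
  to the grade, so only \<open>k < n\<close> reach grade \<open>n\<close>.\<close>

lemma graded_finite_vertices:
  assumes "\<And>k. graded_finite (A k) D"
  shows "graded_finite (Sigma UNIV A) (\<lambda>(k, x). add_mset (2 * (k + 1)) (D x))"
  unfolding graded_finite_def vertices_fibre
  using assms by (intro allI finite_SigmaI) (auto simp: graded_finite_def)

lemma wgf_vertices:
  assumes "\<And>k. graded_finite (A k) D"
  shows "wgf (Sigma UNIV A) (\<lambda>(k, x). add_mset (2 * (k + 1)) (D x)) (\<lambda>(k, x). c k x) =
    vertex_sum (\<lambda>k. wgf (A k) D (c k))"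
proof (rule fps_ext)
  fix n
  let ?f = "\<lambda>k x. of_nat (c k x) * (gvar (k + 1) * weight (D x))"
  have "fps_nth (wgf (Sigma UNIV A) (\<lambda>(k, x). add_mset (2 * (k + 1)) (D x)) (\<lambda>(k, x). c k x)) n =
      (\<Sum>(k, x)\<in>Sigma {..<n} (\<lambda>k. {x \<in> A k. half_degree (D x) = n - (k + 1)}). ?f k x)"
    unfolding wgf_def fps_nth_Abs_fps vertices_fibre by (intro sum.cong) auto
  also have "\<dots> = (\<Sum>k<n. \<Sum>x\<in>{x \<in> A k. half_degree (D x) = n - (k + 1)}. ?f k x)"
    by (rule sum.Sigma[symmetric]) (use assms in \<open>auto simp: graded_finite_def\<close>)
  also have "\<dots> = fps_nth (vertex_sum (\<lambda>k. wgf (A k) D (c k))) n"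
    unfolding vertex_sum_nth wgf_def fps_nth_Abs_fps sum_distrib_left
    by (intro sum.cong) (auto simp: mult_ac)
  finally show "fps_nth (wgf (Sigma UNIV A) (\<lambda>(k, x). add_mset (2 * (k + 1)) (D x)) (\<lambda>(k, x). c k x)) n =
      fps_nth (vertex_sum (\<lambda>k. wgf (A k) D (c k))) n" .
qed

section \<open>Eulerian trees\<close>

text \<open>A closing leaf met at height 0 gives the factor 0. This makes the truncated
  \<open>h - 1\<close> harmless and removes unbalanced trees from every count.\<close>

fun height_prod :: "nat \<Rightarrow> leaf_kind list \<Rightarrow> nat" where
  "height_prod h [] = 1"
| "height_prod h (Opening # w) = height_prod (h + 1) w"
| "height_prod h (Closing # w) = h * height_prod (h - 1) w"

definition net :: "leaf_kind list \<Rightarrow> int" where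
  "net w = sum_list (map leaf_step w)"

lemma net_simps [simp]: "net [] = 0" "net (b # w) = leaf_step b + net w" "net (v @ w) = net v + net w"
  by (simp_all add: net_def)

lemma net_concat: "net (concat ws) = sum_list (map net ws)"
  by (induction ws) auto

lemma height_prod_append:
  "height_prod h (v @ w) = height_prod h v * height_prod (nat (int h + net v)) w"
proof (induction h v rule: height_prod.induct)
  case (3 h v)
  show ?case
  proof (cases h)
    case (Suc h')
    then show ?thesis using 3 by (simp add: algebra_simps)
  qed simp
qed (simp_all add: algebra_simps)

text \<open>A walk that ends below 0 contains a step down from 0, whose factor is 0.\<close>

lemma height_prod_eq_0: "int h + net w < 0 \<Longrightarrow> height_prod h w = 0"
proof (induction h w rule: height_prod.induct)
  case (3 h w)
  then show ?case by (cases h) (simp_all add: algebra_simps)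
qed (simp_all add: algebra_simps)

lemma height_prod_conv_prod:
  "height_prod 0 w = (\<Prod>i | i < length w \<and> w ! i = Closing. nat (net (take i w)))"
proof (induction w rule: rev_induct)
  case (snoc b w)
  have "{i. i < length (w @ [b]) \<and> (w @ [b]) ! i = Closing} =
      {i. i < length w \<and> w ! i = Closing} \<union> (if b = Closing then {length w} else {})"
    by (auto simp: nth_append less_Suc_eq)
  then have "(\<Prod>i | i < length (w @ [b]) \<and> (w @ [b]) ! i = Closing. nat (net (take i (w @ [b])))) =
      (\<Prod>i | i < length w \<and> w ! i = Closing. nat (net (take i w))) *
      (if b = Closing then nat (net w) else 1)"
    by (auto simp: prod.insert_if mult.commute intro!: prod.cong)
  then show ?case
    using snoc by (cases b) (auto simp: height_prod_append)
qed simp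

lemma net_eq_card:
  "net w = int (card {i. i < length w \<and> w ! i = Opening}) - int (card {i. i < length w \<and> w ! i = Closing})"
proof -
  have "net w = int (length (filter (\<lambda>b. b = Opening) w)) - int (length (filter (\<lambda>b. b = Closing) w))"
  proof (induction w)
    case (Cons b w)
    then show ?case by (cases b) auto
  qed simp
  then show ?thesis by (simp add: length_filter_conv_card)
qed

definition eulerian_node :: "plane_tree list \<Rightarrow> bool" where
  "eulerian_node ts \<longleftrightarrow>
     (\<exists>k\<ge>1. node_degree ts = 2 * k \<and> length (filter (\<lambda>t. t = Leaf Opening) ts) = k - 1)"

lemma eulerian_node_iff:
  "eulerian_node ts \<longleftrightarrow> length ts = 2 * length (filter (\<lambda>t. t = Leaf Opening) ts) + 1"
  unfolding eulerian_node_def node_degree_def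
  by (auto intro!: exI[of _ "Suc (length (filter (\<lambda>t. t = Leaf Opening) ts))"])

lemma sum_list_pm1: "(\<Sum>t\<leftarrow>ts. if P t then 1 else - 1 :: int) = 2 * int (length (filter P ts)) - int (length ts)"
  by (induction ts) auto

text \<open>A node of degree \<open>2k\<close> has \<open>2k - 1\<close> children:
  \<open>k - 1\<close> opening leaves counting \<open>+1\<close> and \<open>k\<close> other subtrees
  counting \<open>-1\<close>.\<close>

lemma net_hanging_leaves:
  assumes "\<forall>ts\<in>set (nodes T). eulerian_node ts"
  shows "net (hanging_leaves T) = (if T = Leaf Opening then 1 else - 1)"
  using assms
proof (induction T)
  case (Leaf b)
  then show ?case by (cases b) auto
next
  case (Node ts)
  have "net (hanging_leaves (Node ts)) = (\<Sum>t\<leftarrow>ts. net (hanging_leaves t))"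
    by (simp add: net_concat comp_def)
  also have "\<dots> = (\<Sum>t\<leftarrow>ts. if t = Leaf Opening then 1 else - 1)"
    using Node by (intro arg_cong[of _ _ sum_list] map_cong) auto
  also have "\<dots> = - 1"
    using Node.prems unfolding sum_list_pm1 by (simp add: eulerian_node_iff)
  finally show ?case by simp
qed

text \<open>The local conditions give net height \<open>-1\<close> below the root leaf, so the
  global balance of opening and closing leaves is automatic, except for the tree made of two opening
  leaves.\<close>

lemma eulerian_tree_iff_nodes:
  "eulerian_tree T \<longleftrightarrow> T \<noteq> Leaf Opening \<and> (\<forall>ts\<in>set (nodes T). eulerian_node ts)"
proof -
  have "card (opening_leaves T) = card (closing_leaves T) \<longleftrightarrow> net (leaf_seq T) = 0"
    by (simp add: net_eq_card opening_leaves_def closing_leaves_def)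
  also have "\<dots> \<longleftrightarrow> T \<noteq> Leaf Opening" if "\<forall>ts\<in>set (nodes T). eulerian_node ts"
    using net_hanging_leaves[OF that] by (simp add: leaf_seq_def)
  finally show ?thesis
    unfolding eulerian_tree_def blossoming_tree_def eulerian_node_def[symmetric]
    by (auto simp: eulerian_node_iff node_degree_def)
qed

lemma eulerian_tree_Leaf [simp]: "eulerian_tree (Leaf b) \<longleftrightarrow> b = Closing"
  by (cases b) (auto simp: eulerian_tree_iff_nodes)

lemma eulerian_tree_Node:
  "eulerian_tree (Node ts) \<longleftrightarrow> eulerian_node ts \<and> (\<forall>t\<in>set ts. t = Leaf Opening \<or> eulerian_tree t)"
  by (auto simp: eulerian_tree_iff_nodes)

lemma net_eulerian_tree: "eulerian_tree T \<Longrightarrow> net (hanging_leaves T) = - 1"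
  by (simp add: eulerian_tree_iff_nodes net_hanging_leaves)

section \<open>Decomposition of Eulerian trees at the root node\<close>

definition forest_degrees :: "plane_tree list \<Rightarrow> nat multiset" where
  "forest_degrees ts = sum_list (map node_degrees ts)"

lemma forest_degrees_simps [simp]:
  "forest_degrees [] = {#}" "forest_degrees (t # ts) = node_degrees t + forest_degrees ts"
  by (simp_all add: forest_degrees_def)

lemma node_degrees_simps [simp]:
  "node_degrees (Leaf b) = {#}"
  "node_degrees (Node ts) = add_mset (length ts + 1) (forest_degrees ts)"
proof -
  have "mset (map node_degree (concat (map nodes ts))) = forest_degrees ts"
    by (induction ts) (auto simp: node_degrees_def)
  then show "node_degrees (Node ts) = add_mset (length ts + 1) (forest_degrees ts)"
    by (simp add: node_degrees_def node_degree_def)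
qed (simp add: node_degrees_def)

lemma half_degree_forest: "t \<in> set ts \<Longrightarrow> half_degree (node_degrees t) \<le> half_degree (forest_degrees ts)"
  by (induction ts) auto

text \<open>The root node contributes at least 1 to the half-degree and bounds the number of its
  children, so a tree is a bounded list of trees of smaller grade.\<close>

lemma graded_finite_eulerian_trees: "graded_finite {T. eulerian_tree T} node_degrees"
proof -
  let ?E = "\<lambda>n. {T. eulerian_tree T \<and> half_degree (node_degrees T) < n}"
  have "finite (?E n)" for n
  proof (induction n)
    case (Suc n)
    let ?L = "{ts. set ts \<subseteq> insert (Leaf Opening) (?E n) \<and> length ts \<le> 2 * n + 1}"
    have "?E (Suc n) \<subseteq> insert (Leaf Closing) (Node ` ?L)"
    proof
      fix T assume T: "T \<in> ?E (Suc n)"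
      show "T \<in> insert (Leaf Closing) (Node ` ?L)"
      proof (cases T)
        case (Leaf b)
        then show ?thesis using T by simp
      next
        case (Node ts)
        then have hd: "(length ts + 1) div 2 + half_degree (forest_degrees ts) \<le> n"
          and et: "\<forall>t\<in>set ts. t = Leaf Opening \<or> eulerian_tree t" "odd (length ts)"
          using T by (auto simp: eulerian_tree_Node eulerian_node_iff)
        have "half_degree (node_degrees t) < n" if "t \<in> set ts" for t
          using half_degree_forest[OF that] hd et(2) by (auto elim!: oddE)
        then show ?thesis
          using hd et Node by auto
      qed
    qed
    moreover have "finite ?L"
      using Suc by (intro finite_lists_length_le) auto
    ultimately show ?case
      by (auto intro: finite_subset)
  qed simp
  then show ?thesis
    unfolding graded_finite_def by (auto intro: finite_subset[of _ "?E (Suc _)"])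
qed

definition tree_series :: "nat \<Rightarrow> gpoly fps" where
  "tree_series i = wgf {T. eulerian_tree T} node_degrees (\<lambda>T. height_prod i (hanging_leaves T))"

lemma tree_series_0: "tree_series 0 = 0"
proof -
  have "height_prod 0 (hanging_leaves T) = 0" if "eulerian_tree T" for T
    using net_eulerian_tree[OF that] by (intro height_prod_eq_0) simp
  then show ?thesis
    by (simp add: tree_series_def wgf_def fps_eq_iff)
qed

text \<open>The last condition says that a walk from height \<open>i\<close>, up at each opening
  leaf and down across each Eulerian tree, ends at height \<open>j\<close>; it is written additively
  to avoid subtraction.\<close>

definition forests :: "nat \<Rightarrow> nat \<Rightarrow> nat \<Rightarrow> plane_tree list set" where
  "forests n i j = {ts. length ts = n \<and> (\<forall>t\<in>set ts. t = Leaf Opening \<or> eulerian_tree t) \<and>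
     i + 2 * length (filter (\<lambda>t. t = Leaf Opening) ts) = j + n}"

lemma graded_finite_tree_lists:
  "graded_finite {ts. length ts = n \<and> (\<forall>t\<in>set ts. t = Leaf Opening \<or> eulerian_tree t)} forest_degrees"
    (is "graded_finite (?L n) _")
proof (induction n)
  case 0
  have "?L 0 = {[]}" by auto
  then show ?case by simp
next
  case (Suc n)
  let ?I = "insert (Leaf Opening) {T. eulerian_tree T}"
  have "?L (Suc n) = (\<lambda>(t, ts). t # ts) ` (?I \<times> ?L n)"
    by (auto simp: length_Suc_conv image_iff)
  moreover have "graded_finite (?I \<times> ?L n) (\<lambda>(t, ts). node_degrees t + forest_degrees ts)"
    by (rule graded_finite_Times) (simp_all add: graded_finite_eulerian_trees Suc)
  ultimately show ?case
    by (auto intro: graded_finite_image)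
qed

lemma graded_finite_forests: "graded_finite (forests n i j) forest_degrees"
  by (rule graded_finite_subset[OF graded_finite_tree_lists[of n]]) (auto simp: forests_def)

text \<open>Each member of the forest is one step of a path: an opening leaf is a rise of weight 1,
  a tree read from height \<open>i\<close> is a descent of weight
  \<open>tree_series i\<close>.\<close>

lemma forests_series:
  "wgf (forests n i j) forest_degrees (\<lambda>ts. height_prod i (concat (map hanging_leaves ts))) =
     wpaths tree_series n i j"
proof (induction n arbitrary: i)
  case 0
  have "forests 0 i j = (if i = j then {[]} else {})"
    by (auto simp: forests_def)
  then show ?case by (simp add: wgf_singleton)
next
  case (Suc n)
  let ?E = "{T. eulerian_tree T}"
  let ?c = "\<lambda>i ts. height_prod i (concat (map hanging_leaves ts))"
  \<comment> \<open>This is \<open>forests n (i - 1) j\<close> only for positive \<open>i\<close>.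
    At \<open>i = 0\<close> the two sets may differ, but both products carry the factor
    \<open>tree_series 0 = 0\<close>.\<close>
  let ?F = "{ts. length ts = n \<and> (\<forall>t\<in>set ts. t = Leaf Opening \<or> eulerian_tree t) \<and>
     i + 2 * length (filter (\<lambda>t. t = Leaf Opening) ts) = j + Suc n}"
  let ?up = "(#) (Leaf Opening) ` forests n (Suc i) j"
  let ?down = "(\<lambda>(t, ts). t # ts) ` (?E \<times> ?F)"
  have "ts \<in> forests (Suc n) i j \<longleftrightarrow> ts \<in> ?up \<union> ?down" for ts
  proof (cases ts)
    case (Cons t us)
    then show ?thesis
      by (cases "t = Leaf Opening") (auto simp: forests_def image_iff)
  qed (auto simp: forests_def)
  then have split: "forests (Suc n) i j = ?up \<union> ?down"
    by blast
  have disj: "?up \<inter> ?down = {}"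
    by auto
  have F: "graded_finite ?F forest_degrees"
    by (rule graded_finite_subset[OF graded_finite_tree_lists[of n]]) auto
  have fin: "graded_finite ?up forest_degrees" "graded_finite ?down forest_degrees"
    by (rule graded_finite_subset[OF graded_finite_forests[of "Suc n" i j]], simp add: split)+
  have up: "wgf ?up forest_degrees (?c i) = wpaths tree_series n (Suc i) j"
    unfolding Suc[of "Suc i", symmetric]
    by (rule wgf_reindex[of "(#) (Leaf Opening)"]) (auto simp: bij_betw_def)
  have "wgf ?down forest_degrees (?c i) =
      wgf (?E \<times> ?F) (\<lambda>(t, ts). node_degrees t + forest_degrees ts)
        (\<lambda>(t, ts). height_prod i (hanging_leaves t) * ?c (i - 1) ts)"
  proof (rule wgf_reindex[of "\<lambda>(t, ts). t # ts"])
    show "bij_betw (\<lambda>(t, ts). t # ts) (?E \<times> ?F) ?down"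
      by (auto simp: bij_betw_def inj_on_def)
    fix z assume "z \<in> ?E \<times> ?F"
    moreover have "nat (int i - 1) = i - 1"
      by (simp add: nat_diff_distrib')
    ultimately show "?c i (case z of (t, ts) \<Rightarrow> t # ts) =
        (case z of (t, ts) \<Rightarrow> height_prod i (hanging_leaves t) * ?c (i - 1) ts)"
      by (auto simp: height_prod_append net_eulerian_tree)
  qed auto
  also have "\<dots> = tree_series i * wgf ?F forest_degrees (?c (i - 1))"
    unfolding tree_series_def by (rule wgf_Times[OF graded_finite_eulerian_trees F])
  also have "\<dots> = tree_series i * wpaths tree_series n (i - 1) j"
  proof (cases i)
    case (Suc i')
    then have "?F = forests n (i - 1) j"
      by (auto simp: forests_def)
    then show ?thesis
      using Suc.IH[of "i - 1"] by simp
  qed (simp add: tree_series_0)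
  finally show ?case
    unfolding split wgf_Un[OF fin disj] up by simp
qed

lemma r_system_tree_series: "r_system tree_series"
  unfolding r_system_iff_vertex_sum[where r = tree_series, OF tree_series_0]
proof (intro allI impI)
  fix i :: nat assume i: "i \<ge> 1"
  let ?c = "\<lambda>ts. height_prod i (concat (map hanging_leaves ts))"
  let ?A = "Sigma UNIV (\<lambda>k. forests (2 * k + 1) i (i - 1))"
  let ?N = "(\<lambda>(k, ts). Node ts) ` ?A"
  have "eulerian_tree T \<longleftrightarrow> T \<in> {Leaf Closing} \<union> ?N" for T
  proof (cases T)
    case (Node ts)
    \<comment> \<open>The degree condition at the root node is the same as a total descent by one,
      from \<open>i\<close> to \<open>i - 1\<close>, over an odd number of children.\<close>
    have "eulerian_node ts \<longleftrightarrow> (\<exists>k. length ts = 2 * k + 1 \<and>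
        i + 2 * length (filter (\<lambda>t. t = Leaf Opening) ts) = i - 1 + (2 * k + 1))"
      using i by (auto simp: eulerian_node_iff)
    then show ?thesis
      unfolding Node by (auto simp: eulerian_tree_Node forests_def image_iff)
  qed auto
  then have split: "{T. eulerian_tree T} = {Leaf Closing} \<union> ?N"
    by blast
  have disj: "{Leaf Closing} \<inter> ?N = {}"
    by auto
  have N: "graded_finite ?N node_degrees"
    by (rule graded_finite_subset[OF graded_finite_eulerian_trees]) (use split in blast)
  have "wgf ?N node_degrees (\<lambda>T. height_prod i (hanging_leaves T)) =
      wgf ?A (\<lambda>(k, ts). add_mset (2 * (k + 1)) (forest_degrees ts)) (\<lambda>(k, ts). ?c ts)"
  proof (rule wgf_reindex[of "\<lambda>(k, ts). Node ts"])
    show "bij_betw (\<lambda>(k, ts). Node ts) ?A ?N"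
      by (rule inj_on_imp_bij_betw) (auto simp: inj_on_def forests_def)
    fix z assume "z \<in> ?A"
    then obtain k ts where z: "z = (k, ts)" "length ts = 2 * k + 1"
      by (auto simp: forests_def)
    show "node_degrees (case z of (k, ts) \<Rightarrow> Node ts) =
        (case z of (k, ts) \<Rightarrow> add_mset (2 * (k + 1)) (forest_degrees ts))"
      by (simp add: z)
    show "height_prod i (hanging_leaves (case z of (k, ts) \<Rightarrow> Node ts)) = (case z of (k, ts) \<Rightarrow> ?c ts)"
      by (simp add: z)
  qed
  also have "\<dots> = vertex_sum (\<lambda>k. wgf (forests (2 * k + 1) i (i - 1)) forest_degrees ?c)"
    by (rule wgf_vertices[where c = "\<lambda>k. ?c"]) (rule graded_finite_forests)
  also have "\<dots> = vertex_sum (\<lambda>k. wpaths tree_series (2 * k + 1) i (i - 1))"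
    by (simp only: forests_series)
  finally have nodes: "wgf ?N node_degrees (\<lambda>T. height_prod i (hanging_leaves T)) =
      vertex_sum (\<lambda>k. wpaths tree_series (2 * k + 1) i (i - 1))" .
  have "tree_series i = wgf ({Leaf Closing} \<union> ?N) node_degrees (\<lambda>T. height_prod i (hanging_leaves T))"
    by (simp only: tree_series_def[of i] split)
  also have "\<dots> = wgf {Leaf Closing} node_degrees (\<lambda>T. height_prod i (hanging_leaves T)) +
      wgf ?N node_degrees (\<lambda>T. height_prod i (hanging_leaves T))"
    by (rule wgf_Un[OF _ N disj]) simp
  also have "wgf {Leaf Closing} node_degrees (\<lambda>T. height_prod i (hanging_leaves T)) = of_nat i"
    by (subst wgf_singleton) simp_all
  finally show "tree_series i = of_nat i + vertex_sum (\<lambda>k. wpaths tree_series (2 * k + 1) i (i - 1))"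
    by (simp only: nodes)
qed

section \<open>Enriched and matched trees\<close>

lemma leaf_seq_0 [simp]: "leaf_seq T ! 0 = Opening"
  by (simp add: leaf_seq_def)

lemma net_take: "i \<le> length w \<Longrightarrow> net (take i w) = (\<Sum>j<i. leaf_step (w ! j))"
  by (induction i) (simp_all add: take_Suc_conv_app_nth)

lemma leaf_height_eq_net:
  assumes "i \<in> closing_leaves T"
  shows "leaf_height T i = net (take i (leaf_seq T))"
proof -
  have i: "i \<noteq> 0" "i < length (leaf_seq T)"
    using assms by (auto simp: closing_leaves_def intro!: gr0I)
  \<comment> \<open>The root leaf, at position 0, is the up-step behind the initial 1 in
    \<open>leaf_height\<close>.\<close>
  have "{..<i} = insert 0 {1..<i}"
    using i(1) by auto
  then show ?thesis
    using i(2) by (simp add: leaf_height_def net_take)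
qed

lemma finite_closing_leaves [simp]: "finite (closing_leaves T)"
  by (simp add: closing_leaves_def)

lemma height_prod_eq_prod_closing:
  "height_prod 1 (hanging_leaves T) = (\<Prod>i\<in>closing_leaves T. nat (net (take i (leaf_seq T))))"
  using height_prod_conv_prod[of "leaf_seq T"] by (simp add: closing_leaves_def leaf_seq_def)

definition labellings :: "plane_tree \<Rightarrow> (nat \<Rightarrow> int) set" where
  "labellings T = (\<Pi>\<^sub>E i\<in>closing_leaves T. {0..<leaf_height T i})"

lemma finite_labellings: "finite (labellings T)"
  unfolding labellings_def by (rule finite_PiE) simp_all

text \<open>An interval with nonpositive upper end is empty, in agreement with \<open>nat\<close>;
  unbalanced trees get 0 on both sides.\<close>

lemma card_labellings: "card (labellings T) = height_prod 1 (hanging_leaves T)"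
  unfolding labellings_def height_prod_eq_prod_closing
  by (subst card_PiE) (auto simp: leaf_height_eq_net intro!: prod.cong)

text \<open>Balancedness is implied, as a closing leaf of height at most 0 has no admissible label.\<close>

lemma enriched_eulerian_trees_eq: "enriched_eulerian_trees = Sigma {T. eulerian_tree T} labellings"
proof -
  have "balanced T" if "c \<in> labellings T" for T c
    unfolding balanced_def
  proof
    fix i assume "i \<in> closing_leaves T"
    then have "c i \<in> {0..<leaf_height T i}"
      using that unfolding labellings_def by (rule PiE_mem[rotated])
    then show "leaf_height T i \<ge> 1" by simp
  qed
  then show ?thesis
    unfolding enriched_eulerian_trees_def labellings_def[symmetric] by blast
qed

text \<open>Opening letters may stay unmatched here.\<close>

definition prefix_matchings :: "leaf_kind list \<Rightarrow> nat \<Rightarrow> (nat \<times> nat) set set" where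
  "prefix_matchings w n = {M. M \<subseteq> {(i, j). i < j \<and> j < n \<and> w ! i = Opening \<and> w ! j = Closing} \<and>
     (\<forall>j<n. w ! j = Closing \<longrightarrow> (\<exists>!i. (i, j) \<in> M)) \<and>
     (\<forall>i j j'. (i, j) \<in> M \<longrightarrow> (i, j') \<in> M \<longrightarrow> j = j')}"

section \<open>Counting matchings letter by letter\<close>

lemma finite_prefix_matchings: "finite (prefix_matchings w n)"
proof (rule finite_subset)
  show "prefix_matchings w n \<subseteq> Pow ({..<n} \<times> {..<n})"
    by (auto simp: prefix_matchings_def)
qed simp

lemma card_Domain_prefix_matching:
  assumes "M \<in> prefix_matchings w n"
  shows "card (Domain M) = card {j. j < n \<and> w ! j = Closing}"
proof -
  have M: "M \<subseteq> {(i, j). i < j \<and> j < n \<and> w ! i = Opening \<and> w ! j = Closing}"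
    "\<And>j. j < n \<Longrightarrow> w ! j = Closing \<Longrightarrow> \<exists>!i. (i, j) \<in> M"
    "\<And>i j j'. (i, j) \<in> M \<Longrightarrow> (i, j') \<in> M \<Longrightarrow> j = j'"
    using assms by (auto simp: prefix_matchings_def)
  have "inj_on fst M"
    using M(3) by (auto simp: inj_on_def)
  moreover have "inj_on snd M"
    using M(1,2) by (fastforce simp: inj_on_def)
  moreover have "snd ` M = {j. j < n \<and> w ! j = Closing}"
    using M(1,2) by force
  ultimately show ?thesis
    by (metis Domain_fst card_image)
qed

text \<open>A closing letter chooses its partner among the opening letters still free before it.
  Earlier closing letters have used one each, so the number of choices is the current height,
  whatever the earlier choices were.\<close>

lemma card_prefix_matchings:
  assumes "n \<le> length w"
  shows "card (prefix_matchings w n) = (\<Prod>i | i < n \<and> w ! i = Closing. nat (net (take i w)))"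
  using assms
proof (induction n)
  case 0
  have "prefix_matchings w 0 = {{}}"
    by (auto simp: prefix_matchings_def)
  then show ?case by simp
next
  case (Suc n)
  show ?case
  proof (cases "w ! n")
    case Opening
    then have less: "j < Suc n \<and> w ! j = Closing \<longleftrightarrow> j < n \<and> w ! j = Closing" for j
      by (auto simp: less_Suc_eq)
    have "prefix_matchings w (Suc n) = prefix_matchings w n"
    proof -
      have "{(i, j). i < j \<and> j < Suc n \<and> w ! i = Opening \<and> w ! j = Closing} =
          {(i, j). i < j \<and> j < n \<and> w ! i = Opening \<and> w ! j = Closing}"
        using less by blast
      moreover have "(\<forall>j<Suc n. w ! j = Closing \<longrightarrow> P j) \<longleftrightarrow> (\<forall>j<n. w ! j = Closing \<longrightarrow> P j)" for P
        using less by blast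
      ultimately show ?thesis
        unfolding prefix_matchings_def by simp
    qed
    with Suc less show ?thesis by simp
  next
    case Closing
    define free where "free M = {i. i < n \<and> w ! i = Opening} - Domain M" for M :: "(nat \<times> nat) set"
    have bij: "bij_betw (\<lambda>(M, i). insert (i, n) M) (Sigma (prefix_matchings w n) free) (prefix_matchings w (Suc n))"
    \<comment> \<open>The inverse splits off the pair that ends at \<open>n\<close>.\<close>
    proof (rule bij_betw_byWitness[where f' = "\<lambda>M. (M - {m. snd m = n}, THE i. (i, n) \<in> M)"])
      have old: "(i, n) \<notin> M" if "M \<in> prefix_matchings w n" for M i
        using that by (auto simp: prefix_matchings_def)
      show "\<forall>z\<in>Sigma (prefix_matchings w n) free.
          ((case z of (M, i) \<Rightarrow> insert (i, n) M) - {m. snd m = n},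
           THE i. (i, n) \<in> (case z of (M, i) \<Rightarrow> insert (i, n) M)) = z"
        by (auto simp: old)
      show "\<forall>M\<in>prefix_matchings w (Suc n).
          (case (M - {m. snd m = n}, THE i. (i, n) \<in> M) of (M, i) \<Rightarrow> insert (i, n) M) = M"
      proof
        fix M assume "M \<in> prefix_matchings w (Suc n)"
        then have ex: "\<exists>!i. (i, n) \<in> M"
          using Closing by (auto simp: prefix_matchings_def)
        then have "(THE i. (i, n) \<in> M, n) \<in> M"
          by (rule theI')
        with ex show "(case (M - {m. snd m = n}, THE i. (i, n) \<in> M) of (M, i) \<Rightarrow> insert (i, n) M) = M"
          by auto
      qed
      show "(\<lambda>(M, i). insert (i, n) M) ` Sigma (prefix_matchings w n) free \<subseteq> prefix_matchings w (Suc n)"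
      proof clarify
        fix M i assume M: "M \<in> prefix_matchings w n" and i: "i \<in> free M"
        have "\<exists>!i'. (i', j) \<in> insert (i, n) M" if "j < Suc n" "w ! j = Closing" for j
        proof (cases "j = n")
          case True
          then show ?thesis using old[OF M] by auto
        next
          case False
          then have "\<exists>!i'. (i', j) \<in> M"
            using that M by (auto simp: prefix_matchings_def)
          then show ?thesis using False by auto
        qed
        then show "insert (i, n) M \<in> prefix_matchings w (Suc n)"
          using M i Closing unfolding prefix_matchings_def free_def
          by (auto simp: less_Suc_eq)
      qed
      show "(\<lambda>M. (M - {m. snd m = n}, THE i. (i, n) \<in> M)) ` prefix_matchings w (Suc n)
          \<subseteq> Sigma (prefix_matchings w n) free"
      proof clarify
        fix M assume M: "M \<in> prefix_matchings w (Suc n)"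
        then have ex: "\<exists>!i. (i, n) \<in> M"
          using Closing by (auto simp: prefix_matchings_def)
        then have the: "(THE i. (i, n) \<in> M, n) \<in> M"
          by (rule theI')
        have "\<exists>!i. (i, j) \<in> M - {m. snd m = n}" if "j < n" "w ! j = Closing" for j
        proof -
          have "\<exists>!i. (i, j) \<in> M"
            using that M by (auto simp: prefix_matchings_def)
          then show ?thesis using that by auto
        qed
        then have "M - {m. snd m = n} \<in> prefix_matchings w n"
          using M unfolding prefix_matchings_def by (auto simp: less_Suc_eq)
        moreover have "(THE i. (i, n) \<in> M) \<in> free (M - {m. snd m = n})"
          using M the unfolding prefix_matchings_def free_def by fastforce
        ultimately show "M - {m. snd m = n} \<in> prefix_matchings w n \<and>
            (THE i. (i, n) \<in> M) \<in> free (M - {m. snd m = n})" by simp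
      qed
    qed
    have card_free: "card (free M) = nat (net (take n w))" if M: "M \<in> prefix_matchings w n" for M
    proof -
      have "Domain M \<subseteq> {i. i < n \<and> w ! i = Opening}"
        using M by (auto simp: prefix_matchings_def)
      moreover from this have "finite (Domain M)"
        by (rule finite_subset) simp
      ultimately have "card (free M) = card {i. i < n \<and> w ! i = Opening} - card {j. j < n \<and> w ! j = Closing}"
        unfolding free_def card_Domain_prefix_matching[OF M, symmetric]
        by (intro card_Diff_subset)
      moreover have "{i. i < length (take n w) \<and> take n w ! i = b} = {i. i < n \<and> w ! i = b}" for b
        using Suc.prems by auto
      ultimately show ?thesis
        by (simp add: net_eq_card)
    qed
    have "card (prefix_matchings w (Suc n)) = (\<Sum>M\<in>prefix_matchings w n. card (free M))"
      unfolding bij_betw_same_card[OF bij, symmetric]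
      by (intro card_SigmaI finite_prefix_matchings) (auto simp: free_def)
    also have "\<dots> = card (prefix_matchings w n) * nat (net (take n w))"
      by (simp add: card_free)
    also have "{i. i < Suc n \<and> w ! i = Closing} = insert n {i. i < n \<and> w ! i = Closing}"
      using Closing by auto
    ultimately show ?thesis
      using Suc by (simp add: mult.commute)
  qed
qed

text \<open>As there are equally many leaves of both kinds, matching all closing leaves to distinct
  opening leaves uses up all opening leaves.\<close>

lemma forward_matchings_eq:
  assumes "eulerian_tree T"
  shows "{M. forward_matching T M} = prefix_matchings (leaf_seq T) (length (leaf_seq T))"
proof (intro equalityI subsetI CollectI)
  fix M assume "M \<in> {M. forward_matching T M}"
  then have M: "forward_matching T M" by simp
  have sub: "M \<subseteq> {(i, j). i \<in> opening_leaves T \<and> j \<in> closing_leaves T \<and> i < j}"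
    and "\<And>i. i \<in> opening_leaves T \<Longrightarrow> \<exists>!j. (i, j) \<in> M"
    using M by (auto simp: forward_matching_def)
  then have "j = j'" if "(i, j) \<in> M" "(i, j') \<in> M" for i j j'
    using that by blast
  then show "M \<in> prefix_matchings (leaf_seq T) (length (leaf_seq T))"
    using M unfolding prefix_matchings_def forward_matching_def opening_leaves_def closing_leaves_def
    by auto
next
  fix M assume M: "M \<in> prefix_matchings (leaf_seq T) (length (leaf_seq T))"
  have "Domain M = opening_leaves T"
  proof (rule card_subset_eq)
    show "card (Domain M) = card (opening_leaves T)"
      using assms card_Domain_prefix_matching[OF M]
      by (simp add: eulerian_tree_def blossoming_tree_def closing_leaves_def)
    show "Domain M \<subseteq> opening_leaves T"
      using M by (auto simp: prefix_matchings_def opening_leaves_def)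
  qed (simp add: opening_leaves_def)
  moreover have "j = j'" if "(i, j) \<in> M" "(i, j') \<in> M" for i j j'
    using that M by (auto simp: prefix_matchings_def)
  ultimately have "\<exists>!j. (i, j) \<in> M" if "i \<in> opening_leaves T" for i
    using that by blast
  then show "forward_matching T M"
    using M unfolding prefix_matchings_def forward_matching_def opening_leaves_def closing_leaves_def
    by auto
qed

lemma card_forward_matchings:
  assumes "eulerian_tree T"
  shows "card {M. forward_matching T M} = height_prod 1 (hanging_leaves T)"
  unfolding forward_matchings_eq[OF assms] height_prod_eq_prod_closing
  by (simp add: card_prefix_matchings closing_leaves_def)

lemma enumerated_trees:
  assumes "r_system r"
  shows "enumerated_by enriched_eulerian_trees (\<lambda>x. node_degrees (fst x)) (r 1)"
    and "enumerated_by matched_eulerian_trees (\<lambda>y. node_degrees (fst y)) (r 1)"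
proof -
  have r: "r 1 = tree_series 1"
    by (rule r_system_unique[OF assms r_system_tree_series]) simp
  show "enumerated_by enriched_eulerian_trees (\<lambda>x. node_degrees (fst x)) (r 1)"
    using enumerated_by_Sigma[OF graded_finite_eulerian_trees, of labellings] finite_labellings
    unfolding r tree_series_def enriched_eulerian_trees_eq by (simp add: card_labellings)
  have "matched_eulerian_trees = Sigma {T. eulerian_tree T} (\<lambda>T. {M. forward_matching T M})"
    by (auto simp: matched_eulerian_trees_def)
  moreover have "tree_series 1 = wgf {T. eulerian_tree T} node_degrees (\<lambda>T. card {M. forward_matching T M})"
    unfolding tree_series_def by (rule wgf_cong) (simp_all add: card_forward_matchings)
  moreover have "finite {M. forward_matching T M}" if "eulerian_tree T" for T
    by (simp add: forward_matchings_eq[OF that] finite_prefix_matchings)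
  ultimately show "enumerated_by matched_eulerian_trees (\<lambda>y. node_degrees (fst y)) (r 1)"
    using enumerated_by_Sigma[OF graded_finite_eulerian_trees, of "\<lambda>T. {M. forward_matching T M}"]
    unfolding r by (simp only: mem_Collect_eq)
qed

section \<open>Degree-preserving bijections from equal enumerations\<close>

definition degree_monomial :: "nat multiset \<Rightarrow> nat \<Rightarrow>\<^sub>0 nat" where
  "degree_monomial D = (\<Sum>d\<in>#D. Poly_Mapping.single (d div 2) 1)"

lemma weight_eq_single: "weight D = Poly_Mapping.single (degree_monomial D) 1"
  by (induction D) (simp_all add: degree_monomial_def gvar_def mult_single)

lemma lookup_degree_monomial: "Poly_Mapping.lookup (degree_monomial D) k = count (image_mset (\<lambda>d. d div 2) D) k"
  by (induction D) (auto simp: degree_monomial_def lookup_add lookup_single when_def)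

text \<open>The monomial only knows the halves \<open>d div 2\<close>; evenness makes the halving
  reversible.\<close>

lemma degree_monomial_inj:
  assumes "\<forall>d\<in>#D. even d" "\<forall>d\<in>#D'. even d" "degree_monomial D = degree_monomial D'"
  shows "D = D'"
proof -
  have "image_mset (\<lambda>d. d div 2) D = image_mset (\<lambda>d. d div 2) D'"
    using assms(3) by (intro multiset_eqI) (simp add: lookup_degree_monomial[symmetric])
  then have "image_mset (\<lambda>d. 2 * (d div 2)) D = image_mset (\<lambda>d. 2 * (d div 2)) D'"
    by (metis (no_types, lifting) comp_apply image_mset_cong multiset.map_comp)
  moreover have "image_mset (\<lambda>d. 2 * (d div 2)) E = E" if "\<forall>d\<in>#E. even d" for E :: "nat multiset"
    using that by (induction E) auto
  ultimately show ?thesis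
    using assms by metis
qed

text \<open>Within one grade, only objects with degree multiset \<open>E\<close> hit its monomial,
  each with coefficient 1. So the series alone determines the size of every degree class.\<close>

lemma card_degree_class:
  assumes "enumerated_by A D s" "\<forall>x\<in>A. \<forall>d\<in>#D x. even d" "\<forall>d\<in>#E. even d"
  shows "finite {x \<in> A. D x = E}"
    and "int (card {x \<in> A. D x = E}) = Poly_Mapping.lookup (fps_nth s (half_degree E)) (degree_monomial E)"
proof -
  let ?B = "{x. x \<in> A \<and> half_degree (D x) = half_degree E}"
  have fin: "finite ?B"
    using assms(1) by (simp add: enumerated_by_def)
  show "finite {x \<in> A. D x = E}"
    by (rule finite_subset[OF _ fin]) auto
  have "fps_nth s (half_degree E) = (\<Sum>x\<in>?B. weight (D x))"
    using assms(1) by (simp add: enumerated_by_def)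
  then have "Poly_Mapping.lookup (fps_nth s (half_degree E)) (degree_monomial E) =
      (\<Sum>x\<in>?B. if D x = E then 1 else 0)"
    using assms(2,3) degree_monomial_inj
    by (auto simp: lookup_sum weight_eq_single lookup_single when_def intro!: sum.cong)
  also have "\<dots> = int (card {x \<in> ?B. D x = E})"
    using fin by (simp add: sum.If_cases Int_def)
  also have "{x \<in> ?B. D x = E} = {x \<in> A. D x = E}"
    by auto
  finally show "int (card {x \<in> A. D x = E}) = Poly_Mapping.lookup (fps_nth s (half_degree E)) (degree_monomial E)"
    by simp
qed

text \<open>Degree classes are finite and equinumerous; bijections chosen class by class are
  glued.\<close>

lemma bij_betw_enumerated:
  assumes A: "enumerated_by A D s" "\<forall>x\<in>A. \<forall>d\<in>#D x. even d"
    and B: "enumerated_by B D' s" "\<forall>y\<in>B. \<forall>d\<in>#D' y. even d"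
  shows "\<exists>f. bij_betw f A B \<and> (\<forall>x\<in>A. D' (f x) = D x)"
proof -
  have "\<exists>f. bij_betw f {x \<in> A. D x = E} {y \<in> B. D' y = E}" if "\<forall>d\<in>#E. even d" for E
  proof (rule finite_same_card_bij)
    show "card {x \<in> A. D x = E} = card {y \<in> B. D' y = E}"
      using card_degree_class(2)[OF A that] card_degree_class(2)[OF B that] by linarith
  qed (use card_degree_class(1)[OF A that] card_degree_class(1)[OF B that] in auto)
  then obtain F where F: "\<And>E. \<forall>d\<in>#E. even d \<Longrightarrow> bij_betw (F E) {x \<in> A. D x = E} {y \<in> B. D' y = E}"
    by metis
  define f where "f x = F (D x) x" for x
  have deg: "f x \<in> B \<and> D' (f x) = D x" if "x \<in> A" for x
    using bij_betwE[OF F[of "D x"]] A(2) that by (auto simp: f_def)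
  have "inj_on f A"
  proof (rule inj_onI)
    fix x y assume xy: "x \<in> A" "y \<in> A" "f x = f y"
    then have "D x = D y"
      using deg by metis
    then show "x = y"
      using xy bij_betw_imp_inj_on[OF F[of "D x"]] A(2) by (auto simp: f_def inj_on_def)
  qed
  moreover have "f ` A = B"
  proof (intro equalityI subsetI)
    fix y assume y: "y \<in> B"
    then have "y \<in> F (D' y) ` {x \<in> A. D x = D' y}"
      using bij_betw_imp_surj_on[OF F[of "D' y"]] B(2) by auto
    then obtain x where x: "x \<in> A" "D x = D' y" "y = F (D' y) x"
      by auto
    then have "y = f x"
      by (simp add: f_def)
    with x(1) show "y \<in> f ` A"
      by (rule rev_image_eqI)
  qed (use deg in auto)
  ultimately show ?thesis
    using deg by (auto simp: bij_betw_def)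
qed

section \<open>Exploration codes\<close>

text \<open>
  A code records how a rooted map is taken apart by repeatedly removing the root edge of a
  map whose root vertex has degree \<open>n\<close>: a loop is recorded by \<open>Close j\<close>, where \<open>j\<close> half-edges lie
  between its two ends; otherwise the edge is contracted, which merges the root vertex with a
  vertex of degree \<open>d\<close>, recorded by \<open>Visit d\<close>.
\<close>

datatype exploration_step = Close nat | Visit nat

text \<open>The number is the current degree of the root vertex. Each step consumes the two halves
  of one edge, whence \<open>n - 2\<close>, or \<open>(n - 1) + (d - 1)\<close> after a
  merge.\<close>

fun valid_code :: "nat \<Rightarrow> exploration_step list \<Rightarrow> bool" where
  "valid_code n [] \<longleftrightarrow> n = 0"
| "valid_code n (Close j # c) \<longleftrightarrow> j + 2 \<le> n \<and> valid_code (n - 2) c"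
| "valid_code n (Visit d # c) \<longleftrightarrow> n \<ge> 1 \<and> d \<ge> 1 \<and> valid_code (n + d - 2) c"

fun code_degrees :: "exploration_step list \<Rightarrow> nat multiset" where
  "code_degrees [] = {#}"
| "code_degrees (Close j # c) = code_degrees c"
| "code_degrees (Visit d # c) = add_mset d (code_degrees c)"

definition eulerian_codes :: "nat \<Rightarrow> exploration_step list set" where
  "eulerian_codes n = {c. valid_code n c \<and> (\<forall>d\<in>#code_degrees c. even d)}"

text \<open>For even degrees, \<open>n + 2 * half_degree\<close> counts all half-edges, already in
  the root list or still to be visited. Each step removes two of them, and no letter can exceed
  their number.\<close>

lemma eulerian_code_bounds:
  assumes "c \<in> eulerian_codes n" "n + 2 * half_degree (code_degrees c) \<le> N"
  shows "2 * length c \<le> N" "set c \<subseteq> Close ` {..N} \<union> Visit ` {..N}"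
proof -
  have "2 * length c \<le> N \<and> set c \<subseteq> Close ` {..N} \<union> Visit ` {..N}"
    if "valid_code n c" "\<forall>d\<in>#code_degrees c. even d" "n + 2 * half_degree (code_degrees c) \<le> N"
    using that
  proof (induction n c arbitrary: N rule: valid_code.induct)
    case (2 n j c)
    have "2 * length c \<le> N - 2 \<and> set c \<subseteq> Close ` {..N - 2} \<union> Visit ` {..N - 2}"
      by (rule "2.IH") (use "2.prems" in auto)
    moreover have "{..N - 2} \<subseteq> {..N}"
      by auto
    ultimately show ?case
      using "2.prems" by auto
  next
    case (3 n d c)
    then obtain k where k: "d = 2 * k"
      by auto
    have "2 * length c \<le> N - 2 \<and> set c \<subseteq> Close ` {..N - 2} \<union> Visit ` {..N - 2}"
      by (rule "3.IH") (use "3.prems" k in auto)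
    moreover have "{..N - 2} \<subseteq> {..N}"
      by auto
    ultimately show ?case
      using "3.prems" k by auto
  qed simp
  then show "2 * length c \<le> N" "set c \<subseteq> Close ` {..N} \<union> Visit ` {..N}"
    using assms by (auto simp: eulerian_codes_def)
qed

lemma graded_finite_codes: "graded_finite (eulerian_codes n) code_degrees"
  unfolding graded_finite_def
proof
  fix m
  let ?N = "n + 2 * m"
  let ?S = "Close ` {..?N} \<union> Visit ` {..?N}"
  have "{c \<in> eulerian_codes n. half_degree (code_degrees c) = m} \<subseteq> {c. set c \<subseteq> ?S \<and> length c \<le> ?N}"
    using eulerian_code_bounds[of _ n ?N] by fastforce
  moreover have "finite {c. set c \<subseteq> ?S \<and> length c \<le> ?N}"
    by (rule finite_lists_length_le) simp
  ultimately show "finite {c \<in> eulerian_codes n. half_degree (code_degrees c) = m}"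
    by (rule finite_subset)
qed

definition code_series :: "nat \<Rightarrow> gpoly fps" where
  "code_series n = wgf (eulerian_codes n) code_degrees (\<lambda>_. 1)"

lemma code_series_0: "code_series 0 = 1"
proof -
  have "c \<in> eulerian_codes 0 \<longleftrightarrow> c = []" for c
    by (cases "(0 :: nat, c)" rule: valid_code.cases) (auto simp: eulerian_codes_def)
  then have "eulerian_codes 0 = {[]}"
    by blast
  then show ?thesis
    by (simp add: code_series_def wgf_singleton)
qed

lemma graded_finite_const: "finite A \<Longrightarrow> graded_finite A D"
  by (simp add: graded_finite_def)

lemma wgf_const: "finite A \<Longrightarrow> wgf A (\<lambda>_. {#}) (\<lambda>_. 1) = of_nat (card A)"
proof (induction A rule: finite_induct)
  case (insert x A)
  have "wgf ({x} \<union> A) (\<lambda>_. {#}) (\<lambda>_. 1) = wgf {x} (\<lambda>_. {#}) (\<lambda>_. 1) + wgf A (\<lambda>_. {#}) (\<lambda>_. 1)"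
    using insert by (intro wgf_Un graded_finite_const) auto
  then show ?case
    using insert by (simp add: wgf_singleton)
qed simp

lemma code_series_Suc:
  "code_series (Suc n) = of_nat n * code_series (n - 1) + vertex_sum (\<lambda>k. code_series (n + 2 * k + 1))"
proof -
  \<comment> \<open>From root degree \<open>n + 1\<close>, the second end of a loop has
    \<open>n\<close> possible positions; merging with a vertex of degree \<open>2 * (k + 1)\<close>
    leaves \<open>n + 2 * k + 1\<close> half-edges.\<close>
  let ?C = "(\<lambda>(j, c). Close j # c) ` ({..<n} \<times> eulerian_codes (n - 1))"
  let ?A = "Sigma UNIV (\<lambda>k. eulerian_codes (n + 2 * k + 1))"
  let ?V = "(\<lambda>(k, c). Visit (2 * (k + 1)) # c) ` ?A"
  have "c \<in> eulerian_codes (Suc n) \<longleftrightarrow> c \<in> ?C \<union> ?V" for c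
  proof (cases "(n, c)" rule: valid_code.cases)
    case (2 n j c')
    then show ?thesis
      by (auto simp: eulerian_codes_def image_iff)
  next
    case (3 n' d c')
    have "d \<ge> 1 \<and> even d \<longleftrightarrow> (\<exists>k. d = 2 * (k + 1))"
      by presburger
    then show ?thesis
      using 3 by (auto simp: eulerian_codes_def image_iff)
  qed (auto simp: eulerian_codes_def)
  then have split: "eulerian_codes (Suc n) = ?C \<union> ?V"
    by blast
  have fin: "graded_finite ?C code_degrees" "graded_finite ?V code_degrees"
    by (rule graded_finite_subset[OF graded_finite_codes[of "Suc n"]], use split in blast)+
  have "wgf ?C code_degrees (\<lambda>_. 1) =
      wgf ({..<n} \<times> eulerian_codes (n - 1)) (\<lambda>(j, c). {#} + code_degrees c) (\<lambda>(j, c). 1 * 1)"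
    by (rule wgf_reindex[of "\<lambda>(j, c). Close j # c"]) (auto simp: bij_betw_def inj_on_def)
  also have "\<dots> = wgf {..<n} (\<lambda>_. {#}) (\<lambda>_. 1) * wgf (eulerian_codes (n - 1)) code_degrees (\<lambda>_. 1)"
    by (rule wgf_Times) (simp_all add: graded_finite_const graded_finite_codes)
  also have "\<dots> = of_nat n * code_series (n - 1)"
    by (simp only: wgf_const finite_lessThan card_lessThan code_series_def)
  finally have C: "wgf ?C code_degrees (\<lambda>_. 1) = of_nat n * code_series (n - 1)" .
  have "wgf ?V code_degrees (\<lambda>_. 1) = wgf ?A (\<lambda>(k, c). add_mset (2 * (k + 1)) (code_degrees c)) (\<lambda>(k, c). 1)"
    by (rule wgf_reindex[of "\<lambda>(k, c). Visit (2 * (k + 1)) # c"]) (auto simp: bij_betw_def inj_on_def)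
  also have "\<dots> = vertex_sum (\<lambda>k. code_series (n + 2 * k + 1))"
    unfolding code_series_def by (rule wgf_vertices[where c = "\<lambda>_ _. 1"]) (rule graded_finite_codes)
  finally have V: "wgf ?V code_degrees (\<lambda>_. 1) = vertex_sum (\<lambda>k. code_series (n + 2 * k + 1))" .
  have "code_series (Suc n) = wgf (?C \<union> ?V) code_degrees (\<lambda>_. 1)"
    by (simp only: code_series_def[of "Suc n"] split)
  also have "\<dots> = wgf ?C code_degrees (\<lambda>_. 1) + wgf ?V code_degrees (\<lambda>_. 1)"
    by (rule wgf_Un[OF fin]) auto
  finally show ?thesis
    by (simp only: C V)
qed

lemma code_series_eq_wpaths: "code_series n = wpaths tree_series n 0 0"
proof (rule loop_equation_unique[OF code_series_0 code_series_Suc])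
  show "wpaths tree_series (Suc n) 0 0 = of_nat n * wpaths tree_series (n - 1) 0 0 +
      vertex_sum (\<lambda>k. wpaths tree_series (n + 2 * k + 1) 0 0)" for n
    by (rule loop_equation[OF tree_series_0 r_system_tree_series])
qed simp

text \<open>Here the root vertex receives its weight. The sum becomes the path sum in the equation
  for \<open>r 1\<close>, and the added 1 is reserved for the trivial map.\<close>

lemma root_codes_series:
  "wgf (Sigma UNIV (\<lambda>k. eulerian_codes (2 * (k + 1)))) (\<lambda>(k, c). add_mset (2 * (k + 1)) (code_degrees c)) (\<lambda>_. 1) + 1
    = tree_series 1"
proof -
  have "wgf (Sigma UNIV (\<lambda>k. eulerian_codes (2 * (k + 1)))) (\<lambda>(k, c). add_mset (2 * (k + 1)) (code_degrees c)) (\<lambda>(k, c). 1)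
      = vertex_sum (\<lambda>k. code_series (2 * (k + 1)))"
    unfolding code_series_def by (rule wgf_vertices[where c = "\<lambda>_ _. 1"]) (rule graded_finite_codes)
  also have "\<dots> = vertex_sum (\<lambda>k. wpaths tree_series (2 * k + 1) 1 0)"
    unfolding code_series_eq_wpaths by (simp add: tree_series_0)
  finally show ?thesis
    using r_system_tree_series[unfolded r_system_iff_vertex_sum[where r = tree_series, OF tree_series_0], rule_format, of 1]
    by (simp add: case_prod_unfold add.commute)
qed

section \<open>Exploration of a rooted map\<close>

text \<open>The equation \<open>map f (x # ys) = ys @ [z]\<close> says that \<open>f\<close> runs
  through \<open>x\<close>, then \<open>ys\<close>, then \<open>z\<close>. With \<open>z = x\<close>
  it is the list form of a cycle used throughout; a separate \<open>z\<close> lets the induction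
  drop the head.\<close>

lemma cycle_closure:
  assumes "map f (x # ys) = ys @ [z]" "x \<in> B" "\<And>h. h \<in> B \<Longrightarrow> h \<in> set (x # ys) \<Longrightarrow> f h \<in> B"
  shows "insert z (set ys) \<subseteq> B"
  using assms
proof (induction ys arbitrary: x)
  case (Cons y ys)
  have y: "f x = y" "map f (y # ys) = ys @ [z]"
    using Cons.prems(1) by simp_all
  then have "y \<in> B"
    using Cons.prems(2,3) by auto
  with Cons.IH[OF y(2)] Cons.prems(3) show ?case
    by auto
qed auto

lemma orbit_cycle:
  assumes "map f (x # ys) = ys @ [x]"
  shows "orbit f x = set (x # ys)"
proof
  have closed: "f h \<in> set (x # ys)" if "h \<in> set (x # ys)" for h
  proof -
    have "f ` set (x # ys) = set (x # ys)"
      using arg_cong[OF assms, of set] by simp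
    then show ?thesis using that by blast
  qed
  show "orbit f x \<subseteq> set (x # ys)"
  proof
    fix y assume "y \<in> orbit f x"
    then show "y \<in> set (x # ys)"
      by induction (use closed in auto)
  qed
  have "insert x (set ys) \<subseteq> insert x (orbit f x)"
    by (rule cycle_closure[OF assms]) (auto intro: orbit.intros)
  \<comment> \<open>\<open>orbit\<close> starts at \<open>f x\<close>, so \<open>x\<close> itself is
    reached only on return from the last entry.\<close>
  moreover have "x \<in> orbit f x"
  proof (cases ys rule: rev_cases)
    case Nil
    then show ?thesis using assms orbit.base[of f x] by simp
  next
    case (snoc zs z)
    have "insert z (set zs) \<subseteq> orbit f x"
    proof (cases zs)
      case Nil
      then show ?thesis using assms snoc orbit.base[of f x] by simp
    next
      case (Cons u us)
      have "insert z (set us) \<subseteq> orbit f x"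
        by (rule cycle_closure[of f u us z]) (use assms snoc Cons orbit.base[of f x] in \<open>auto intro: orbit.step\<close>)
      then show ?thesis using assms snoc Cons orbit.base[of f x] by simp
    qed
    moreover have "f z = x"
      using assms snoc by simp
    ultimately show ?thesis
      using orbit.step[of z f x] by simp
  qed
  ultimately show "set (x # ys) \<subseteq> orbit f x"
    by auto
qed

lemma cycle_unique:
  assumes "map f (x # ys) = ys @ [z]" "map f (x # zs) = zs @ [z]" "z \<notin> set ys" "z \<notin> set zs"
  shows "ys = zs"
  using assms
proof (induction ys arbitrary: x zs)
  case Nil
  then show ?case by (cases zs) auto
next
  case (Cons y ys)
  then show ?case by (cases zs) auto
qed

lemma ex_cycle:
  assumes "finite K" "bij_betw f K K" "b \<in> K"
  shows "\<exists>ys. distinct (b # ys) \<and> set (b # ys) \<subseteq> K \<and> map f (b # ys) = ys @ [b]"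
proof -
  \<comment> \<open>Fixing all points outside \<open>K\<close> turns \<open>f\<close> into a
    permutation, whose \<open>least_power\<close> at \<open>b\<close> is the length of the
    cycle.\<close>
  define p where "p = perm_restrict f K"
  have p: "p permutes K"
    unfolding p_def using assms(2)
    by (intro bij_imp_permutes) (auto simp: perm_restrict_simps intro: bij_betw_cong[THEN iffD1])
  then have perm: "permutation p"
    using assms(1) by (auto simp: permutation_permutes)
  obtain m where m: "least_power p b = Suc m"
    using least_power_of_permutation(2)[OF perm, of b] by (cases "least_power p b") auto
  define ys where "ys = map (\<lambda>i. (p ^^ Suc i) b) [0..<m]"
  have supp: "support p b = b # ys"
    unfolding m ys_def by (simp add: upt_conv_Cons map_Suc_upt[symmetric] del: upt_Suc funpow.simps)
  have K: "(p ^^ i) b \<in> K" for i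
    using permutes_funpow[OF p, of i] assms(3) by (simp add: permutes_in_image)
  have "map p (b # ys) = map (\<lambda>i. (p ^^ Suc i) b) [0..<Suc m]"
    unfolding supp[symmetric] m by simp
  also have "\<dots> = ys @ [(p ^^ Suc m) b]"
    by (simp add: ys_def)
  also have "(p ^^ Suc m) b = b"
    using least_power_of_permutation(1)[OF perm, of b] m by simp
  finally have "map p (b # ys) = ys @ [b]" .
  moreover have "distinct (b # ys)"
    using cycle_of_permutation[OF perm, of b] unfolding supp .
  moreover have sub: "set (b # ys) \<subseteq> K"
    unfolding ys_def using K assms(3) by (auto simp del: funpow.simps)
  moreover have "map f (b # ys) = map p (b # ys)"
    using sub by (auto simp: p_def perm_restrict_simps)
  ultimately show ?thesis by metis
qed

text \<open>
  In a partially explored map, \<open>L\<close> lists the half-edges of the (merged) root vertex and \<open>K\<close> is the set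
  of half-edges of the other vertices; \<open>\<alpha>\<close> is the edge involution and \<open>\<sigma>\<close> the rotation at the
  other vertices.
\<close>

inductive explores ::
  "('a \<Rightarrow> 'a) \<Rightarrow> ('a \<Rightarrow> 'a) \<Rightarrow> 'a list \<Rightarrow> 'a set \<Rightarrow> exploration_step list \<Rightarrow> bool" for \<alpha> \<sigma> where
  Done: "explores \<alpha> \<sigma> [] {} []"
| Close: "explores \<alpha> \<sigma> (us @ vs) K c \<Longrightarrow> a \<notin> set (us @ vs) \<union> K \<Longrightarrow> b \<notin> set (us @ vs) \<union> K \<Longrightarrow> a \<noteq> b \<Longrightarrow>
    \<alpha> a = b \<Longrightarrow> \<alpha> b = a \<Longrightarrow> explores \<alpha> \<sigma> (a # us @ b # vs) K (Close (length us) # c)"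
| Visit: "explores \<alpha> \<sigma> (ys @ vs) K c \<Longrightarrow> a \<notin> set (ys @ vs) \<union> K \<Longrightarrow> b \<notin> set (ys @ vs) \<union> K \<Longrightarrow> a \<noteq> b \<Longrightarrow>
    \<alpha> a = b \<Longrightarrow> \<alpha> b = a \<Longrightarrow> map \<sigma> (b # ys) = ys @ [b] \<Longrightarrow>
    explores \<alpha> \<sigma> (a # vs) (set (b # ys) \<union> K) (Visit (length ys + 1) # c)"

inductive_cases explores_NilE: "explores \<alpha> \<sigma> L K []"
inductive_cases explores_CloseE: "explores \<alpha> \<sigma> L K (Close j # c)"
inductive_cases explores_VisitE: "explores \<alpha> \<sigma> L K (Visit d # c)"

section \<open>Invariants and relabelling of an exploration\<close>

lemma bij_betw_cycle:
  assumes "distinct (b # ys)" "map f (b # ys) = ys @ [b]"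
  shows "bij_betw f (set (b # ys)) (set (b # ys))"
proof -
  have "set (map f (b # ys)) = set (b # ys)"
    unfolding assms(2) by auto
  moreover have "distinct (map f (b # ys))"
    unfolding assms(2) using assms(1) by auto
  then have "inj_on f (set (b # ys))"
    unfolding distinct_map by blast
  ultimately show ?thesis
    unfolding bij_betw_def by simp
qed

lemma explores_wf:
  assumes "explores \<alpha> \<sigma> L K c"
  shows "distinct L \<and> finite K \<and> set L \<inter> K = {} \<and> bij_betw \<sigma> K K \<and> valid_code (length L) c \<and>
    (\<forall>h\<in>set L \<union> K. \<alpha> h \<in> set L \<union> K \<and> \<alpha> h \<noteq> h \<and> \<alpha> (\<alpha> h) = h)"
  using assms
proof induction
  case (Close us vs K c a b)
  then show ?case by auto
next
  case (Visit ys vs K c a b)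
  have "bij_betw \<sigma> (set (b # ys) \<union> K) (set (b # ys) \<union> K)"
    by (rule bij_betw_combine[OF bij_betw_cycle]) (use Visit in auto)
  with Visit show ?case by (auto simp: add.commute)
qed (simp add: bij_betw_def)

text \<open>Whatever has a code is connected: each vertex in \<open>K\<close> is entered through the
  partner of a half-edge already reached, then swept by its rotation.\<close>

lemma explores_connected:
  assumes "explores \<alpha> \<sigma> L K c" "set L \<subseteq> B"
    "\<And>h. h \<in> B \<Longrightarrow> h \<in> set L \<union> K \<Longrightarrow> \<alpha> h \<in> B" "\<And>h. h \<in> B \<Longrightarrow> h \<in> K \<Longrightarrow> \<sigma> h \<in> B"
  shows "K \<subseteq> B"
  using assms
proof induction
  case (Close us vs K c a b)
  then show ?case by auto
next
  case (Visit ys vs K c a b)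
  have "b \<in> B"
    using Visit.prems(1,2) Visit.hyps by auto
  then have "insert b (set ys) \<subseteq> B"
    using Visit.prems(3) by (intro cycle_closure[OF Visit.hyps(7)]) auto
  moreover have "K \<subseteq> B"
    using Visit.prems calculation by (intro Visit.IH) auto
  ultimately show ?case by auto
qed simp

text \<open>\<open>\<sigma>\<close> has to be respected on \<open>K\<close> only, since the list
  \<open>L\<close> takes the place of the rotation at the root vertex.\<close>

lemma explores_image:
  assumes "explores \<alpha> \<sigma> L K c" "inj_on \<phi> (set L \<union> K)"
    "\<And>h. h \<in> set L \<union> K \<Longrightarrow> \<alpha>' (\<phi> h) = \<phi> (\<alpha> h)" "\<And>h. h \<in> K \<Longrightarrow> \<sigma>' (\<phi> h) = \<phi> (\<sigma> h)"
  shows "explores \<alpha>' \<sigma>' (map \<phi> L) (\<phi> ` K) c"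
  using assms
proof induction
  case Done
  show ?case by (simp add: explores.Done)
next
  case (Close us vs K c a b)
  have sub: "set (us @ vs) \<union> K \<subseteq> set (a # us @ b # vs) \<union> K"
    by auto
  have "explores \<alpha>' \<sigma>' (map \<phi> (us @ vs)) (\<phi> ` K) c"
    using Close.prems sub by (intro Close.IH) (auto intro: inj_on_subset)
  moreover have "\<phi> x \<notin> set (map \<phi> us @ map \<phi> vs) \<union> \<phi> ` K" if "x \<in> {a, b}" for x
    using that Close.hyps inj_on_image_mem_iff[OF Close.prems(1) _ sub] by (auto simp: image_Un)
  moreover have "\<phi> a \<noteq> \<phi> b"
    using Close.prems(1) Close.hyps by (auto simp: inj_on_def)
  moreover have "\<alpha>' (\<phi> a) = \<phi> b" "\<alpha>' (\<phi> b) = \<phi> a"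
    using Close.prems(2) Close.hyps by auto
  ultimately show ?case
    using explores.Close[of \<alpha>' \<sigma>' "map \<phi> us" "map \<phi> vs" "\<phi> ` K" c "\<phi> a" "\<phi> b"] by simp
next
  case (Visit ys vs K c a b)
  let ?D = "set (a # vs) \<union> (set (b # ys) \<union> K)"
  have sub: "set (ys @ vs) \<union> K \<subseteq> ?D"
    by auto
  have "explores \<alpha>' \<sigma>' (map \<phi> (ys @ vs)) (\<phi> ` K) c"
    using Visit.prems sub by (intro Visit.IH) (auto intro: inj_on_subset)
  moreover have "\<phi> x \<notin> set (map \<phi> ys @ map \<phi> vs) \<union> \<phi> ` K" if "x \<in> {a, b}" for x
    using that Visit.hyps inj_on_image_mem_iff[OF Visit.prems(1) _ sub] by (auto simp: image_Un)
  moreover have "\<phi> a \<noteq> \<phi> b"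
    using Visit.prems(1) Visit.hyps by (auto simp: inj_on_def)
  moreover have "\<alpha>' (\<phi> a) = \<phi> b" "\<alpha>' (\<phi> b) = \<phi> a"
    using Visit.prems(2) Visit.hyps by auto
  moreover have "map \<sigma>' (\<phi> b # map \<phi> ys) = map \<phi> ys @ [\<phi> b]"
  proof -
    have "map \<sigma>' (map \<phi> (b # ys)) = map \<phi> (map \<sigma> (b # ys))"
      using Visit.prems(3) by auto
    then show ?thesis
      unfolding Visit.hyps(7) by simp
  qed
  ultimately show ?case
    using explores.Visit[of \<alpha>' \<sigma>' "map \<phi> ys" "map \<phi> vs" "\<phi> ` K" c "\<phi> a" "\<phi> b"] by (simp add: image_Un)
qed

lemma explores_cong:
  assumes "explores \<alpha> \<sigma> L K c" "\<And>h. h \<in> set L \<union> K \<Longrightarrow> \<alpha>' h = \<alpha> h" "\<And>h. h \<in> K \<Longrightarrow> \<sigma>' h = \<sigma> h"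
  shows "explores \<alpha>' \<sigma>' L K c"
  using explores_image[of \<alpha> \<sigma> L K c id \<alpha>' \<sigma>'] assms by simp

section \<open>Uniqueness and existence of the exploration\<close>

lemma explores_ConsE:
  assumes "explores \<alpha> \<sigma> (a # L) K c"
  obtains (Close) us vs c' where "c = Close (length us) # c'" "L = us @ \<alpha> a # vs" "\<alpha> a \<notin> set (us @ vs)"
      "explores \<alpha> \<sigma> (us @ vs) K c'"
    | (Visit) ys K' c' where "c = Visit (length ys + 1) # c'" "\<alpha> a \<notin> set (ys @ L)"
      "map \<sigma> (\<alpha> a # ys) = ys @ [\<alpha> a]" "explores \<alpha> \<sigma> (ys @ L) K' c'"
  using assms by cases (use that in auto)

text \<open>The partner of the first half-edge decides the rule: if it is in the list, it splits the
  list in one way; otherwise its cycle is determined by \<open>\<sigma>\<close>.\<close>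

lemma explores_unique:
  assumes "explores \<alpha> \<sigma> L K c" "explores \<alpha> \<sigma> L K' c'"
  shows "c = c'"
  using assms
proof (induction arbitrary: K' c')
  case Done
  then show ?case by (auto elim: explores.cases)
next
  case (Close us vs K c a b)
  from Close.prems show ?case
  proof (cases rule: explores_ConsE)
    case (Close us' vs' c'')
    then have "us @ b # vs = us' @ b # vs'" "b \<notin> set us" "b \<notin> set vs" "b \<notin> set us'" "b \<notin> set vs'"
      using Close.hyps \<open>\<alpha> a = b\<close> by auto
    then have "us = us' \<and> vs = vs'"
      by (simp add: append_Cons_eq_iff)
    then show ?thesis
      using Close Close.IH by blast
  next
    case Visit
    then show ?thesis
      using \<open>\<alpha> a = b\<close> by auto
  qed
next
  case (Visit ys vs K c a b)
  from Visit.prems show ?case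
  proof (cases rule: explores_ConsE)
    case Close
    then show ?thesis
      using \<open>\<alpha> a = b\<close> Visit.hyps by auto
  next
    case (Visit ys' K'' c'')
    then have "ys = ys'"
      using Visit.hyps by (intro cycle_unique[of \<sigma> b ys b ys']) auto
    then show ?thesis
      using Visit Visit.IH by blast
  qed
qed

text \<open>Induction on the number of half-edges. Connectivity is phrased through closed sets
  \<open>B\<close> because this form passes easily to the map with one edge removed or
  contracted.\<close>

lemma explores_exists:
  assumes "distinct L" "finite K" "set L \<inter> K = {}" "bij_betw \<sigma> K K"
    "\<And>h. h \<in> set L \<union> K \<Longrightarrow> \<alpha> h \<in> set L \<union> K \<and> \<alpha> h \<noteq> h \<and> \<alpha> (\<alpha> h) = h"
    "\<And>B. set L \<subseteq> B \<Longrightarrow> (\<And>h. h \<in> B \<Longrightarrow> h \<in> set L \<union> K \<Longrightarrow> \<alpha> h \<in> B) \<Longrightarrow>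
      (\<And>h. h \<in> B \<Longrightarrow> h \<in> K \<Longrightarrow> \<sigma> h \<in> B) \<Longrightarrow> K \<subseteq> B"
  shows "\<exists>c. explores \<alpha> \<sigma> L K c"
  using assms
proof (induction "card (set L \<union> K)" arbitrary: L K rule: less_induct)
  case less
  note dist = less.prems(1) and fin = less.prems(2) and disj = less.prems(3) and bij = less.prems(4)
    and inv = less.prems(5) and conn = less.prems(6)
  show ?case
  proof (cases L)
    case Nil
    \<comment> \<open>With an empty root list the empty set is closed, so connectivity leaves
      nothing else.\<close>
    then have "K = {}"
      using conn[of "{}"] by auto
    then show ?thesis
      using Nil explores.Done by blast
  next
    case (Cons a L1)
    define b where "b = \<alpha> a"
    have ab: "b \<in> set L \<union> K" "b \<noteq> a" "\<alpha> b = a" "\<alpha> a = b"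
      using inv[of a] Cons by (auto simp: b_def)
    show ?thesis
    proof (cases "b \<in> set L1")
      case True
      then obtain us vs where L1: "L1 = us @ b # vs"
        by (meson split_list)
      have D: "set (us @ vs) \<union> K = (set L \<union> K) - {a, b}"
        using dist disj unfolding Cons L1 by auto
      have "\<exists>c. explores \<alpha> \<sigma> (us @ vs) K c"
      proof (rule less.hyps)
        show "card (set (us @ vs) \<union> K) < card (set L \<union> K)"
          unfolding D using fin Cons by (intro psubset_card_mono) auto
        show "\<alpha> h \<in> set (us @ vs) \<union> K \<and> \<alpha> h \<noteq> h \<and> \<alpha> (\<alpha> h) = h" if "h \<in> set (us @ vs) \<union> K" for h
          using that inv[of h] ab unfolding D by auto
        show "K \<subseteq> B" if B: "set (us @ vs) \<subseteq> B"
          "\<And>h. h \<in> B \<Longrightarrow> h \<in> set (us @ vs) \<union> K \<Longrightarrow> \<alpha> h \<in> B" "\<And>h. h \<in> B \<Longrightarrow> h \<in> K \<Longrightarrow> \<sigma> h \<in> B" for B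
        proof -
          \<comment> \<open>A closed set of the smaller map becomes closed in the larger one once
            the removed edge is added.\<close>
          have "K \<subseteq> B \<union> {a, b}"
          proof (rule conn)
            show "set L \<subseteq> B \<union> {a, b}"
              using B(1) Cons L1 by auto
            show "\<alpha> h \<in> B \<union> {a, b}" if "h \<in> B \<union> {a, b}" "h \<in> set L \<union> K" for h
              using that B(2)[of h] ab unfolding D by auto
            show "\<sigma> h \<in> B \<union> {a, b}" if "h \<in> B \<union> {a, b}" "h \<in> K" for h
              using that B(3)[of h] disj Cons L1 by auto
          qed
          then show ?thesis
            using disj Cons L1 by auto
        qed
      qed (use dist disj Cons L1 fin bij in auto)
      then obtain c where c: "explores \<alpha> \<sigma> (us @ vs) K c" ..
      have "explores \<alpha> \<sigma> (a # us @ b # vs) K (Close (length us) # c)"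
        by (rule explores.Close[OF c]) (use ab D in auto)
      then show ?thesis
        using Cons L1 by blast
    next
      case False
      then have "b \<in> K"
        using ab Cons by auto
      then obtain ys where ys: "distinct (b # ys)" "set (b # ys) \<subseteq> K" "map \<sigma> (b # ys) = ys @ [b]"
        using ex_cycle[OF fin bij] by blast
      define K' where "K' = K - set (b # ys)"
      have K: "K = set (b # ys) \<union> K'"
        using ys(2) by (auto simp: K'_def)
      have D: "set (ys @ L1) \<union> K' = (set L \<union> K) - {a, b}"
        using dist disj ys(1,2) unfolding Cons K'_def by auto
      have bij': "bij_betw \<sigma> K' K'"
        unfolding K'_def by (rule bij_betw_DiffI[OF bij bij_betw_cycle[OF ys(1,3)]]) (use ys(2) in auto)
      have "\<exists>c. explores \<alpha> \<sigma> (ys @ L1) K' c"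
      proof (rule less.hyps)
        show "card (set (ys @ L1) \<union> K') < card (set L \<union> K)"
          unfolding D using fin Cons by (intro psubset_card_mono) auto
        show "\<alpha> h \<in> set (ys @ L1) \<union> K' \<and> \<alpha> h \<noteq> h \<and> \<alpha> (\<alpha> h) = h" if "h \<in> set (ys @ L1) \<union> K'" for h
          using that inv[of h] ab unfolding D by auto
        show "K' \<subseteq> B" if B: "set (ys @ L1) \<subseteq> B"
          "\<And>h. h \<in> B \<Longrightarrow> h \<in> set (ys @ L1) \<union> K' \<Longrightarrow> \<alpha> h \<in> B" "\<And>h. h \<in> B \<Longrightarrow> h \<in> K' \<Longrightarrow> \<sigma> h \<in> B" for B
        proof -
          have "K \<subseteq> B \<union> {a, b}"
          proof (rule conn)
            show "set L \<subseteq> B \<union> {a, b}"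
              using B(1) Cons by auto
            show "\<alpha> h \<in> B \<union> {a, b}" if "h \<in> B \<union> {a, b}" "h \<in> set L \<union> K" for h
              using that B(2)[of h] ab unfolding D by auto
            show "\<sigma> h \<in> B \<union> {a, b}" if h: "h \<in> B \<union> {a, b}" "h \<in> K" for h
            \<comment> \<open>Half-edges of \<open>K\<close> outside \<open>K'\<close> lie on the
              cycle of \<open>b\<close>, which is contained in \<open>B \<union> {a, b}\<close>
              because \<open>ys\<close> joins the root list.\<close>
            proof (cases "h \<in> K'")
              case True
              moreover have "h \<noteq> a" "h \<noteq> b"
                using True disj Cons by (auto simp: K'_def)
              ultimately show ?thesis
                using h B(3)[of h] by auto
            next
              case False
              then have "\<sigma> h \<in> set (b # ys)"
                using h(2) bij_betw_apply[OF bij_betw_cycle[OF ys(1,3)], of h] by (auto simp: K'_def)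
              then show ?thesis
                using B(1) by auto
            qed
          qed
          moreover have "a \<notin> K'" "b \<notin> K'"
            using disj Cons by (auto simp: K'_def)
          ultimately show ?thesis
            by (auto simp: K)
        qed
      qed (use dist disj Cons ys fin bij' in \<open>auto simp: K'_def\<close>)
      then obtain c where c: "explores \<alpha> \<sigma> (ys @ L1) K' c" ..
      have "explores \<alpha> \<sigma> (a # L1) (set (b # ys) \<union> K') (Visit (length ys + 1) # c)"
        by (rule explores.Visit[OF c]) (use ab D ys in auto)
      then show ?thesis
        using Cons K by blast
    qed
  qed
qed

text \<open>A letter tells where the partner sits in the list, or how many half-edges its vertex
  brings, so two runs with the same code stay aligned position by position. The isomorphism is built
  backwards, one edge at a time.\<close>

lemma explores_iso:
  assumes "explores \<alpha> \<sigma> L K c" "explores \<alpha>' \<sigma>' L' K' c" "length L = length L'"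
  shows "\<exists>\<phi>. bij_betw \<phi> (set L \<union> K) (set L' \<union> K') \<and> map \<phi> L = L' \<and>
    (\<forall>h\<in>set L \<union> K. \<alpha>' (\<phi> h) = \<phi> (\<alpha> h)) \<and> (\<forall>h\<in>K. \<sigma>' (\<phi> h) = \<phi> (\<sigma> h))"
  using assms
proof (induction arbitrary: L' K')
  case Done
  then have "L' = []" "K' = {}"
    by (auto elim: explores_NilE)
  then show ?case by (auto simp: bij_betw_def)
next
  case (Close us vs K c a b)
  note hyps = Close.hyps
  from Close.prems(1) obtain us' vs' a' b' where L': "L' = a' # us' @ b' # vs'" "length us' = length us"
    and e: "explores \<alpha>' \<sigma>' (us' @ vs') K' c" and n: "a' \<notin> set (us' @ vs') \<union> K'" "b' \<notin> set (us' @ vs') \<union> K'"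
      "a' \<noteq> b'" "\<alpha>' a' = b'" "\<alpha>' b' = a'"
    by (auto elim: explores_CloseE)
  obtain \<phi> where \<phi>: "bij_betw \<phi> (set (us @ vs) \<union> K) (set (us' @ vs') \<union> K')" "map \<phi> (us @ vs) = us' @ vs'"
    "\<forall>h\<in>set (us @ vs) \<union> K. \<alpha>' (\<phi> h) = \<phi> (\<alpha> h)" "\<forall>h\<in>K. \<sigma>' (\<phi> h) = \<phi> (\<sigma> h)"
    using Close.IH[OF e] Close.prems(2) L' by auto
  define \<psi> where "\<psi> = \<phi>(a := a', b := b')"
  have old: "\<psi> h = \<phi> h" if "h \<in> set (us @ vs) \<union> K" for h
    using that hyps by (auto simp: \<psi>_def)
  have ab: "\<psi> a = a'" "\<psi> b = b'"
    using hyps by (auto simp: \<psi>_def)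
  have closed: "\<alpha> h \<in> set (us @ vs) \<union> K" if "h \<in> set (us @ vs) \<union> K" for h
    using explores_wf[OF hyps(1)] that by blast
  have \<sigma>: "\<sigma> h \<in> K" if "h \<in> K" for h
    using explores_wf[OF hyps(1)] that by (auto simp: bij_betw_def)
  have "bij_betw \<psi> ((set (us @ vs) \<union> K) \<union> {a, b}) ((set (us' @ vs') \<union> K') \<union> {a', b'})"
  proof (rule bij_betw_combine)
    show "bij_betw \<psi> (set (us @ vs) \<union> K) (set (us' @ vs') \<union> K')"
      using \<phi>(1) old by (subst bij_betw_cong[of _ \<psi> \<phi>]) auto
    show "bij_betw \<psi> {a, b} {a', b'}"
      using ab n hyps by (auto simp: bij_betw_def inj_on_def)
  qed (use n in auto)
  moreover have "(set (us @ vs) \<union> K) \<union> {a, b} = set (a # us @ b # vs) \<union> K"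
    "(set (us' @ vs') \<union> K') \<union> {a', b'} = set L' \<union> K'"
    by (auto simp: L')
  moreover have "map \<psi> (a # us @ b # vs) = L'"
  proof -
    have "map \<psi> (us @ vs) = us' @ vs'"
      unfolding \<phi>(2)[symmetric] using old by (intro map_cong) auto
    then show ?thesis
      using L' ab by simp
  qed
  moreover have "\<alpha>' (\<psi> h) = \<psi> (\<alpha> h)" if "h \<in> set (a # us @ b # vs) \<union> K" for h
  proof (cases "h \<in> {a, b}")
    case True
    then show ?thesis using ab n hyps by auto
  next
    case False
    then have "h \<in> set (us @ vs) \<union> K" using that by auto
    then show ?thesis using old closed \<phi>(3) by metis
  qed
  moreover have "\<sigma>' (\<psi> h) = \<psi> (\<sigma> h)" if "h \<in> K" for h
    using that old \<sigma> \<phi>(4) by (metis UnCI)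
  ultimately show ?case by metis
next
  case (Visit ys vs K c a b)
  note hyps = Visit.hyps
  from Visit.prems(1) obtain ys' vs' K'' a' b' where L': "L' = a' # vs'" "K' = set (b' # ys') \<union> K''" "length ys' = length ys"
    and e: "explores \<alpha>' \<sigma>' (ys' @ vs') K'' c" and n: "a' \<notin> set (ys' @ vs') \<union> K''" "b' \<notin> set (ys' @ vs') \<union> K''"
      "a' \<noteq> b'" "\<alpha>' a' = b'" "\<alpha>' b' = a'" "map \<sigma>' (b' # ys') = ys' @ [b']"
    by (auto elim!: explores_VisitE)
  obtain \<phi> where \<phi>: "bij_betw \<phi> (set (ys @ vs) \<union> K) (set (ys' @ vs') \<union> K'')" "map \<phi> (ys @ vs) = ys' @ vs'"
    "\<forall>h\<in>set (ys @ vs) \<union> K. \<alpha>' (\<phi> h) = \<phi> (\<alpha> h)" "\<forall>h\<in>K. \<sigma>' (\<phi> h) = \<phi> (\<sigma> h)"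
    using Visit.IH[OF e] Visit.prems(2) L' by auto
  define \<psi> where "\<psi> = \<phi>(a := a', b := b')"
  have old: "\<psi> h = \<phi> h" if "h \<in> set (ys @ vs) \<union> K" for h
    using that hyps by (auto simp: \<psi>_def)
  have ab: "\<psi> a = a'" "\<psi> b = b'"
    using hyps by (auto simp: \<psi>_def)
  have closed: "\<alpha> h \<in> set (ys @ vs) \<union> K" if "h \<in> set (ys @ vs) \<union> K" for h
    using explores_wf[OF hyps(1)] that by blast
  have \<sigma>: "\<sigma> h \<in> K" if "h \<in> K" for h
    using explores_wf[OF hyps(1)] that by (auto simp: bij_betw_def)
  \<comment> \<open>The code fixes the length of \<open>ys\<close>, so the boundary between the
    absorbed vertex and the old list matches; this recovers the rotation on that vertex.\<close>
  have maps: "map \<psi> ys = ys'" "map \<psi> vs = vs'"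
  proof -
    have "map \<psi> (ys @ vs) = ys' @ vs'"
      unfolding \<phi>(2)[symmetric] using old by (intro map_cong) auto
    then show "map \<psi> ys = ys'" "map \<psi> vs = vs'"
      using L'(3) by auto
  qed
  have "bij_betw \<psi> ((set (ys @ vs) \<union> K) \<union> {a, b}) ((set (ys' @ vs') \<union> K'') \<union> {a', b'})"
  proof (rule bij_betw_combine)
    show "bij_betw \<psi> (set (ys @ vs) \<union> K) (set (ys' @ vs') \<union> K'')"
      using \<phi>(1) old by (subst bij_betw_cong[of _ \<psi> \<phi>]) auto
    show "bij_betw \<psi> {a, b} {a', b'}"
      using ab n hyps by (auto simp: bij_betw_def inj_on_def)
  qed (use n in auto)
  moreover have "(set (ys @ vs) \<union> K) \<union> {a, b} = set (a # vs) \<union> (set (b # ys) \<union> K)"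
    "(set (ys' @ vs') \<union> K'') \<union> {a', b'} = set L' \<union> K'"
    by (auto simp: L')
  moreover have "map \<psi> (a # vs) = L'"
    using L' ab maps by simp
  moreover have "\<alpha>' (\<psi> h) = \<psi> (\<alpha> h)" if "h \<in> set (a # vs) \<union> (set (b # ys) \<union> K)" for h
  proof (cases "h \<in> {a, b}")
    case True
    then show ?thesis using ab n hyps by auto
  next
    case False
    then have "h \<in> set (ys @ vs) \<union> K" using that by auto
    then show ?thesis using old closed \<phi>(3) by metis
  qed
  moreover have "\<sigma>' (\<psi> h) = \<psi> (\<sigma> h)" if "h \<in> set (b # ys) \<union> K" for h
  proof (cases "h \<in> K")
    case True
    then show ?thesis using old \<sigma> \<phi>(4) by (metis UnCI)
  next
    case False
    have "map \<sigma>' (map \<psi> (b # ys)) = map \<psi> (map \<sigma> (b # ys))"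
      unfolding hyps(7) using n(6) maps ab by simp
    then show ?thesis
      using that False by auto
  qed
  ultimately show ?case by metis
qed

section \<open>Realizing a code\<close>

lemma ex_fun_map:
  assumes "distinct xs" "length xs = length zs"
  shows "\<exists>f. map f xs = zs \<and> (\<forall>x. x \<notin> set xs \<longrightarrow> f x = g x)"
  using assms(2,1)
proof (induction xs zs rule: list_induct2)
  case (Cons x xs z zs)
  then obtain f where "map f xs = zs" "\<forall>x. x \<notin> set xs \<longrightarrow> f x = g x"
    by auto
  then show ?case
    using Cons.prems by (intro exI[of _ "f(x := z)"]) (auto intro: map_cong)
qed auto

text \<open>The code is run backwards with two fresh half-edges per letter, which natural-number
  labels always provide.\<close>

lemma explores_realizable:
  assumes "valid_code n c"
  shows "\<exists>\<alpha> \<sigma> (L :: nat list) K. explores \<alpha> \<sigma> L K c \<and> length L = n"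
  using assms
proof (induction n c rule: valid_code.induct)
  case (1 n)
  then show ?case by (auto intro: explores.Done)
next
  case (2 n j c)
  then obtain \<alpha> \<sigma> and L :: "nat list" and K where L: "explores \<alpha> \<sigma> L K c" "length L = n - 2"
    by auto
  have fin: "finite (set L \<union> K)"
    using explores_wf[OF L(1)] by simp
  obtain a where a: "a \<notin> set L \<union> K"
    using ex_new_if_finite[OF infinite_UNIV_nat fin] by blast
  have "finite (insert a (set L \<union> K))"
    using fin by simp
  then obtain b where b: "b \<notin> insert a (set L \<union> K)"
    using ex_new_if_finite[OF infinite_UNIV_nat] by blast
  let ?\<alpha> = "\<alpha>(a := b, b := a)"
  have "explores ?\<alpha> \<sigma> (take j L @ drop j L) K c"
    using L(1) a b by (auto intro: explores_cong)
  then have "explores ?\<alpha> \<sigma> (a # take j L @ b # drop j L) K (Close (length (take j L)) # c)"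
    by (rule explores.Close) (use a b in auto)
  moreover have "length (take j L) = j" "length (a # take j L @ b # drop j L) = n"
    using L(2) "2.prems" by auto
  ultimately show ?case by metis
next
  case (3 n d c)
  then obtain \<alpha> \<sigma> and L :: "nat list" and K where L: "explores \<alpha> \<sigma> L K c" "length L = n + d - 2"
    by auto
  have wf: "distinct L" "finite K" "set L \<inter> K = {}"
    using explores_wf[OF L(1)] by auto
  then have fin: "finite (set L \<union> K)" by simp
  obtain a where a: "a \<notin> set L \<union> K"
    using ex_new_if_finite[OF infinite_UNIV_nat fin] by blast
  have "finite (insert a (set L \<union> K))"
    using fin by simp
  then obtain b where b: "b \<notin> insert a (set L \<union> K)"
    using ex_new_if_finite[OF infinite_UNIV_nat] by blast
  let ?\<alpha> = "\<alpha>(a := b, b := a)"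
  \<comment> \<open>Undoing a contraction: the first \<open>d - 1\<close> root half-edges, together
    with the new \<open>b\<close>, split off as a vertex of degree \<open>d\<close>.\<close>
  define ys vs where "ys = take (d - 1) L" and "vs = drop (d - 1) L"
  have L_eq: "L = ys @ vs"
    by (simp add: ys_def vs_def)
  have "distinct (b # ys)" "length (b # ys) = length (ys @ [b])"
    using wf b L_eq by auto
  then obtain \<sigma>' where \<sigma>': "map \<sigma>' (b # ys) = ys @ [b]" "\<And>x. x \<notin> set (b # ys) \<Longrightarrow> \<sigma>' x = \<sigma> x"
    using ex_fun_map[of "b # ys" "ys @ [b]" \<sigma>] by blast
  have "explores ?\<alpha> \<sigma>' (ys @ vs) K c"
    unfolding L_eq[symmetric]
  proof (rule explores_cong[OF L(1)])
    show "\<sigma>' h = \<sigma> h" if "h \<in> K" for h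
      using that wf(3) b L_eq by (intro \<sigma>'(2)) auto
  qed (use a b in auto)
  then have "explores ?\<alpha> \<sigma>' (a # vs) (set (b # ys) \<union> K) (Visit (length ys + 1) # c)"
    by (rule explores.Visit) (use a b L_eq \<sigma>' in auto)
  moreover have "length ys + 1 = d" "length (a # vs) = n"
    using L(2) "3.prems" by (auto simp: ys_def vs_def)
  ultimately show ?case by metis
qed

section \<open>Rooted maps and their codes\<close>

lemma rooted_map_rev:
  assumes "is_rooted_map M" "a \<in> arcs (map_graph M)"
  shows "map_rev M a \<in> arcs (map_graph M)" "map_rev M a \<noteq> a" "map_rev M (map_rev M a) = a"
    "tail (map_graph M) (map_rev M a) = head (map_graph M) a"
    "head (map_graph M) (map_rev M a) = tail (map_graph M) a"
proof -
  interpret bidirected_digraph "map_graph M" "map_rev M"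
    using assms(1) by (simp add: is_rooted_map_def)
  show "map_rev M a \<in> arcs (map_graph M)" "map_rev M a \<noteq> a" "map_rev M (map_rev M a) = a"
    "tail (map_graph M) (map_rev M a) = head (map_graph M) a"
    "head (map_graph M) (map_rev M a) = tail (map_graph M) a"
    using assms(2) arev_neq by simp_all
qed

lemma rooted_map_out_arcs:
  assumes "is_rooted_map M" "a \<in> arcs (map_graph M)"
  shows "out_arcs (map_graph M) (tail (map_graph M) a) = orbit (map_rot M) a"
proof -
  have "a \<in> out_arcs (map_graph M) (tail (map_graph M) a)"
    using assms(2) by simp
  moreover from this have "cyclic_on (map_rot M) (out_arcs (map_graph M) (tail (map_graph M) a))"
    using assms is_rooted_map_closed(3)[OF assms] unfolding is_rooted_map_def by blast
  ultimately show ?thesis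
    by (metis orbit_cyclic_eq3)
qed

text \<open>A set closed under the rotation contains all arcs at a vertex or none;
  \<open>map_rev\<close> carries it across an edge. Nonemptiness also excludes isolated
  vertices.\<close>

lemma rooted_map_connected:
  assumes M: "is_rooted_map M" and B: "map_root M \<in> B"
    "\<And>a. a \<in> B \<Longrightarrow> a \<in> arcs (map_graph M) \<Longrightarrow> map_rev M a \<in> B"
    "\<And>a. a \<in> B \<Longrightarrow> a \<in> arcs (map_graph M) \<Longrightarrow> map_rot M a \<in> B"
    and v: "v \<in> verts (map_graph M)"
  shows "out_arcs (map_graph M) v \<noteq> {} \<and> out_arcs (map_graph M) v \<subseteq> B"
proof -
  let ?G = "map_graph M"
  have orbit: "out_arcs ?G (tail ?G a) \<noteq> {} \<and> out_arcs ?G (tail ?G a) \<subseteq> B"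
    if a: "a \<in> B" "a \<in> arcs ?G" for a
  proof -
    have "x \<in> B \<and> x \<in> arcs ?G" if "x \<in> orbit (map_rot M) a" for x
      using that by induction (use a B(3) is_rooted_map_closed(2)[OF M] in auto)
    moreover have "a \<in> out_arcs ?G (tail ?G a)"
      using a by simp
    ultimately show ?thesis
      unfolding rooted_map_out_arcs[OF M a(2)] by blast
  qed
  have root: "map_root M \<in> arcs ?G"
    using M by (simp add: is_rooted_map_def)
  have "(tail ?G (map_root M), v) \<in> rtrancl_on (verts ?G) (parcs (mk_symmetric ?G))"
    using M v is_rooted_map_closed(3)[OF M root]
    unfolding is_rooted_map_def Digraph_Component.connected_def strongly_connected_def reachable_def
    by simp
  then show ?thesis
  proof (induction rule: rtrancl_on_induct)
    case base
    show ?case using orbit[OF B(1) root] .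
  next
    case (step u w)
    have "\<exists>e\<in>arcs ?G. tail ?G e = u \<and> head ?G e = w"
      using step.hyps(2) rooted_map_rev[OF M] by (auto simp: parcs_mk_symmetric) metis+
    then obtain e where e: "e \<in> arcs ?G" "tail ?G e = u" "head ?G e = w"
      by blast
    then have "e \<in> B"
      using step.IH by auto
    then show ?case
      using orbit[of "map_rev M e"] B(2)[of e] e rooted_map_rev[OF M e(1)] by simp
  qed
qed

lemma rooted_map_verts:
  assumes "is_rooted_map M"
  shows "verts (map_graph M) = tail (map_graph M) ` arcs (map_graph M)"
proof -
  have "out_arcs (map_graph M) v \<noteq> {}" if "v \<in> verts (map_graph M)" for v
    using rooted_map_connected[OF assms, of UNIV v] that by simp
  then show ?thesis
    using is_rooted_map_closed(3)[OF assms] by (fastforce simp: out_arcs_def)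
qed

text \<open>\<open>n\<close> is kept apart because the letters of \<open>c\<close> do not record the
  degree of the root vertex. The root enters as the start of the list.\<close>

definition map_code :: "('v, 'a) map_rep \<Rightarrow> nat \<Rightarrow> exploration_step list \<Rightarrow> bool" where
  "map_code M n c \<longleftrightarrow> (\<exists>ys K. n = length ys + 1 \<and>
     map (map_rot M) (map_root M # ys) = ys @ [map_root M] \<and>
     set (map_root M # ys) \<union> K = arcs (map_graph M) \<and>
     explores (map_rev M) (map_rot M) (map_root M # ys) K c)"

lemma map_code_exists:
  assumes M: "is_rooted_map M"
  shows "\<exists>n c. map_code M n c"
proof -
  let ?A = "arcs (map_graph M)" and ?r = "map_root M"
  have fin: "finite ?A"
    using M by (simp add: is_rooted_map_def fin_digraph.finite_arcs)
  have bij: "bij_betw (map_rot M) ?A ?A"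
    using M by (simp add: is_rooted_map_def permutes_imp_bij)
  have r: "?r \<in> ?A"
    using M by (simp add: is_rooted_map_def)
  obtain ys where ys: "distinct (?r # ys)" "set (?r # ys) \<subseteq> ?A" "map (map_rot M) (?r # ys) = ys @ [?r]"
    using ex_cycle[OF fin bij r] by blast
  define K where "K = ?A - set (?r # ys)"
  have A: "set (?r # ys) \<union> K = ?A"
    using ys(2) by (auto simp: K_def)
  have "\<exists>c. explores (map_rev M) (map_rot M) (?r # ys) K c"
  proof (rule explores_exists)
    show "bij_betw (map_rot M) K K"
      unfolding K_def by (rule bij_betw_DiffI[OF bij bij_betw_cycle[OF ys(1,3)]]) (use ys(2) in auto)
    show "map_rev M h \<in> set (?r # ys) \<union> K \<and> map_rev M h \<noteq> h \<and> map_rev M (map_rev M h) = h"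
      if "h \<in> set (?r # ys) \<union> K" for h
      using rooted_map_rev[OF M, of h] that unfolding A by simp
    show "K \<subseteq> B" if B: "set (?r # ys) \<subseteq> B"
      "\<And>h. h \<in> B \<Longrightarrow> h \<in> set (?r # ys) \<union> K \<Longrightarrow> map_rev M h \<in> B" "\<And>h. h \<in> B \<Longrightarrow> h \<in> K \<Longrightarrow> map_rot M h \<in> B" for B
    proof -
      have rot: "map_rot M h \<in> B" if "h \<in> B" "h \<in> ?A" for h
      proof (cases "h \<in> K")
        case False
        then have "map_rot M h \<in> set (?r # ys)"
          using that bij_betw_apply[OF bij_betw_cycle[OF ys(1,3)], of h] by (auto simp: K_def)
        then show ?thesis using B(1) by blast
      qed (use B(3) that in auto)
      have "a \<in> B" if a: "a \<in> ?A" for a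
      proof -
        have "out_arcs (map_graph M) (tail (map_graph M) a) \<subseteq> B"
          by (rule conjunct2[OF rooted_map_connected[OF M]])
            (use B rot a A is_rooted_map_closed(3)[OF M a] in auto)
        then show ?thesis using a by auto
      qed
      then show ?thesis using A by blast
    qed
  qed (use ys fin in \<open>auto simp: K_def\<close>)
  then show ?thesis
    using ys(3) A unfolding map_code_def by blast
qed

lemma map_code_unique:
  assumes "map_code M n c" "map_code M n' c'"
  shows "n = n' \<and> c = c'"
proof -
  obtain ys K ys' K' where ys: "n = length ys + 1" "map (map_rot M) (map_root M # ys) = ys @ [map_root M]"
      "explores (map_rev M) (map_rot M) (map_root M # ys) K c"
    and ys': "n' = length ys' + 1" "map (map_rot M) (map_root M # ys') = ys' @ [map_root M]"
      "explores (map_rev M) (map_rot M) (map_root M # ys') K' c'"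
    using assms unfolding map_code_def by blast
  have "ys = ys'"
    using explores_wf[OF ys(3)] explores_wf[OF ys'(3)] by (intro cycle_unique[OF ys(2) ys'(2)]) auto
  then show ?thesis
    using explores_unique[OF ys(3)] ys ys' by blast
qed

lemma map_code_valid:
  assumes "map_code M n c"
  shows "n \<ge> 1 \<and> valid_code n c"
  using assms explores_wf unfolding map_code_def by fastforce

lemma map_code_iso:
  assumes M: "is_rooted_map M" and iso: "map_iso_by f h M N" and code: "map_code M n c"
  shows "map_code N n c"
proof -
  let ?r = "map_root M"
  obtain ys K where ys: "n = length ys + 1" "map (map_rot M) (?r # ys) = ys @ [?r]"
      "set (?r # ys) \<union> K = arcs (map_graph M)" "explores (map_rev M) (map_rot M) (?r # ys) K c"
    using code unfolding map_code_def by blast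
  have h: "inj_on h (arcs (map_graph M))" "arcs (map_graph N) = h ` arcs (map_graph M)" "map_root N = h ?r"
    and comm: "\<And>a. a \<in> arcs (map_graph M) \<Longrightarrow> map_rev N (h a) = h (map_rev M a) \<and> map_rot N (h a) = h (map_rot M a)"
    using iso by (auto simp: map_iso_by_def bij_betw_def)
  have "explores (map_rev N) (map_rot N) (map h (?r # ys)) (h ` K) c"
    by (rule explores_image[OF ys(4)]) (use h comm ys(3) in auto)
  moreover have "map (map_rot N) (map h (?r # ys)) = map h (map (map_rot M) (?r # ys))"
    using comm ys(3) by auto
  then have "map (map_rot N) (h ?r # map h ys) = map h ys @ [h ?r]"
    unfolding ys(2) by simp
  moreover have "set (h ?r # map h ys) \<union> h ` K = arcs (map_graph N)"
    unfolding h(2) ys(3)[symmetric] by auto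
  ultimately show ?thesis
    unfolding map_code_def h(3) using ys(1) by (intro exI[of _ "map h ys"] exI[of _ "h ` K"]) simp
qed

text \<open>Aligned explorations give a bijection of arcs; it carries rotation orbits to rotation
  orbits, and these are the vertices.\<close>

lemma map_code_eq_imp_iso:
  assumes M: "is_rooted_map M" and N: "is_rooted_map N" and "map_code M n c" "map_code N n c"
  shows "map_iso M N"
proof -
  let ?r = "map_root M" and ?s = "map_root N"
  obtain ys K zs K' where ys: "n = length ys + 1" "map (map_rot M) (?r # ys) = ys @ [?r]"
      "set (?r # ys) \<union> K = arcs (map_graph M)" "explores (map_rev M) (map_rot M) (?r # ys) K c"
    and zs: "n = length zs + 1" "map (map_rot N) (?s # zs) = zs @ [?s]"
      "set (?s # zs) \<union> K' = arcs (map_graph N)" "explores (map_rev N) (map_rot N) (?s # zs) K' c"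
    using assms(3,4) unfolding map_code_def by blast
  obtain \<phi> where \<phi>: "bij_betw \<phi> (set (?r # ys) \<union> K) (set (?s # zs) \<union> K')" "map \<phi> (?r # ys) = ?s # zs"
    "\<forall>h\<in>set (?r # ys) \<union> K. map_rev N (\<phi> h) = \<phi> (map_rev M h)" "\<forall>h\<in>K. map_rot N (\<phi> h) = \<phi> (map_rot M h)"
    using explores_iso[OF ys(4) zs(4)] ys(1) zs(1) by auto
  let ?G = "map_graph M" and ?H = "map_graph N"
  have bij: "bij_betw \<phi> (arcs ?G) (arcs ?H)"
    using \<phi>(1) unfolding ys(3) zs(3) .
  have \<phi>_arcs: "\<phi> a \<in> arcs ?H" if "a \<in> arcs ?G" for a
    using bij that by (rule bij_betw_apply)
  have rev: "map_rev N (\<phi> a) = \<phi> (map_rev M a)" if "a \<in> arcs ?G" for a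
    using \<phi>(3) that unfolding ys(3) by blast
  \<comment> \<open>\<open>explores_iso\<close> covers the rotation on \<open>K\<close> only; at the
    root vertex the aligned lists supply it.\<close>
  have rot: "map_rot N (\<phi> a) = \<phi> (map_rot M a)" if "a \<in> arcs ?G" for a
  proof (cases "a \<in> K")
    case False
    then have a: "a \<in> set (?r # ys)"
      using that ys(3) by blast
    have "map (map_rot N) (map \<phi> (?r # ys)) = map \<phi> (map (map_rot M) (?r # ys))"
      unfolding ys(2) using zs(2) \<phi>(2) by simp
    then show ?thesis
      using a by auto
  qed (use \<phi>(4) in blast)
  have orbit: "\<phi> ` orbit (map_rot M) a = orbit (map_rot N) (\<phi> a)" if a: "a \<in> arcs ?G" for a
  proof (rule orbit_inverse)
    show "a \<in> orbit (map_rot M) a"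
      unfolding rooted_map_out_arcs[OF M a, symmetric] using a by simp
    show "map_rot N (\<phi> x) = \<phi> (map_rot M x)" if "x \<in> orbit (map_rot M) a" for x
      using that unfolding rooted_map_out_arcs[OF M a, symmetric] by (auto intro: rot)
  qed
  have tail_iff: "tail ?H (\<phi> a) = tail ?H (\<phi> b) \<longleftrightarrow> tail ?G a = tail ?G b"
    if ab: "a \<in> arcs ?G" "b \<in> arcs ?G" for a b
  proof -
    have "tail ?H (\<phi> a) = tail ?H (\<phi> b) \<longleftrightarrow> \<phi> b \<in> out_arcs ?H (tail ?H (\<phi> a))"
      using \<phi>_arcs[OF ab(2)] by auto
    also have "\<dots> \<longleftrightarrow> \<phi> b \<in> \<phi> ` out_arcs ?G (tail ?G a)"
      unfolding rooted_map_out_arcs[OF N \<phi>_arcs[OF ab(1)]] rooted_map_out_arcs[OF M ab(1)] orbit[OF ab(1)] ..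
    also have "\<dots> \<longleftrightarrow> b \<in> out_arcs ?G (tail ?G a)"
      by (rule inj_on_image_mem_iff[OF bij_betw_imp_inj_on[OF bij] ab(2)]) auto
    finally show ?thesis
      using ab(2) by auto
  qed
  \<comment> \<open>Any outgoing arc may represent the vertex, by \<open>tail_iff\<close>.\<close>
  define f where "f v = tail ?H (\<phi> (SOME a. a \<in> out_arcs ?G v))" for v
  have f: "f (tail ?G a) = tail ?H (\<phi> a)" if a: "a \<in> arcs ?G" for a
  proof -
    define b where "b = (SOME b. b \<in> out_arcs ?G (tail ?G a))"
    have "a \<in> out_arcs ?G (tail ?G a)"
      using a by simp
    then have "b \<in> out_arcs ?G (tail ?G a)"
      unfolding b_def by (rule someI)
    then have "tail ?H (\<phi> b) = tail ?H (\<phi> a)"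
      using tail_iff[OF _ a, of b] by simp
    then show ?thesis
      unfolding f_def b_def .
  qed
  have "bij_betw f (verts ?G) (verts ?H)"
    unfolding bij_betw_def
  proof
    show "inj_on f (verts ?G)"
      unfolding rooted_map_verts[OF M] using f tail_iff by (auto intro!: inj_onI)
    show "f ` verts ?G = verts ?H"
      unfolding rooted_map_verts[OF M] rooted_map_verts[OF N] bij_betw_imp_surj_on[OF bij, symmetric] image_image
      using f by (intro image_cong) auto
  qed
  moreover have "head ?H (\<phi> a) = f (head ?G a)" if a: "a \<in> arcs ?G" for a
    using f[of "map_rev M a"] rooted_map_rev[OF M a] rooted_map_rev(4)[OF N \<phi>_arcs[OF a]] rev[OF a] by simp
  moreover have "?s = \<phi> ?r"
    using \<phi>(2) by simp
  ultimately show ?thesis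
    unfolding map_iso_def map_iso_by_def using bij f rev rot by metis
qed

text \<open>\<open>Visit d\<close> absorbs one whole vertex, the orbit of the partner; its cycle has
  length \<open>d\<close> and misses the remaining \<open>K\<close>.\<close>

lemma explores_degrees:
  assumes "explores (map_rev M) (map_rot M) L K c" and M: "is_rooted_map M" and "K \<subseteq> arcs (map_graph M)"
  shows "image_mset (out_degree (map_graph M)) (mset_set (tail (map_graph M) ` K)) = code_degrees c"
  using assms(1,3)
proof induction
  case (Visit ys vs K c a b)
  let ?G = "map_graph M"
  have b: "b \<in> arcs ?G" and K: "K \<subseteq> arcs ?G"
    using Visit.prems by auto
  have wf: "distinct (ys @ vs)" "set ys \<inter> K = {}" "finite K"
    using explores_wf[OF Visit.hyps(1)] by auto
  have out: "out_arcs ?G (tail ?G b) = set (b # ys)"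
    unfolding rooted_map_out_arcs[OF M b] by (rule orbit_cycle[OF Visit.hyps(7)])
  have "tail ?G x = tail ?G b" if "x \<in> set ys" for x
    using out that by (auto simp: out_arcs_def)
  then have im: "tail ?G ` (set (b # ys) \<union> K) = insert (tail ?G b) (tail ?G ` K)"
    by auto
  have "tail ?G b \<notin> tail ?G ` K"
  proof
    assume "tail ?G b \<in> tail ?G ` K"
    then obtain x where "x \<in> K" "tail ?G x = tail ?G b"
      by auto
    then have "x \<in> set (b # ys)"
      unfolding out[symmetric] using K by auto
    then show False
      using \<open>x \<in> K\<close> wf Visit.hyps(3) by auto
  qed
  moreover have "out_degree ?G (tail ?G b) = length ys + 1"
    unfolding out_degree_def out using distinct_card[of "b # ys"] wf(1) Visit.hyps(3) by simp
  ultimately show ?case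
    unfolding im using Visit.IH[OF K] wf(3) by simp
qed simp_all

lemma map_code_degrees:
  assumes M: "is_rooted_map M" and "map_code M n c"
  shows "rep_vertex_degrees M = add_mset n (code_degrees c)"
proof -
  let ?G = "map_graph M" and ?r = "map_root M"
  obtain ys K where ys: "n = length ys + 1" "map (map_rot M) (?r # ys) = ys @ [?r]"
      "set (?r # ys) \<union> K = arcs ?G" "explores (map_rev M) (map_rot M) (?r # ys) K c"
    using assms(2) unfolding map_code_def by blast
  have wf: "distinct (?r # ys)" "set (?r # ys) \<inter> K = {}" "finite K"
    using explores_wf[OF ys(4)] by blast+
  have r: "?r \<in> arcs ?G" and K: "K \<subseteq> arcs ?G"
    using ys(3) by auto
  have out: "out_arcs ?G (tail ?G ?r) = set (?r # ys)"
    unfolding rooted_map_out_arcs[OF M r] by (rule orbit_cycle[OF ys(2)])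
  have "tail ?G x = tail ?G ?r" if "x \<in> set ys" for x
    using out that by (auto simp: out_arcs_def)
  then have verts: "verts ?G = insert (tail ?G ?r) (tail ?G ` K)"
    unfolding rooted_map_verts[OF M] ys(3)[symmetric] by auto
  have "tail ?G ?r \<notin> tail ?G ` K"
  proof
    assume "tail ?G ?r \<in> tail ?G ` K"
    then obtain x where "x \<in> K" "tail ?G x = tail ?G ?r"
      by auto
    then have "x \<in> set (?r # ys)"
      unfolding out[symmetric] using K by auto
    then show False
      using \<open>x \<in> K\<close> wf(2) by blast
  qed
  moreover have "out_degree ?G (tail ?G ?r) = n"
    unfolding out_degree_def out using distinct_card[OF wf(1)] ys(1) by simp
  ultimately show ?thesis
    unfolding rep_vertex_degrees_def verts using explores_degrees[OF ys(4) M K] wf(3) by simp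
qed

lemma ex_map_of_code:
  assumes "valid_code n c" "n \<ge> 1"
  shows "\<exists>M :: (nat, nat) map_rep. is_rooted_map M \<and> map_code M n c"
proof -
  obtain \<alpha> \<sigma> and L :: "nat list" and K where e: "explores \<alpha> \<sigma> L K c" "length L = n"
    using explores_realizable[OF assms(1)] by blast
  obtain r ys where L: "L = r # ys"
    using e(2) assms(2) by (cases L) auto
  have wf: "distinct L" "finite K" "set L \<inter> K = {}" "bij_betw \<sigma> K K"
    "\<And>h. h \<in> set L \<union> K \<Longrightarrow> \<alpha> h \<in> set L \<union> K \<and> \<alpha> h \<noteq> h \<and> \<alpha> (\<alpha> h) = h"
    using explores_wf[OF e(1)] by auto
  define A where "A = set L \<union> K"
  \<comment> \<open>\<open>bidirected_digraph\<close> requires that exactly the arcs are moved,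
    hence the identity outside \<open>A\<close>.\<close>
  define rev where "rev a = (if a \<in> A then \<alpha> a else a)" for a
  \<comment> \<open>The exploration constrains no rotation at the root vertex; here \<open>L\<close>
    is closed up into a cycle.\<close>
  obtain \<tau> where \<tau>: "map \<tau> L = ys @ [r]" "\<And>x. x \<notin> set L \<Longrightarrow> \<tau> x = (if x \<in> K then \<sigma> x else x)"
    using ex_fun_map[OF wf(1), of "ys @ [r]" "\<lambda>x. if x \<in> K then \<sigma> x else x"] L by auto
  have \<tau>K: "\<tau> x = \<sigma> x" if "x \<in> K" for x
    using \<tau>(2)[of x] that wf(3) by auto
  have "bij_betw \<tau> (set L) (set L)"
    using bij_betw_cycle[of r ys \<tau>] wf(1) \<tau>(1) L by simp
  moreover have "bij_betw \<tau> K K"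
    using wf(4) \<tau>K by (subst bij_betw_cong[of _ \<tau> \<sigma>]) auto
  ultimately have bij: "bij_betw \<tau> A A"
    unfolding A_def using wf(3) by (rule bij_betw_combine)
  have perm: "\<tau> permutes A"
    by (rule bij_imp_permutes[OF bij]) (use \<tau>(2) in \<open>auto simp: A_def\<close>)
  have fin: "finite A"
    using wf(2) by (simp add: A_def)
  then have permutation: "permutation \<tau>"
    using perm by (auto simp: permutation_permutes)
  \<comment> \<open>Vertices are the rotation orbits, each named by its least half-edge to get
    natural-number labels.\<close>
  define rep where "rep a = (LEAST b. b \<in> orbit \<tau> a)" for a
  have rep_in: "rep a \<in> orbit \<tau> a" for a
    unfolding rep_def using orbit.base[of \<tau> a] by (rule LeastI)
  have orbit_rep: "orbit \<tau> (rep a) = orbit \<tau> a" for a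
    using rep_in[of a] cyclic_on_orbit'[OF permutation, of a] by (metis orbit_cyclic_eq3)
  have rep_iff: "rep a = rep b \<longleftrightarrow> a \<in> orbit \<tau> b" for a b
  proof
    assume "rep a = rep b"
    then have "orbit \<tau> a = orbit \<tau> b"
      using orbit_rep by metis
    then show "a \<in> orbit \<tau> b"
      using permutation_self_in_orbit[OF permutation, of a] by simp
  next
    assume "a \<in> orbit \<tau> b"
    then have "orbit \<tau> a = orbit \<tau> b"
      using cyclic_on_orbit'[OF permutation, of b] by (metis orbit_cyclic_eq3)
    then show "rep a = rep b"
      by (simp add: rep_def)
  qed
  have rep_\<tau>: "rep (\<tau> a) = rep a" for a
    unfolding rep_iff by (rule orbit.base)
  define G :: "(nat, nat) pre_digraph" where
    "G = \<lparr>verts = rep ` A, arcs = A, tail = rep, head = (\<lambda>a. rep (rev a))\<rparr>"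
  define M where "M = \<lparr>map_graph = G, map_rev = rev, map_rot = \<tau>, map_root = r\<rparr>"
  have rev: "rev a \<in> A" "rev a \<noteq> a" "rev (rev a) = a" if "a \<in> A" for a
    using wf(5)[of a] that by (auto simp: rev_def A_def)
  have rA: "r \<in> A"
    by (simp add: A_def L)
  have G: "wf_digraph G"
    by unfold_locales (auto simp: G_def rev)
  have "fin_digraph G"
    using G fin by (auto simp: fin_digraph_def fin_digraph_axioms_def G_def)
  moreover have "bidirected_digraph G rev"
    using G by (rule wf_digraph.bidirected_digraphI) (auto simp: G_def rev, simp add: rev_def)
  moreover have "Digraph_Component.connected G"
  proof -
    let ?S = "with_proj (mk_symmetric G)"
    \<comment> \<open>The half-edges at vertices reachable from the root;
      \<open>explores_connected\<close> then shows that they are all.\<close>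
    define B where "B = {a. rep r \<rightarrow>\<^sup>*\<^bsub>?S\<^esub> rep a}"
    have "r \<in> B"
      using rA by (auto simp: B_def reachable_def G_def)
    have step: "rep (rev a) \<in> verts G \<and> (rep a, rep (rev a)) \<in> parcs (mk_symmetric G)" if "a \<in> A" for a
      using that rev(1) by (auto simp: parcs_mk_symmetric G_def)
    have L_B: "set L \<subseteq> B"
    proof
      fix x assume "x \<in> set L"
      then have "x \<in> orbit \<tau> r"
        using orbit_cycle[of \<tau> r ys] \<tau>(1) L by simp
      then have "rep x = rep r"
        by (simp only: rep_iff)
      then show "x \<in> B"
        using \<open>r \<in> B\<close> by (simp add: B_def)
    qed
    have "K \<subseteq> B"
    proof (rule explores_connected[OF e(1)])
      show "set L \<subseteq> B" by (rule L_B)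
      show "\<alpha> h \<in> B" if h: "h \<in> B" "h \<in> set L \<union> K" for h
      proof -
        have "h \<in> A"
          using h(2) by (simp add: A_def)
        then show ?thesis
          using h(1) step[of h] unfolding B_def reachable_def
          by (auto simp: rev_def intro: rtrancl_on_into_rtrancl_on)
      qed
      show "\<sigma> h \<in> B" if "h \<in> B" "h \<in> K" for h
        using that rep_\<tau>[of h] \<tau>K[of h] by (simp add: B_def)
    qed
    then have reach: "rep r \<rightarrow>\<^sup>*\<^bsub>?S\<^esub> v" if "v \<in> verts G" for v
      using that L_B by (auto simp: G_def A_def B_def)
    have "u \<rightarrow>\<^sup>*\<^bsub>?S\<^esub> v" if "u \<in> verts G" "v \<in> verts G" for u v
    proof -
      have "u \<rightarrow>\<^sup>*\<^bsub>?S\<^esub> rep r"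
        by (rule symmetric_reachable[OF symmetric_mk_symmetric reach[OF that(1)]])
      then show ?thesis
        using reach[OF that(2)] unfolding reachable_def by (rule rtrancl_on_trans)
    qed
    then show ?thesis
      unfolding Digraph_Component.connected_def strongly_connected_def using rA by (auto simp: G_def)
  qed
  moreover have "cyclic_on \<tau> (out_arcs G v)" if "v \<in> verts G" for v
  proof -
    obtain a where a: "a \<in> A" "v = rep a"
      using \<open>v \<in> verts G\<close> by (auto simp: G_def)
    have "out_arcs G v = orbit \<tau> a"
      using permutes_orbit_subset[OF perm a(1)] rep_iff a(2) by (auto simp: G_def out_arcs_def)
    then show ?thesis
      using cyclic_on_orbit'[OF permutation] by simp
  qed
  ultimately have "is_rooted_map M"
    using perm rA by (simp add: is_rooted_map_def M_def) (simp add: G_def)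
  moreover have "map_code M n c"
    unfolding map_code_def
  proof (intro exI conjI)
    show "n = length ys + 1"
      using e(2) L by simp
    show "map (map_rot M) (map_root M # ys) = ys @ [map_root M]"
      using \<tau>(1) L by (simp add: M_def)
    show "set (map_root M # ys) \<union> K = arcs (map_graph M)"
      by (simp add: M_def G_def A_def L)
    show "explores (map_rev M) (map_rot M) (map_root M # ys) K c"
    proof -
      have "explores rev \<tau> L K c"
        by (rule explores_cong[OF e(1)]) (auto simp: rev_def A_def \<tau>K)
      then show ?thesis
        by (simp add: M_def L)
    qed
  qed
  ultimately show ?thesis by blast
qed

definition map_of_code :: "nat \<times> exploration_step list \<Rightarrow> rooted_map" where
  "map_of_code = (\<lambda>(n, c). abs_rooted_map (SOME M. is_rooted_map M \<and> map_code M n c))"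

lemma map_equiv_refl: "is_rooted_map M \<Longrightarrow> map_equiv M M"
  using map_iso_by_id by (auto simp: map_equiv_def map_iso_def)

lemma map_of_code:
  assumes "valid_code n c" "n \<ge> 1"
  obtains M where "map_of_code (n, c) = abs_rooted_map M" "is_rooted_map M" "map_code M n c"
proof
  let ?M = "SOME M :: (nat, nat) map_rep. is_rooted_map M \<and> map_code M n c"
  show "map_of_code (n, c) = abs_rooted_map ?M"
    by (simp add: map_of_code_def)
  show "is_rooted_map ?M" "map_code ?M n c"
    using someI_ex[OF ex_map_of_code[OF assms]] by blast+
qed

lemma vertex_degrees_map_of_code:
  assumes "valid_code n c" "n \<ge> 1"
  shows "vertex_degrees (map_of_code (n, c)) = add_mset n (code_degrees c)"
proof -
  obtain M where M: "map_of_code (n, c) = abs_rooted_map M" "is_rooted_map M" "map_code M n c"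
    using map_of_code[OF assms] .
  then show ?thesis
    using map_code_degrees[OF M(2,3)] vertex_degrees.abs_eq[OF map_equiv_refl[OF M(2)]] by simp
qed

text \<open>The code is a complete invariant: isomorphism invariance and uniqueness give
  injectivity, while equal codes forcing isomorphism gives surjectivity.\<close>

lemma map_of_code_bij: "bij_betw map_of_code {(n, c). n \<ge> 1 \<and> valid_code n c} UNIV"
  unfolding bij_betw_def
proof (intro conjI equalityI subsetI)
  show "inj_on map_of_code {(n, c). n \<ge> 1 \<and> valid_code n c}"
  proof (rule inj_onI, clarify)
    fix n c n' c'
    assume "valid_code n c" "n \<ge> 1" "valid_code n' c'" "n' \<ge> 1" and eq: "map_of_code (n, c) = map_of_code (n', c')"
    then obtain M M' where M: "map_of_code (n, c) = abs_rooted_map M" "is_rooted_map M" "map_code M n c"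
      and M': "map_of_code (n', c') = abs_rooted_map M'" "is_rooted_map M'" "map_code M' n' c'"
      using map_of_code by metis
    then have "map_equiv M M'"
      using eq Quotient3_rel[OF Quotient3_rooted_map] map_equiv_refl by metis
    then show "n = n' \<and> c = c'"
      using map_code_iso[OF M(2) _ M(3)] map_code_unique M'(3) unfolding map_equiv_def map_iso_def by metis
  qed
next
  fix m :: rooted_map
  let ?M = "rep_rooted_map m"
  have "map_equiv ?M ?M"
    by (rule Quotient3_rep_reflp[OF Quotient3_rooted_map])
  then have M: "is_rooted_map ?M"
    by (simp add: map_equiv_def)
  then obtain n c where code: "map_code ?M n c"
    using map_code_exists by blast
  note valid = map_code_valid[OF code]
  then obtain N where N: "map_of_code (n, c) = abs_rooted_map N" "is_rooted_map N" "map_code N n c"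
    using map_of_code by metis
  have "map_equiv ?M N"
    using map_code_eq_imp_iso[OF M N(2) code N(3)] M N(2) by (simp add: map_equiv_def)
  then have "m = map_of_code (n, c)"
    unfolding N(1) using Quotient3_rel_abs[OF Quotient3_rooted_map] Quotient3_abs_rep[OF Quotient3_rooted_map] by metis
  then show "m \<in> map_of_code ` {(n, c). n \<ge> 1 \<and> valid_code n c}"
    using valid by blast
qed simp

lemma enumerated_maps:
  assumes "r_system r"
  shows "enumerated_by rooted_eulerian_maps emap_degrees (r 1)"
proof -
  let ?A = "Sigma UNIV (\<lambda>k. eulerian_codes (2 * (k + 1)))"
  let ?D = "\<lambda>(k, c). add_mset (2 * (k + 1)) (code_degrees c)"
  let ?f = "\<lambda>(k, c). Some (map_of_code (2 * (k + 1), c))"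
  have deg: "emap_degrees (?f z) = ?D z" if "z \<in> ?A" for z
    using that vertex_degrees_map_of_code by (auto simp: emap_degrees_def eulerian_codes_def)
  have inj: "inj_on ?f ?A"
  proof (rule inj_onI, clarsimp)
    fix k c k' c'
    assume "c \<in> eulerian_codes (Suc (Suc (2 * k)))" "c' \<in> eulerian_codes (Suc (Suc (2 * k')))"
      "map_of_code (Suc (Suc (2 * k)), c) = map_of_code (Suc (Suc (2 * k')), c')"
    then have "(Suc (Suc (2 * k)), c) = (Suc (Suc (2 * k')), c')"
      by (intro inj_onD[OF bij_betw_imp_inj_on[OF map_of_code_bij]]) (auto simp: eulerian_codes_def)
    then show "k = k' \<and> c = c'"
      by simp
  qed
  have im: "?f ` ?A = Some ` {m. \<forall>d\<in>#vertex_degrees m. even d}"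
  proof (intro equalityI subsetI)
    fix x assume "x \<in> ?f ` ?A"
    then show "x \<in> Some ` {m. \<forall>d\<in>#vertex_degrees m. even d}"
      using vertex_degrees_map_of_code by (auto simp: eulerian_codes_def)
  next
    fix x assume "x \<in> Some ` {m. \<forall>d\<in>#vertex_degrees m. even d}"
    then obtain m where m: "x = Some m" "\<forall>d\<in>#vertex_degrees m. even d"
      by blast
    obtain n c where nc: "m = map_of_code (n, c)" "n \<ge> 1" "valid_code n c"
      using bij_betw_imp_surj_on[OF map_of_code_bij] by blast
    then have even: "even n" "\<forall>d\<in>#code_degrees c. even d"
      using m(2) vertex_degrees_map_of_code[OF nc(3,2)] by auto
    then obtain k where "n = 2 * (k + 1)"
      using nc(2) by (metis One_nat_def Suc_eq_plus1 dvdE mult_0_right not0_implies_Suc not_one_le_zero)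
    then show "x \<in> ?f ` ?A"
      using m nc even by (auto simp: eulerian_codes_def image_iff intro!: exI[of _ k] bexI[of _ c])
  qed
  have A: "graded_finite ?A ?D"
    by (rule graded_finite_vertices) (rule graded_finite_codes)
  have fin: "graded_finite (Some ` {m. \<forall>d\<in>#vertex_degrees m. even d}) emap_degrees"
    unfolding im[symmetric] using A deg by (rule graded_finite_image)
  have "wgf (Some ` {m. \<forall>d\<in>#vertex_degrees m. even d}) emap_degrees (\<lambda>_. 1) = wgf ?A ?D (\<lambda>_. 1)"
    unfolding im[symmetric] by (rule wgf_reindex[OF inj_on_imp_bij_betw[OF inj]]) (erule deg, rule refl)
  moreover have "wgf ({None} \<union> Some ` {m. \<forall>d\<in>#vertex_degrees m. even d}) emap_degrees (\<lambda>_. 1) =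
      wgf {None} emap_degrees (\<lambda>_. 1) + wgf (Some ` {m. \<forall>d\<in>#vertex_degrees m. even d}) emap_degrees (\<lambda>_. 1)"
    by (rule wgf_Un[OF _ fin]) auto
  \<comment> \<open>The trivial object accounts for the 1 added in
    \<open>root_codes_series\<close>.\<close>
  moreover have "wgf {None} emap_degrees (\<lambda>_. 1) = 1"
    by (subst wgf_singleton) (simp_all add: emap_degrees_def)
  ultimately have "wgf rooted_eulerian_maps emap_degrees (\<lambda>_. 1) = tree_series 1"
    using root_codes_series by (simp add: rooted_eulerian_maps_def add.commute)
  moreover have "r 1 = tree_series 1"
    by (rule r_system_unique[OF assms r_system_tree_series]) simp
  ultimately show ?thesis
    using fin by (simp add: enumerated_by_iff_wgf rooted_eulerian_maps_def)
qed

text \<open>Handshake count: the arcs are partitioned into pairs by edge and into outgoing sets by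
  tail.\<close>

lemma num_edges_eq_half_degree:
  assumes "\<forall>d\<in>#vertex_degrees m. even d"
  shows "num_edges m = half_degree (vertex_degrees m)"
proof -
  define M where "M = rep_rooted_map m"
  have eq: "map_equiv M M"
    unfolding M_def by (rule Quotient3_rep_reflp[OF Quotient3_rooted_map])
  then have M: "is_rooted_map M"
    by (simp add: map_equiv_def)
  have m: "m = abs_rooted_map M"
    unfolding M_def by (rule Quotient3_abs_rep[OF Quotient3_rooted_map, symmetric])
  let ?G = "map_graph M" and ?e = "\<lambda>a. {a, map_rev M a}"
  have fin: "finite (arcs ?G)" "finite (verts ?G)"
    using M by (simp_all add: is_rooted_map_def fin_digraph.finite_arcs fin_digraph.finite_verts)
  have deg: "vertex_degrees m = rep_vertex_degrees M" and edges: "num_edges m = rep_num_edges M"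
    unfolding m by (simp_all add: vertex_degrees.abs_eq[OF eq] num_edges.abs_eq[OF eq])
  have inj: "a = b" if "a \<in> arcs ?G" "b \<in> arcs ?G" "map_rev M a = map_rev M b" for a b
    using that rooted_map_rev(3)[OF M] by metis
  have "2 * card (?e ` arcs ?G) = card (\<Union>(?e ` arcs ?G))"
  proof (rule card_partition)
    show "finite (?e ` arcs ?G)"
      using fin by simp
    show "finite (\<Union>(?e ` arcs ?G))"
      using fin by auto
    show "card c = 2" if "c \<in> ?e ` arcs ?G" for c
      using that rooted_map_rev(2)[OF M] by (auto simp: card_2_iff)
    show "c \<inter> c' = {}" if "c \<in> ?e ` arcs ?G" "c' \<in> ?e ` arcs ?G" "c \<noteq> c'" for c c'
      using that rooted_map_rev(3)[OF M] by (auto dest: inj)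
  qed
  also have "\<Union>(?e ` arcs ?G) = (\<Union>v\<in>verts ?G. out_arcs ?G v)"
    using rooted_map_rev(1)[OF M] is_rooted_map_closed(3)[OF M] by auto
  also have "card \<dots> = (\<Sum>v\<in>verts ?G. out_degree ?G v)"
    unfolding out_degree_def using fin by (intro card_UN_disjoint) (auto simp: out_arcs_def)
  \<comment> \<open>Evenness of the degrees makes the integer halving lossless.\<close>
  also have "\<dots> = (\<Sum>v\<in>verts ?G. 2 * (out_degree ?G v div 2))"
    using assms fin unfolding deg rep_vertex_degrees_def by (intro sum.cong) auto
  also have "\<dots> = 2 * half_degree (vertex_degrees m)"
    unfolding deg rep_vertex_degrees_def half_degree_def sum_distrib_left[symmetric]
    by (simp add: sum_unfold_sum_mset image_mset.compositionality comp_def)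
  finally show ?thesis
    by (simp add: edges rep_num_edges_def)
qed

theorem theorem2:
  fixes r :: "nat \<Rightarrow> gpoly fps"
  assumes r: "r_system r"
  shows
    "(\<exists>\<phi> \<psi>.
        bij_betw \<phi> enriched_eulerian_trees matched_eulerian_trees \<and>
        bij_betw \<psi> matched_eulerian_trees rooted_eulerian_maps \<and>
        (\<forall>x \<in> enriched_eulerian_trees.
           (\<forall>k\<ge>1. count (node_degrees (fst (\<phi> x))) (2 * k) = count (node_degrees (fst x)) (2 * k)) \<and>
           half_degree (node_degrees (fst (\<phi> x))) = half_degree (node_degrees (fst x))) \<and>
        (\<forall>y \<in> matched_eulerian_trees.
           (\<forall>k\<ge>1. count (emap_degrees (\<psi> y)) (2 * k) = count (node_degrees (fst y)) (2 * k)) \<and>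
           half_degree (emap_degrees (\<psi> y)) = half_degree (node_degrees (fst y)))) \<and>
     (\<forall>m \<in> rooted_eulerian_maps. emap_edges m = half_degree (emap_degrees m)) \<and>
     enumerated_by enriched_eulerian_trees (\<lambda>x. node_degrees (fst x)) (r 1) \<and>
     enumerated_by matched_eulerian_trees (\<lambda>y. node_degrees (fst y)) (r 1) \<and>
     enumerated_by rooted_eulerian_maps emap_degrees (r 1)"
proof -
  have even: "even d" if "eulerian_tree T" "d \<in># node_degrees T" for T d
    using that by (auto simp: eulerian_tree_def node_degrees_def)
  have even1: "\<forall>x\<in>enriched_eulerian_trees. \<forall>d\<in>#node_degrees (fst x). even d"
    and even2: "\<forall>y\<in>matched_eulerian_trees. \<forall>d\<in>#node_degrees (fst y). even d"
    and even3: "\<forall>m\<in>rooted_eulerian_maps. \<forall>d\<in>#emap_degrees m. even d"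
    by (auto simp: enriched_eulerian_trees_def matched_eulerian_trees_def rooted_eulerian_maps_def
        emap_degrees_def dest: even)
  note enum = enumerated_trees[OF r] enumerated_maps[OF r]
  obtain \<phi> where \<phi>: "bij_betw \<phi> enriched_eulerian_trees matched_eulerian_trees"
    "\<forall>x\<in>enriched_eulerian_trees. node_degrees (fst (\<phi> x)) = node_degrees (fst x)"
    using bij_betw_enumerated[OF enum(1) even1 enum(2) even2] by blast
  obtain \<psi> where \<psi>: "bij_betw \<psi> matched_eulerian_trees rooted_eulerian_maps"
    "\<forall>y\<in>matched_eulerian_trees. emap_degrees (\<psi> y) = node_degrees (fst y)"
    using bij_betw_enumerated[OF enum(2) even2 enum(3) even3] by blast
  have "\<forall>m\<in>rooted_eulerian_maps. emap_edges m = half_degree (emap_degrees m)"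
    by (auto simp: rooted_eulerian_maps_def emap_edges_def emap_degrees_def num_edges_eq_half_degree)
  with enum \<phi> \<psi> show ?thesis
    by (intro conjI exI[of _ \<phi>] exI[of _ \<psi>]) simp_all
qed

end
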